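(* Let $N$ and $k$ be positive integers, and let $E_N := \big\{\sum_{n=1}^N t_n/n : t_1,\dots,t_N\in\{0,1\}\big\}$. Then: (i) if $\ln_2 N \ge 1$, then $\ln|E_N| \ge 2\ln 2\,\dfrac{N}{\ln N}$; (ii) if $\ln_3 N \ge 1$, then $\ln|E_N| \ge 2\ln 2\,\dfrac{N}{\ln N}\,\ln_3 N$; (iii) if $k\ge 4$ and $\ln_k N \ge 3/2$, then \[ \ln|E_N| \ge 2\ln 2\,\frac{N}{\ln N}\Big(1-\frac{3/2}{\ln_k N}\Big)\prod_{j=3}^{k}\ln_j N . \]
   Context: $\ln_k$ denotes the $k$-th iterate of the natural logarithm ($\ln_1=\ln$, $\ln_{k}=\ln\circ\ln_{k-1}$). $|S|$ denotes the cardinality of a finite set $S$. $E_N$ is the set of rational numbers representable as Egyptian fractions (sums of reciprocals of distinct positive integers, including the empty sum $0$) with denominators at most $N$. *)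

theory Defs
  imports "HOL-Analysis.Analysis"
begin

definition iter_ln :: "nat \<Rightarrow> real \<Rightarrow> real" where
  "iter_ln k x = (ln ^^ k) x"

(* HOL's ln is total, and it takes junk values on nonpositive arguments. Without this
   condition a hypothesis such as iter_ln 4 N \<ge> 3/2 could be satisfied through these. *)
definition iter_ln_defined :: "nat \<Rightarrow> real \<Rightarrow> bool" where
  "iter_ln_defined k x \<longleftrightarrow> (\<forall>j<k. iter_ln j x > 0)"

definition egyptian :: "nat \<Rightarrow> rat set" where
  "egyptian N = {\<Sum>n=1..N. of_nat (t n) / of_nat n |t :: nat \<Rightarrow> nat. \<forall>n\<in>{1..N}. t n \<in> {0, 1}}"

end

(* If p is a prime exceeding all numerators of sums of 1/m (m <= M) over a common denominator prime to p,
   then the terms 1/(p m) contribute a factor |E_M| to |E_N|, independently of the terms whose denominators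
   are prime to p. Taking M = floor(N/p), |E_N| is at least the product of |E_(floor(N/p))| over all such p.
   Grouping the primes by floor(N/p), this bounds log_2 |E_N| below by a sum over m of g(m) pi(N/m), where g
   is any weight whose partial sums are at most log_2 |E_m|. Explicit Chebyshev estimates turn a bound of
   order N/ln N for |E_m| with small m into one of order (N/ln N) ln_3 N. Repeating the argument gains one
   iterated logarithm each time, as the sum of 1/(m ln m) ln_3 m ... ln_k m over m <= ln N has order
   ln_3 N ... ln_(k+1) N. The constant 3/2 absorbs the losses of all the steps. For decreasing weights the
   lower bound for the prime counts is replaced by the asymptotically sharp mean value of psi(N/m) over m,
   so that no constant factor is lost. *)
theory Submission
  imports Defs "HOL-Number_Theory.Number_Theory"
begin

section \<open>Independence of the multiples of a prime\<close>

text \<open>All estimates are made for \<open>lgE\<close>, the logarithm to base 2, which turns the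
  factor 2 ln 2 into 2. Chebyshev's method only gives psi(n) >= 0.921 n up to lower-order terms. The
  bound by N / ln N is therefore proved with 2.18 in place of 2: since 2.18 * 0.921 > 2, this pays
  for the loss once, in the passage to ln_3. A constant factor lost at every further level could not
  be repaid. A prime is certainly large enough for M if it exceeds M * lcm {1..M}, which is
  exponential in M. So m runs up to a multiple of ln N only; the multiple 2/5 works because 2/5 * ln
  4 < 0.56 leaves a power of N for all error terms. At level j the bound is a product of iterated
  logarithms times t - \<kappa>, where t is the innermost one. The passage to the next level
  compares derivatives: the derivative of the new bound is the old bound plus lower-order terms, and
  these are absorbed by raising \<kappa>. Where the new bound is not positive there is nothing to
  prove, so each level only has to treat large N.\<close>

text \<open>Arbitrary sets of denominators are allowed because the set is enlarged one prime at a
  time.\<close>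

definition esums :: "nat set \<Rightarrow> rat set" where
  "esums W = (\<lambda>T. \<Sum>n\<in>T. 1 / of_nat n) ` Pow W"

lemma egyptian_eq_esums: "egyptian N = esums {1..N}"
proof (intro equalityI subsetI)
  fix x assume "x \<in> egyptian N"
  then obtain t :: "nat \<Rightarrow> nat" where t: "\<forall>n\<in>{1..N}. t n \<in> {0, 1}"
    and x: "x = (\<Sum>n=1..N. of_nat (t n) / of_nat n)"
    unfolding egyptian_def by blast
  have "x = (\<Sum>n\<in>{n\<in>{1..N}. t n = 1}. 1 / of_nat n)"
    unfolding x using t by (intro sum.mono_neutral_cong_right) auto
  then show "x \<in> esums {1..N}" unfolding esums_def by auto
next
  fix x assume "x \<in> esums {1..N}"
  then obtain T where T: "T \<subseteq> {1..N}" and x: "x = (\<Sum>n\<in>T. 1 / of_nat n)"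
    unfolding esums_def by auto
  have "x = (\<Sum>n=1..N. of_nat (if n \<in> T then 1 else 0) / of_nat n)"
    unfolding x using T by (intro sum.mono_neutral_cong_left) auto
  then show "x \<in> egyptian N" unfolding egyptian_def by (intro CollectI exI conjI) auto
qed

lemma finite_esums: "finite W \<Longrightarrow> finite (esums W)"
  by (simp add: esums_def)

lemma zero_in_esums: "0 \<in> esums W"
  unfolding esums_def by (rule image_eqI[of _ _ "{}"]) auto

lemma esums_mono: "V \<subseteq> W \<Longrightarrow> esums V \<subseteq> esums W"
  unfolding esums_def by (intro image_mono) auto

lemma card_esums_mono: "finite W \<Longrightarrow> V \<subseteq> W \<Longrightarrow> card (esums V) \<le> card (esums W)"
  by (intro card_mono finite_esums esums_mono)

lemma card_esums_pos: "finite W \<Longrightarrow> card (esums W) > 0"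
  using zero_in_esums finite_esums card_gt_0_iff by blast

lemma sum_reciprocals_common_denominator:
  fixes L :: nat
  assumes "finite T" "L > 0" "\<forall>n\<in>T. n dvd L"
  shows "(\<Sum>n\<in>T. 1 / of_nat n :: rat) = of_nat (\<Sum>n\<in>T. L div n) / of_nat L"
proof -
  have "(\<Sum>n\<in>T. 1 / of_nat n :: rat) = (\<Sum>n\<in>T. of_nat (L div n) / of_nat L)"
  proof (intro sum.cong refl)
    fix n assume "n \<in> T"
    then have "n dvd L" using assms by auto
    then obtain k where k: "L = n * k" by auto
    show "1 / of_nat n = (of_nat (L div n) / of_nat L :: rat)"
      using assms(2) unfolding k by auto
  qed
  then show ?thesis by (simp add: sum_divide_distrib)
qed

text \<open>Each \<open>w\<close> splits into a power of \<open>p\<close> with exponent at most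
  \<open>a\<close> and a part prime to \<open>p\<close>; \<open>D\<close> is the product of the
  latter parts.\<close>

lemma common_denominator_prime_part:
  fixes p a :: nat
  assumes "prime p" "finite W" "\<forall>w\<in>W. w > 0 \<and> \<not> p ^ Suc a dvd w"
  shows "\<exists>D>0. \<not> p dvd D \<and> (\<forall>w\<in>W. w dvd p ^ a * D)"
proof -
  define D where "D = (\<Prod>w\<in>W. w div p ^ multiplicity p w)"
  have dec: "p ^ multiplicity p w * (w div p ^ multiplicity p w) = w" for w
    by (rule dvd_mult_div_cancel) (rule multiplicity_dvd)
  have nd: "\<not> p dvd (w div p ^ multiplicity p w)" if "w \<in> W" for w
  proof -
    have "w \<noteq> 0" using assms(3) that by blast
    moreover have "\<not> is_unit p" using assms(1) by auto
    ultimately show ?thesis by (rule multiplicity_decompose)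
  qed
  have npD: "\<not> p dvd D"
    unfolding D_def using assms(1,2) nd by (simp add: prime_dvd_prod_iff)
  then have "D > 0" by (cases "D = 0") auto
  moreover have "\<forall>w\<in>W. w dvd p ^ a * D"
  proof
    fix w assume w: "w \<in> W"
    have "multiplicity p w \<le> a"
    proof (rule ccontr)
      assume "\<not> multiplicity p w \<le> a"
      then have "p ^ Suc a dvd w" by (intro multiplicity_dvd') simp
      with assms(3) w show False by blast
    qed
    then have "p ^ multiplicity p w dvd p ^ a" by (rule le_imp_power_dvd)
    moreover have "w div p ^ multiplicity p w dvd D"
      unfolding D_def using assms(2) w by (rule dvd_prodI)
    ultimately show "w dvd p ^ a * D" using mult_dvd_mono dec[of w] by metis
  qed
  ultimately show ?thesis using npD by blast
qed

text \<open>\<open>V\<close> is a family of selections from \<open>M\<close> whose numerators over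
  the common denominator \<open>L\<close> are pairwise incongruent modulo \<open>p\<close>. Only the
  residue of the numerator can be recovered once fractions with a lower power of \<open>p\<close>
  are added.\<close>

definition separated :: "nat \<Rightarrow> nat \<Rightarrow> nat set \<Rightarrow> nat set set \<Rightarrow> bool" where
  "separated p L M V \<longleftrightarrow> V \<subseteq> Pow M \<and> (\<forall>m\<in>M. m dvd L) \<and> \<not> p dvd L \<and>
     inj_on (\<lambda>v. (\<Sum>m\<in>v. L div m) mod p) V"

text \<open>Sums over \<open>W\<close> have denominator \<open>p ^ a * D\<close>. Clearing
  denominators in an equality of two combined sums multiplies the part from \<open>W\<close> by
  \<open>p\<close>, so modulo \<open>p\<close> only \<open>D\<close> times the numerator of
  \<open>v\<close> remains. As \<open>D\<close> is prime to \<open>p\<close>, this determines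
  \<open>v\<close>, and then \<open>s\<close>.\<close>

lemma card_esums_prime_power_step:
  fixes p a :: nat
  assumes p: "prime p" and W: "finite W" "\<forall>w\<in>W. w > 0 \<and> \<not> p ^ Suc a dvd w"
    and M: "finite M" and sep: "separated p L M V"
  shows "card (esums W) * card V \<le> card (esums (W \<union> (\<lambda>m. p ^ Suc a * m) ` M))"
proof -
  define q where "q = p ^ Suc a"
  have p0: "p > 0" using p by (simp add: prime_gt_0_nat)
  have q0: "q > 0" using p0 by (simp add: q_def)
  obtain D where D: "D > 0" "\<not> p dvd D" "\<forall>w\<in>W. w dvd p ^ a * D"
    using common_denominator_prime_part[OF p W] by blast
  have V: "V \<subseteq> Pow M" and L: "\<forall>m\<in>M. m dvd L" "\<not> p dvd L"
    and inj: "inj_on (\<lambda>v. (\<Sum>m\<in>v. L div m) mod p) V"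
    using sep by (auto simp: separated_def)
  have L0: "L > 0" using L(2) by (cases "L = 0") auto
  define \<nu> where "\<nu> v = (\<Sum>m\<in>v. L div m)" for v
  have vsum: "(\<Sum>m\<in>v. 1 / of_nat (q * m) :: rat) = of_nat (\<nu> v) / (of_nat q * of_nat L)" if "v \<in> V" for v
  proof -
    have "v \<subseteq> M" using V that by auto
    then have "finite v" "\<forall>m\<in>v. m dvd L" using M L finite_subset by blast+
    then have "(\<Sum>m\<in>v. 1 / of_nat m :: rat) = of_nat (\<nu> v) / of_nat L"
      unfolding \<nu>_def using L0 by (intro sum_reciprocals_common_denominator)
    moreover have "(\<Sum>m\<in>v. 1 / of_nat (q * m) :: rat) = (\<Sum>m\<in>v. 1 / of_nat m) / of_nat q"
      by (simp add: sum_divide_distrib mult.commute)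
    ultimately show ?thesis by simp
  qed
  define \<phi> :: "rat \<times> nat set \<Rightarrow> rat" where "\<phi> = (\<lambda>(s, v). s + (\<Sum>m\<in>v. 1 / of_nat (q * m)))"
  have img: "\<phi> ` (esums W \<times> V) \<subseteq> esums (W \<union> (\<lambda>m. q * m) ` M)"
  proof (clarsimp simp: \<phi>_def)
    fix s v assume s: "s \<in> esums W" and v: "v \<in> V"
    obtain T where T: "T \<subseteq> W" "s = (\<Sum>n\<in>T. 1 / of_nat n)" using s by (auto simp: esums_def)
    have vM: "v \<subseteq> M" using v V by auto
    have disj: "T \<inter> (\<lambda>m. q * m) ` v = {}"
    proof -
      have "\<not> q dvd w" if "w \<in> T" for w using T(1) W(2) that unfolding q_def by blast
      then have "q * m \<notin> T" for m using dvd_triv_left by blast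
      then show ?thesis by auto
    qed
    have fin: "finite T" "finite ((\<lambda>m. q * m) ` v)"
      using T(1) W(1) vM M finite_subset by blast+
    have "(\<Sum>n\<in>T \<union> (\<lambda>m. q * m) ` v. 1 / of_nat n :: rat) = s + (\<Sum>n\<in>(\<lambda>m. q * m) ` v. 1 / of_nat n)"
      unfolding T(2) using disj fin by (intro sum.union_disjoint)
    also have "(\<Sum>n\<in>(\<lambda>m. q * m) ` v. 1 / of_nat n :: rat) = (\<Sum>m\<in>v. 1 / of_nat (q * m))"
      using q0 by (subst sum.reindex) (auto simp: inj_on_def)
    finally have "s + (\<Sum>m\<in>v. 1 / of_nat (q * m)) = (\<Sum>n\<in>T \<union> (\<lambda>m. q * m) ` v. 1 / of_nat n :: rat)"
      by simp
    moreover have "T \<union> (\<lambda>m. q * m) ` v \<subseteq> W \<union> (\<lambda>m. q * m) ` M" using T(1) vM by auto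
    ultimately have "s + (\<Sum>m\<in>v. 1 / of_nat (q * m)) \<in> esums (W \<union> (\<lambda>m. q * m) ` M)"
      unfolding esums_def by blast
    then show "s + (\<Sum>m\<in>v. 1 / (of_nat q * of_nat m)) \<in> esums (W \<union> (\<lambda>m. q * m) ` M)"
      by simp
  qed
  have "inj_on \<phi> (esums W \<times> V)"
  proof (rule inj_onI, clarify)
    fix s v s' v' assume s: "s \<in> esums W" "s' \<in> esums W" and v: "v \<in> V" "v' \<in> V"
      and eq: "\<phi> (s, v) = \<phi> (s', v')"
    have ex: "\<exists>z::nat. r = of_nat z / of_nat (p ^ a * D)" if "r \<in> esums W" for r
    proof -
      obtain T where "T \<subseteq> W" "r = (\<Sum>n\<in>T. 1 / of_nat n)" using \<open>r \<in> esums W\<close> by (auto simp: esums_def)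
      moreover have "finite T" "\<forall>n\<in>T. n dvd p ^ a * D" "p ^ a * D > 0"
        using \<open>T \<subseteq> W\<close> finite_subset[of T W] W(1) D p0 by auto
      ultimately have "r = of_nat (\<Sum>n\<in>T. (p ^ a * D) div n) / of_nat (p ^ a * D)"
        using sum_reciprocals_common_denominator[of T "p ^ a * D"] by simp
      then show ?thesis by blast
    qed
    obtain z z' :: nat where z: "s = of_nat z / of_nat (p ^ a * D)" "s' = of_nat z' / of_nat (p ^ a * D)"
      using ex s by meson
    have "(of_nat z :: rat) / of_nat (p ^ a * D) + of_nat (\<nu> v) / (of_nat q * of_nat L)
      = of_nat z' / of_nat (p ^ a * D) + of_nat (\<nu> v') / (of_nat q * of_nat L)"
      using eq vsum[OF v(1)] vsum[OF v(2)] unfolding \<phi>_def z by simp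
    then have "(of_nat (p * L * z + D * \<nu> v) :: rat) = of_nat (p * L * z' + D * \<nu> v')"
      using p0 D(1) L0 unfolding q_def by (simp add: field_simps)
    then have "p * L * z + D * \<nu> v = p * L * z' + D * \<nu> v'"
      using of_nat_eq_iff by blast
    then have "(p * (L * z) + D * \<nu> v) mod p = (p * (L * z') + D * \<nu> v') mod p"
      by (simp add: mult.assoc)
    then have "[D * \<nu> v = D * \<nu> v'] (mod p)"
      by (simp add: cong_def)
    moreover have "coprime D p"
      using prime_imp_coprime[OF p D(2)] by (simp add: coprime_commute)
    ultimately have "[\<nu> v = \<nu> v'] (mod p)"
      by (simp add: cong_mult_lcancel_nat)
    then have vv: "v = v'" using inj v by (auto simp: inj_on_def cong_def \<nu>_def)
    with eq show "s = s' \<and> v = v'" by (simp add: \<phi>_def)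
  qed
  then have "card (esums W) * card V = card (\<phi> ` (esums W \<times> V))"
    by (simp add: card_image card_cartesian_product)
  also have "\<dots> \<le> card (esums (W \<union> (\<lambda>m. q * m) ` M))"
    using W(1) M by (intro card_mono img finite_esums) auto
  finally show ?thesis by (simp add: q_def)
qed

text \<open>The two selections from \<open>{1}\<close> have numerators 0 and 1, which differ modulo
  every prime.\<close>

lemma card_esums_insert_prime_power:
  fixes p a :: nat
  assumes "prime p" "finite W" "\<forall>w\<in>W. w > 0 \<and> \<not> p ^ Suc a dvd w"
  shows "card (esums W) * 2 \<le> card (esums (insert (p ^ Suc a) W))"
proof -
  have "p > 1" using assms(1) by (rule prime_gt_1_nat)
  then have "separated p 1 {1} {{}, {1}}"
    by (auto simp: separated_def)
  from card_esums_prime_power_step[OF assms _ this] show ?thesis by simp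
qed

text \<open>With the common denominator \<open>L\<close> the numerators of all sums over \<open>{1..M}\<close> are below \<open>p\<close>,
  so such a sum is determined by its numerator modulo \<open>p\<close>.\<close>

definition faithful :: "nat \<Rightarrow> nat \<Rightarrow> bool" where
  "faithful p M \<longleftrightarrow> M \<ge> 1 \<and> (\<exists>L>0. (\<forall>m\<in>{1..M}. m dvd L) \<and> (\<Sum>m=1..M. L div m) < p)"

text \<open>\<open>V\<close> keeps one subset for each value in \<open>egyptian M\<close>. Different
  values have different numerators, and below \<open>p\<close> these stay different modulo
  \<open>p\<close>.\<close>

lemma faithful_separated:
  assumes "faithful p M"
  shows "\<exists>L V. separated p L {1..M} V \<and> card V = card (egyptian M)"
proof -
  obtain L where L: "L > 0" "\<forall>m\<in>{1..M}. m dvd L" "(\<Sum>m=1..M. L div m) < p" and M: "M \<ge> 1"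
    using assms by (auto simp: faithful_def)
  \<comment> \<open>The term of \<open>m = 1\<close> already gives \<open>L < p\<close>, so
    \<open>p\<close> cannot divide \<open>L\<close>.\<close>
  have "L div 1 \<le> (\<Sum>m=1..M. L div m)"
    by (rule member_le_sum) (use M in auto)
  then have "L < p" using L(3) by simp
  then have npL: "\<not> p dvd L" using L(1) by (auto dest: dvd_imp_le)
  define S :: "nat set \<Rightarrow> rat" where "S T = (\<Sum>n\<in>T. 1 / of_nat n)" for T
  define V where "V = inv_into (Pow {1..M}) S ` egyptian M"
  have eg: "egyptian M = S ` Pow {1..M}"
    unfolding egyptian_eq_esums esums_def S_def ..
  have VP: "V \<subseteq> Pow {1..M}"
    unfolding V_def eg by (intro image_subsetI) (rule inv_into_into)
  have "inj_on (inv_into (Pow {1..M}) S) (egyptian M)"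
    by (rule inj_on_inv_into) (simp add: eg)
  then have cV: "card V = card (egyptian M)" unfolding V_def by (rule card_image)
  have S_inj: "v = v'" if "v \<in> V" "v' \<in> V" "S v = S v'" for v v'
    using that unfolding V_def eg by (auto simp: f_inv_into_f)
  have lt: "(\<Sum>m\<in>v. L div m) < p" if "v \<in> V" for v
  proof -
    have "(\<Sum>m\<in>v. L div m) \<le> (\<Sum>m=1..M. L div m)"
      using VP that by (intro sum_mono2) auto
    with L(3) show ?thesis by simp
  qed
  have Sv: "S v = of_nat (\<Sum>m\<in>v. L div m) / of_nat L" if "v \<in> V" for v
  proof -
    have "v \<subseteq> {1..M}" using VP that by blast
    then have "finite v" "\<forall>m\<in>v. m dvd L" using finite_subset L(2) by blast+
    then show ?thesis unfolding S_def using L(1) by (intro sum_reciprocals_common_denominator)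
  qed
  have "inj_on (\<lambda>v. (\<Sum>m\<in>v. L div m) mod p) V"
  proof (rule inj_onI)
    fix v v' assume v: "v \<in> V" "v' \<in> V"
      and "(\<Sum>m\<in>v. L div m) mod p = (\<Sum>m\<in>v'. L div m) mod p"
    then have "(\<Sum>m\<in>v. L div m) = (\<Sum>m\<in>v'. L div m)" using lt by simp
    then have "S v = S v'" using Sv[OF v(1)] Sv[OF v(2)] by simp
    then show "v = v'" using S_inj v by blast
  qed
  then have "separated p L {1..M} V"
    using VP L(2) npL by (auto simp: separated_def)
  with cV show ?thesis by blast
qed

text \<open>Every term \<open>L div m\<close> is at least 1. The inequality ensures that a multiple
  \<open>p * m\<close> in use has no prime factor above \<open>p\<close>.\<close>

lemma faithful_less:
  assumes "faithful p M"
  shows "M < p"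
proof -
  obtain L where L: "L > 0" "\<forall>m\<in>{1..M}. m dvd L" "(\<Sum>m=1..M. L div m) < p"
    using assms by (auto simp: faithful_def)
  have "M = (\<Sum>m=1..M. 1)" by simp
  also have "\<dots> \<le> (\<Sum>m=1..M. L div m)"
  proof (rule sum_mono)
    fix m assume m: "m \<in> {1..M}"
    then have "m dvd L" using L(2) by blast
    then obtain k where k: "L = m * k" by auto
    show "1 \<le> L div m" using L(1) m unfolding k by auto
  qed
  finally show ?thesis using L(3) by simp
qed

text \<open>Processing the primes in increasing order keeps the denominators already in use
  prime to the next prime.\<close>

lemma card_esums_prod_primes:
  assumes "finite P" "\<And>p. p \<in> P \<Longrightarrow> prime p \<and> faithful p (M p)"
    and "finite W" "\<And>w. w \<in> W \<Longrightarrow> w > 0 \<and> (\<forall>p\<in>P. \<not> p dvd w)"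
  shows "card (esums W) * (\<Prod>p\<in>P. card (egyptian (M p)))
    \<le> card (esums (W \<union> (\<Union>p\<in>P. (\<lambda>m. p * m) ` {1..M p})))"
  using assms(1,2,4)
proof (induction P rule: finite_linorder_max_induct)
  case empty
  then show ?case by simp
next
  case (insert b A)
  let ?W = "W \<union> (\<Union>p\<in>A. (\<lambda>m. p * m) ` {1..M p})"
  have b: "prime b" "faithful b (M b)" using insert.prems(1) by auto
  obtain L V where LV: "separated b L {1..M b} V" "card V = card (egyptian (M b))"
    using faithful_separated[OF b(2)] by blast
  have IH: "card (esums W) * (\<Prod>p\<in>A. card (egyptian (M p))) \<le> card (esums ?W)"
    using insert.prems by (intro insert.IH) auto
  have fin: "finite ?W" using insert.hyps(1) assms(3) by auto
  have nd: "\<forall>w\<in>?W. w > 0 \<and> \<not> b ^ Suc 0 dvd w"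
  proof
    fix w assume "w \<in> ?W"
    then consider "w \<in> W" | p m where "p \<in> A" "m \<in> {1..M p}" "w = p * m" by auto
    then show "w > 0 \<and> \<not> b ^ Suc 0 dvd w"
    proof cases
      case 1
      then show ?thesis using insert.prems(2) by auto
    next
      case 2
      have p: "prime p" "faithful p (M p)" using insert.prems(1) 2(1) by auto
      \<comment> \<open>Both factors of \<open>p * m\<close> are positive and smaller than the prime
        \<open>b\<close>, hence \<open>b\<close> does not divide the product.\<close>
      have "p < b" using insert.hyps(2) 2(1) by blast
      moreover have "m < b" using faithful_less[OF p(2)] 2(2) \<open>p < b\<close> by auto
      moreover have "p > 0" using p(1) by (simp add: prime_gt_0_nat)
      ultimately show ?thesis
        using b(1) 2(2,3) by (auto simp: prime_dvd_mult_iff dest: dvd_imp_le)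
    qed
  qed
  have "card (esums ?W) * card V \<le> card (esums (?W \<union> (\<lambda>m. b ^ Suc 0 * m) ` {1..M b}))"
    by (rule card_esums_prime_power_step[OF b(1) fin nd _ LV(1)]) simp
  moreover have "?W \<union> (\<lambda>m. b ^ Suc 0 * m) ` {1..M b} = W \<union> (\<Union>p\<in>insert b A. (\<lambda>m. p * m) ` {1..M p})"
    by auto
  ultimately have "card (esums ?W) * card (egyptian (M b))
      \<le> card (esums (W \<union> (\<Union>p\<in>insert b A. (\<lambda>m. p * m) ` {1..M p})))"
    using LV(2) by simp
  moreover have "card (esums W) * (\<Prod>p\<in>insert b A. card (egyptian (M p)))
      = (card (esums W) * (\<Prod>p\<in>A. card (egyptian (M p)))) * card (egyptian (M b))"
    using insert.hyps by (subst prod.insert) auto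
  moreover have "(card (esums W) * (\<Prod>p\<in>A. card (egyptian (M p)))) * card (egyptian (M b))
      \<le> card (esums ?W) * card (egyptian (M b))"
    using IH by (rule mult_le_mono1)
  ultimately show ?case by linarith
qed

text \<open>To base 2 an independent denominator contributes exactly 1, and an independent prime
  \<open>p\<close> contributes \<open>lgE (M p)\<close>.\<close>

definition lgE :: "nat \<Rightarrow> real" where
  "lgE N = log 2 (real (card (egyptian N)))"

lemma card_egyptian_pos: "card (egyptian N) > 0"
  unfolding egyptian_eq_esums by (rule card_esums_pos) simp

lemma lgE_nonneg: "lgE N \<ge> 0"
  unfolding lgE_def using card_egyptian_pos[of N] by (simp add: zero_le_log_cancel_iff)

lemma lgE_mono: "M \<le> N \<Longrightarrow> lgE M \<le> lgE N"
  unfolding lgE_def using card_egyptian_pos[of N] card_egyptian_pos[of M]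
    card_esums_mono[of "{1..N}" "{1..M}"]
  by (simp add: egyptian_eq_esums)

lemma lgE_ge_primes:
  assumes "finite P" "\<And>p. p \<in> P \<Longrightarrow> prime p \<and> faithful p (M p) \<and> p * M p \<le> N"
    and "W \<subseteq> {1..N}" "\<And>w p. w \<in> W \<Longrightarrow> p \<in> P \<Longrightarrow> \<not> p dvd w"
  shows "log 2 (real (card (esums W))) + (\<Sum>p\<in>P. lgE (M p)) \<le> lgE N"
proof -
  have finW: "finite W" using assms(3) finite_subset by blast
  have "card (esums W) * (\<Prod>p\<in>P. card (egyptian (M p)))
    \<le> card (esums (W \<union> (\<Union>p\<in>P. (\<lambda>m. p * m) ` {1..M p})))"
  proof (rule card_esums_prod_primes)
    show "w > 0 \<and> (\<forall>p\<in>P. \<not> p dvd w)" if "w \<in> W" for w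
      using assms(3,4) that by (auto simp: subset_eq Suc_le_eq)
  qed (use assms(1,2) finW in auto)
  also have "\<dots> \<le> card (egyptian N)"
    unfolding egyptian_eq_esums
  proof (rule card_esums_mono)
    show "W \<union> (\<Union>p\<in>P. (\<lambda>m. p * m) ` {1..M p}) \<subseteq> {1..N}"
    proof (intro Un_least assms(3) UN_least image_subsetI)
      fix p m assume pm: "p \<in> P" "m \<in> {1..M p}"
      have "p * m \<le> p * M p" using pm by simp
      also have "\<dots> \<le> N" using assms(2) pm by blast
      finally show "p * m \<in> {1..N}" using assms(2)[OF pm(1)] pm by (auto simp: prime_gt_0_nat Suc_le_eq)
    qed
  qed simp
  finally have le: "card (esums W) * (\<Prod>p\<in>P. card (egyptian (M p))) \<le> card (egyptian N)" .
  have pos: "0 < card (esums W)" "0 < (\<Prod>p\<in>P. card (egyptian (M p)))"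
    using card_esums_pos[OF finW] card_egyptian_pos by (auto intro: prod_pos)
  have "log 2 (real (card (esums W))) + (\<Sum>p\<in>P. lgE (M p))
      = log 2 (real (card (esums W))) + log 2 (\<Prod>p\<in>P. real (card (egyptian (M p))))"
    unfolding lgE_def log_def using card_egyptian_pos assms(1)
    by (subst ln_prod) (auto simp: sum_divide_distrib)
  also have "\<dots> = log 2 (real (card (esums W) * (\<Prod>p\<in>P. card (egyptian (M p)))))"
  proof -
    have "real (card (esums W)) > 0" "(\<Prod>p\<in>P. real (card (egyptian (M p)))) > 0"
      using pos card_egyptian_pos by (auto intro: prod_pos)
    then show ?thesis by (simp add: log_mult)
  qed
  also have "\<dots> \<le> lgE N"
    unfolding lgE_def using le pos by (subst log_le_cancel_iff) (auto simp del: of_nat_mult of_nat_prod simp: card_egyptian_pos)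
  finally show ?thesis .
qed

section \<open>Weighted sums over prime counts\<close>

text \<open>Over the common denominator \<open>L\<close> the subset sums become natural numbers, so
  that the count is obtained by evaluating the list \<open>zs\<close>.\<close>

lemma card_esums_list:
  assumes "distinct xs" "L > 0" "list_all (\<lambda>n. n dvd L) xs"
    and "map (\<lambda>ys. sum_list (map ((div) L) ys)) (subseqs xs) = zs"
  shows "card (esums (set xs)) = card (set zs)"
proof -
  define h :: "nat set \<Rightarrow> nat" where "h T = (\<Sum>n\<in>T. L div n)" for T
  have "esums (set xs) = (\<lambda>k. of_nat k / of_nat L) ` h ` Pow (set xs)"
    unfolding esums_def h_def image_image
  proof (intro image_cong refl)
    fix T assume "T \<in> Pow (set xs)"
    then show "(\<Sum>n\<in>T. 1 / of_nat n) = (of_nat (\<Sum>n\<in>T. L div n) / of_nat L :: rat)"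
      using assms(2,3) finite_subset[of T "set xs"]
      by (intro sum_reciprocals_common_denominator) (auto simp: list_all_iff)
  qed
  also have "card \<dots> = card (h ` Pow (set xs))"
    by (intro card_image) (use assms(2) in \<open>auto simp: inj_on_def\<close>)
  also have "h ` Pow (set xs) = set zs"
    unfolding assms(4)[symmetric] set_map subseqs_powset[symmetric] image_image h_def
    using subseqs_distinctD[OF _ assms(1)]
    by (intro image_cong refl) (simp add: sum_list_distinct_conv_sum_set)
  finally show ?thesis .
qed

lemma card_esums_ge:
  assumes "distinct xs" "L > 0" "list_all (\<lambda>n. n dvd L) xs"
    and "map (\<lambda>ys. sum_list (map ((div) L) ys)) (subseqs xs) = zs"
    and "distinct ks" "list_all (\<lambda>k. k \<in> set zs) ks"
  shows "length ks \<le> card (esums (set xs))"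
  unfolding card_esums_list[OF assms(1-4)] distinct_card[OF assms(5), symmetric]
  using assms(6) by (intro card_mono) (auto simp: list_all_iff)

text \<open>The numerators over 12 are the sums of distinct divisors of 12; all integers from 0 to
  28 occur.\<close>

lemma card_core: "29 \<le> card (esums {1, 2, 3, 4, 6, 12})"
proof -
  have "map (\<lambda>ys. sum_list (map ((div) (12::nat)) ys)) (subseqs [1, 2, 3, 4, 6, 12])
    = [28, 27, 26, 25, 25, 24, 23, 22, 24, 23, 22, 21, 21, 20, 19, 18, 22, 21, 20, 19, 19, 18, 17, 16, 18, 17, 16, 15, 15, 14, 13, 12, 16, 15, 14, 13, 13, 12, 11, 10, 12, 11, 10, 9, 9, 8, 7, 6, 10, 9, 8, 7, 7, 6, 5, 4, 6, 5, 4, 3, 3, 2, 1, 0]"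
    by (simp add: Let_def)
  then have "length [0, 1, 2, 3, 4, 5, 6, 7, 8, 9, 10, 11, 12, 13, 14, 15, 16, 17, 18, 19, 20, 21, 22, 23, 24, 25, 26, 27, 28 :: nat]
    \<le> card (esums (set [1, 2, 3, 4, 6, 12]))"
    by (rule card_esums_ge[rotated 3]) simp_all
  then show ?thesis by simp
qed

text \<open>Without the divisor 1 of 12, the numerators run through 0 to 27 except 1 and 26.\<close>

lemma card_core6: "26 \<le> card (esums {1, 2, 3, 4, 6})"
proof -
  have "map (\<lambda>ys. sum_list (map ((div) (12::nat)) ys)) (subseqs [1, 2, 3, 4, 6])
    = [27, 25, 24, 22, 23, 21, 20, 18, 21, 19, 18, 16, 17, 15, 14, 12, 15, 13, 12, 10, 11, 9, 8, 6, 9, 7, 6, 4, 5, 3, 2, 0]"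
    by (simp add: Let_def)
  then have "length [0, 2, 3, 4, 5, 6, 7, 8, 9, 10, 11, 12, 13, 14, 15, 16, 17, 18, 19, 20, 21, 22, 23, 24, 25, 27 :: nat]
    \<le> card (esums (set [1, 2, 3, 4, 6]))"
    by (rule card_esums_ge[rotated 3]) simp_all
  then show ?thesis by simp
qed

lemma card_core4: "card (esums {1, 2, 3, 4}) = 16"
  using card_esums_list[of "[1, 2, 3, 4]" 12, OF _ _ _ refl]
  by (simp add: subseqs.simps Let_def)

lemma card_core3: "card (esums {1, 2, 3}) = 8"
  using card_esums_list[of "[1, 2, 3]" 6, OF _ _ _ refl]
  by (simp add: subseqs.simps Let_def)

lemma card_core2: "card (esums {1, 2}) = 4"
  using card_esums_list[of "[1, 2]" 2, OF _ _ _ refl]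
  by (simp add: subseqs.simps Let_def)

lemma card_core1: "card (esums {1}) = 2"
  using card_esums_list[of "[1]" 1, OF _ _ _ refl]
  by (simp add: subseqs.simps Let_def)

text \<open>The primes used below are larger than 3, so the powers of 2 and 3 contribute a logarithmic term for free.\<close>

definition core :: "nat \<Rightarrow> nat \<Rightarrow> nat set" where
  "core a b = {1, 2, 3, 4, 6, 12} \<union> (\<lambda>i. 2 ^ i) ` {3..a} \<union> (\<lambda>i. 3 ^ i) ` {2..b}"

text \<open>Neither 8 nor 9 divides 12, so every further power of 2 or 3 has a higher exponent than
  the denominators before it and doubles the number of sums.\<close>

lemma card_core_ge:
  assumes "a \<ge> 2" "b \<ge> 1"
  shows "29 * 2 ^ (a - 2) * 2 ^ (b - 1) \<le> card (esums (core a b))"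
  using assms(2)
proof (induction b rule: dec_induct)
  case base
  show ?case using assms(1)
  proof (induction a rule: dec_induct)
    case base
    then show ?case using card_core by (simp add: core_def)
  next
    case (step a)
    have "core (Suc a) 1 = insert (2 ^ Suc a) (core a 1)"
      using step.hyps by (auto simp: core_def atLeastAtMostSuc_conv)
    moreover have "\<forall>w\<in>core a 1. w > 0 \<and> \<not> 2 ^ Suc a dvd w"
    proof
      fix w assume "w \<in> core a 1"
      then consider "w \<in> {1, 2, 3, 4, 6, 12}" | i where "i \<in> {3..a}" "w = 2 ^ i"
        by (auto simp: core_def)
      then show "w > 0 \<and> \<not> 2 ^ Suc a dvd w"
      proof cases
        case 1
        have "(2::nat) ^ 3 dvd 2 ^ Suc a" using step.hyps by (intro le_imp_power_dvd) auto
        moreover have "\<not> 2 ^ 3 dvd w" using 1 by auto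
        ultimately have "\<not> 2 ^ Suc a dvd w" using dvd_trans by metis
        then show ?thesis using 1 by auto
      next
        case 2
        then have "\<not> 2 ^ Suc a dvd (2::nat) ^ i"
          using power_dvd_imp_le[of 2 "Suc a" i] by auto
        then show ?thesis using 2 by simp
      qed
    qed
    moreover have "finite (core a 1)" by (simp add: core_def)
    ultimately have "card (esums (core a 1)) * 2 \<le> card (esums (core (Suc a) 1))"
      using card_esums_insert_prime_power[of 2 "core a 1" a] by simp
    moreover have e: "Suc a - 2 = Suc (a - 2)" using step.hyps by simp
    have "29 * 2 ^ (Suc a - 2) * 2 ^ (1 - 1) = (29 * 2 ^ (a - 2) * 2 ^ (1 - 1)) * (2::nat)"
      unfolding e power_Suc by simp
    ultimately show ?case using step.IH by linarith
  qed
next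
  case (step b)
  have "core a (Suc b) = insert (3 ^ Suc b) (core a b)"
    using step.hyps by (auto simp: core_def atLeastAtMostSuc_conv)
  moreover have "\<forall>w\<in>core a b. w > 0 \<and> \<not> 3 ^ Suc b dvd w"
  proof
    fix w assume "w \<in> core a b"
    then consider "w \<in> {1, 2, 3, 4, 6, 12}" | i where "w = 2 ^ i" | i where "i \<in> {2..b}" "w = 3 ^ i"
      by (auto simp: core_def)
    then show "w > 0 \<and> \<not> 3 ^ Suc b dvd w"
    proof cases
      case 1
      have "(3::nat) ^ 2 dvd 3 ^ Suc b" using step.hyps by (intro le_imp_power_dvd) auto
      moreover have "\<not> 3 ^ 2 dvd w" using 1 by auto
      ultimately have "\<not> 3 ^ Suc b dvd w" using dvd_trans by metis
      then show ?thesis using 1 by auto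
    next
      case 2
      have "\<not> 3 dvd (2::nat) ^ i"
        using prime_dvd_power[of 3 "2::nat" i] by auto
      then show ?thesis using 2 dvd_trans[of 3 "3 ^ Suc b"] by auto
    next
      case 3
      then have "\<not> 3 ^ Suc b dvd (3::nat) ^ i"
        using power_dvd_imp_le[of 3 "Suc b" i] by auto
      then show ?thesis using 3 by simp
    qed
  qed
  moreover have "finite (core a b)" by (simp add: core_def)
  ultimately have "card (esums (core a b)) * 2 \<le> card (esums (core a (Suc b)))"
    using card_esums_insert_prime_power[of 3 "core a b" b] by simp
  moreover have e: "Suc b - 1 = Suc (b - 1)" using step.hyps by simp
  have "29 * 2 ^ (a - 2) * 2 ^ (Suc b - 1) = (29 * 2 ^ (a - 2) * 2 ^ (b - 1)) * (2::nat)"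
    unfolding e power_Suc by simp
  ultimately show ?case using step.IH by linarith
qed

lemma core_subset:
  assumes "N \<ge> 12" "2 ^ a \<le> N" "3 ^ b \<le> N"
  shows "core a b \<subseteq> {1..N}"
proof
  fix w assume "w \<in> core a b"
  then consider "w \<in> {1, 2, 3, 4, 6, 12}" | i where "i \<le> a" "w = 2 ^ i" | i where "i \<le> b" "w = 3 ^ i"
    by (auto simp: core_def)
  then show "w \<in> {1..N}"
  proof cases
    case 2
    then have "w \<le> 2 ^ a" by simp
    with assms have "w \<le> N" by linarith
    with 2 show ?thesis by simp
  next
    case 3
    then have "w \<le> 3 ^ b" by simp
    with assms have "w \<le> N" by linarith
    with 3 show ?thesis by simp
  qed (use assms in auto)
qed

lemma core_coprime:
  assumes "w \<in> core a b" "prime p" "p \<ge> 5"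
  shows "\<not> p dvd w"
proof
  assume dvd: "p dvd w"
  have "p dvd 2 \<or> p dvd 3"
  proof -
    consider "w \<in> {1, 2, 3, 4, 6, 12}" | i where "w = 2 ^ i" | i where "w = 3 ^ i"
      using assms(1) by (auto simp: core_def)
    then show ?thesis
    proof cases
      case 1
      then have "w dvd 2 ^ 2 * 3" by auto
      with dvd have "p dvd 2 ^ 2 * 3" by (rule dvd_trans)
      then show ?thesis using assms(2) by (metis prime_dvd_mult_iff prime_dvd_power)
    qed (use dvd assms(2) in \<open>auto dest: prime_dvd_power\<close>)
  qed
  then show False using assms(3) by (auto dest: dvd_imp_le)
qed

text \<open>This is 2^34 <= 29^7, and it is the source of the sevenths in the numerical bounds
  below.\<close>

lemma log2_29: "34 / 7 \<le> log 2 (29 :: real)"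
proof -
  have "log 2 (2 ^ 34 :: real) \<le> log 2 (29 ^ 7)"
    by (subst log_le_cancel_iff) auto
  moreover have "log 2 (2 ^ 34 :: real) = 34" "log 2 (29 ^ 7 :: real) = 7 * log 2 29"
    by (subst log_nat_power; simp)+
  ultimately show ?thesis by linarith
qed

lemma log2_26: "47 / 10 \<le> log 2 (26 :: real)"
proof -
  have "log 2 (2 ^ 47 :: real) \<le> log 2 (26 ^ 10)"
    by (subst log_le_cancel_iff) auto
  moreover have "log 2 (2 ^ 47 :: real) = 47" "log 2 (26 ^ 10 :: real) = 10 * log 2 26"
    by (subst log_nat_power; simp)+
  ultimately show ?thesis by linarith
qed

lemma log2_core_ge:
  assumes "a \<ge> 2" "b \<ge> 1"
  shows "34 / 7 + real (a - 2) + real (b - 1) \<le> log 2 (real (card (esums (core a b))))"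
proof -
  have "34 / 7 + real (a - 2) + real (b - 1) \<le> log 2 29 + real (a - 2) + real (b - 1)"
    using log2_29 by simp
  also have "\<dots> = log 2 (29 * 2 ^ (a - 2) * 2 ^ (b - 1))"
    by (simp add: log_mult log_nat_power)
  also have "\<dots> = log 2 (real (29 * 2 ^ (a - 2) * 2 ^ (b - 1)))" by simp
  also have "\<dots> \<le> log 2 (real (card (esums (core a b))))"
    using card_core_ge[OF assms] card_esums_pos[of "core a b"]
    by (subst log_le_cancel_iff) (auto simp: core_def simp del: of_nat_mult of_nat_power)
  finally show ?thesis .
qed

section \<open>Explicit thresholds and prime counts\<close>

lemma faithfulI:
  assumes "[1..<Suc M] = xs" "M \<ge> 1" "L > 0" "list_all (\<lambda>m. m dvd L) xs"
    and "sum_list (map ((div) L) xs) < p"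
  shows "faithful p M"
proof -
  have "(\<Sum>m=1..M. L div m) = sum_list (map ((div) L) [1..<Suc M])"
    by (simp add: sum_list_distinct_conv_sum_set atLeastLessThanSuc_atLeastAtMost del: upt_Suc)
  then show ?thesis unfolding faithful_def
    using assms by (intro conjI exI[of _ L]) (auto simp: list_all_iff simp del: upt_Suc)
qed

text \<open>In this and the following lemmas the threshold is one more than the sum of
  \<open>L div m\<close> over \<open>m\<close> up to \<open>M\<close>, where \<open>L\<close> is the
  least common multiple of 1, ..., \<open>M\<close>: for instance 6 + 3 + 2 = 11 for
  \<open>M = 3\<close>.\<close>

lemma faithful_1: "p \<ge> 2 \<Longrightarrow> faithful p 1"
  by (rule faithfulI[of 1 "[1]" 1]) (simp_all add: upt_rec)

lemma faithful_2: "p \<ge> 4 \<Longrightarrow> faithful p 2"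
  by (rule faithfulI[of 2 "[1,2]" 2]) (simp_all add: upt_rec)

lemma faithful_3: "p \<ge> 12 \<Longrightarrow> faithful p 3"
  by (rule faithfulI[of 3 "[1,2,3]" 6]) (simp_all add: upt_rec)

lemma faithful_4: "p \<ge> 26 \<Longrightarrow> faithful p 4"
  by (rule faithfulI[of 4 "[1,2,3,4]" 12]) (simp_all add: upt_rec)

lemma faithful_5: "p \<ge> 138 \<Longrightarrow> faithful p 5"
  by (rule faithfulI[of 5 "[1,2,3,4,5]" 60]) (simp_all add: upt_rec)

lemma faithful_6: "p \<ge> 148 \<Longrightarrow> faithful p 6"
  by (rule faithfulI[of 6 "[1,2,3,4,5,6]" 60]) (simp_all add: upt_rec)

lemma faithful_8: "p \<ge> 2284 \<Longrightarrow> faithful p 8"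
  by (rule faithfulI[of 8 "[1,2,3,4,5,6,7,8]" 840]) (simp_all add: upt_rec)

lemma faithful_16: "p \<ge> 2436560 \<Longrightarrow> faithful p 16"
  by (rule faithfulI[of 16 "[1,2,3,4,5,6,7,8,9,10,11,12,13,14,15,16]" 720720]) (simp_all add: upt_rec)

lemma faithful_mono:
  assumes "faithful p M" "1 \<le> M'" "M' \<le> M"
  shows "faithful p M'"
proof -
  obtain L where L: "L > 0" "\<forall>m\<in>{1..M}. m dvd L" "(\<Sum>m=1..M. L div m) < p"
    using assms by (auto simp: faithful_def)
  have "(\<Sum>m=1..M'. L div m) \<le> (\<Sum>m=1..M. L div m)"
    using assms by (intro sum_mono2) auto
  then show ?thesis unfolding faithful_def using L assms by (intro conjI exI[of _ L]) auto
qed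

definition prime_count :: "nat \<Rightarrow> nat" where
  "prime_count x = card {p. prime p \<and> p \<le> x}"

lemma finite_primes_le: "finite {p::nat. prime p \<and> p \<le> x}"
  by (rule finite_subset[of _ "{..x}"]) auto

lemma prime_count_mono: "x \<le> y \<Longrightarrow> prime_count x \<le> prime_count y"
  unfolding prime_count_def by (intro card_mono finite_primes_le) auto

lemma prime_count_le: "prime_count x \<le> x"
proof -
  have "prime_count x \<le> card {1..x}"
    unfolding prime_count_def by (intro card_mono) (auto dest: prime_gt_0_nat)
  then show ?thesis by simp
qed

lemma downward_closed_eq_atLeastAtMost:
  fixes A :: "nat set"
  assumes "A \<subseteq> {1..K}" "\<And>m m'. m \<in> A \<Longrightarrow> 1 \<le> m' \<Longrightarrow> m' \<le> m \<Longrightarrow> m' \<in> A" "A \<noteq> {}"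
  shows "A = {1..Max A}"
proof -
  have fin: "finite A" using assms(1) finite_subset by blast
  show ?thesis
  proof (intro equalityI subsetI)
    fix m assume "m \<in> A"
    then show "m \<in> {1..Max A}" using assms(1) fin by auto
  next
    fix m assume "m \<in> {1..Max A}"
    then show "m \<in> A" using assms(2)[OF Max_in[OF fin assms(3)]] by auto
  qed
qed

text \<open>A prime \<open>p\<close> is used with the largest admissible cofactor bound, which
  contributes at least the sum of \<open>g m\<close> over all admissible \<open>m\<close>. Counting
  pairs by \<open>m\<close> instead, each \<open>g m\<close> occurs for all primes in the interval
  from \<theta> m to \<open>N div m\<close>.\<close>

lemma lgE_ge_weighted:
  fixes g :: "nat \<Rightarrow> real" and \<theta> :: "nat \<Rightarrow> nat"
  assumes g: "\<And>m. m \<in> {1..K} \<Longrightarrow> g m \<ge> 0"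
    and gE: "\<And>M. M \<in> {1..K} \<Longrightarrow> (\<Sum>m=1..M. g m) \<le> lgE M"
    and \<theta>: "\<And>m m'. 1 \<le> m \<Longrightarrow> m \<le> m' \<Longrightarrow> m' \<le> K \<Longrightarrow> \<theta> m \<le> \<theta> m'"
    and faith: "\<And>m p. m \<in> {1..K} \<Longrightarrow> prime p \<Longrightarrow> \<theta> m < p \<Longrightarrow> faithful p m"
    and W: "W \<subseteq> {1..N}" "\<And>w p. w \<in> W \<Longrightarrow> prime p \<Longrightarrow> \<theta> 1 < p \<Longrightarrow> \<not> p dvd w"
  shows "log 2 (real (card (esums W)))
    + (\<Sum>m=1..K. g m * (real (prime_count (N div m)) - real (prime_count (\<theta> m)))) \<le> lgE N"
proof -
  \<comment> \<open>The admissible cofactors of \<open>p\<close>. As \<theta> is monotone they form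
    an initial segment, so that the hypothesis on partial sums of \<open>g\<close> applies.\<close>
  define A where "A p = {m\<in>{1..K}. \<theta> m < p \<and> p * m \<le> N}" for p
  define P where "P = {p. prime p \<and> p \<le> N \<and> A p \<noteq> {}}"
  have finP: "finite P" unfolding P_def by (rule finite_subset[OF _ finite_primes_le[of N]]) auto
  have AM: "A p = {1..Max (A p)}" if "p \<in> P" for p
  proof (rule downward_closed_eq_atLeastAtMost)
    show "A p \<subseteq> {1..K}" "A p \<noteq> {}" using that by (auto simp: A_def P_def)
    fix m m' assume m: "m \<in> A p" "1 \<le> m'" "m' \<le> m"
    have "\<theta> m' \<le> \<theta> m" using m by (intro \<theta>) (auto simp: A_def)
    moreover have "p * m' \<le> p * m" using m(3) by (rule mult_le_mono2)
    moreover have "p * m \<le> N" using m(1) by (simp add: A_def)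
    ultimately have "p * m' \<le> N" "\<theta> m' \<le> \<theta> m" by linarith+
    then show "m' \<in> A p" using m by (auto simp: A_def)
  qed
  have finA: "finite (A p)" for p by (simp add: A_def)
  have MA: "Max (A p) \<in> A p" if "p \<in> P" for p
    using that by (intro Max_in finA) (simp add: P_def)
  have A_D: "m \<in> {1..K} \<and> \<theta> m < p \<and> p * m \<le> N" if "m \<in> A p" for m p
    using that by (simp add: A_def)
  have P_D: "prime p" if "p \<in> P" for p
    using that by (simp add: P_def)
  have main: "log 2 (real (card (esums W))) + (\<Sum>p\<in>P. lgE (Max (A p))) \<le> lgE N"
  proof (rule lgE_ge_primes[OF finP _ W(1)])
    fix p assume p: "p \<in> P"
    show "prime p \<and> faithful p (Max (A p)) \<and> p * Max (A p) \<le> N"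
      using A_D[OF MA[OF p]] P_D[OF p] faith[of "Max (A p)" p] by blast
  next
    fix w p assume w: "w \<in> W" and p: "p \<in> P"
    have "1 \<le> Max (A p)" using A_D[OF MA[OF p]] by simp
    then have "1 \<in> A p" by (subst AM[OF p]) simp
    then show "\<not> p dvd w" using A_D[of 1 p] W(2)[OF w P_D[OF p]] by blast
  qed
  have cnt: "real (prime_count (N div m)) - real (prime_count (\<theta> m)) \<le> real (card {p\<in>P. m \<in> A p})"
    if m: "m \<in> {1..K}" for m
  proof -
    have "{p. prime p \<and> p \<le> N div m} \<subseteq> {p. prime p \<and> p \<le> \<theta> m} \<union> {p\<in>P. m \<in> A p}"
    proof
      fix p assume p: "p \<in> {p. prime p \<and> p \<le> N div m}"
      have "p * m \<le> N" using p m by (simp add: less_eq_div_iff_mult_less_eq)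
      moreover have "p \<le> p * m" using m by simp
      ultimately have "p \<le> N" "p * m \<le> N" by linarith+
      then show "p \<in> {p. prime p \<and> p \<le> \<theta> m} \<union> {p\<in>P. m \<in> A p}"
        using p m by (auto simp: P_def A_def intro!: exI[of _ m])
    qed
    then have "prime_count (N div m) \<le> card ({p. prime p \<and> p \<le> \<theta> m} \<union> {p\<in>P. m \<in> A p})"
      unfolding prime_count_def using finP finite_primes_le by (intro card_mono) auto
    also have "\<dots> \<le> prime_count (\<theta> m) + card {p\<in>P. m \<in> A p}"
      unfolding prime_count_def by (rule card_Un_le)
    finally show ?thesis by simp
  qed
  \<comment> \<open>Double counting of the pairs of \<open>m\<close> and \<open>p\<close> with
    \<open>m \<in> A p\<close>.\<close>
  have "(\<Sum>m=1..K. g m * (real (prime_count (N div m)) - real (prime_count (\<theta> m))))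
      \<le> (\<Sum>m=1..K. g m * real (card {p\<in>P. m \<in> A p}))"
    using g cnt by (intro sum_mono mult_left_mono) auto
  also have "\<dots> = (\<Sum>m=1..K. \<Sum>p\<in>P. if m \<in> A p then g m else 0)"
    using finP by (intro sum.cong refl) (simp add: sum.If_cases Int_def mult.commute)
  also have "\<dots> = (\<Sum>p\<in>P. \<Sum>m=1..K. if m \<in> A p then g m else 0)"
    by (rule sum.swap)
  also have "\<dots> = (\<Sum>p\<in>P. \<Sum>m\<in>A p. g m)"
  proof (rule sum.cong)
    fix p assume "p \<in> P"
    have "{1..K} \<inter> A p = A p" by (auto simp: A_def)
    then show "(\<Sum>m=1..K. if m \<in> A p then g m else 0) = (\<Sum>m\<in>A p. g m)"
      by (simp add: sum.inter_restrict[symmetric])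
  qed simp
  also have "\<dots> \<le> (\<Sum>p\<in>P. lgE (Max (A p)))"
  proof (rule sum_mono)
    fix p assume p: "p \<in> P"
    have "Max (A p) \<in> {1..K}" using A_D[OF MA[OF p]] by blast
    then show "(\<Sum>m\<in>A p. g m) \<le> lgE (Max (A p))" by (subst AM[OF p]) (rule gE)
  qed
  finally show ?thesis using main by simp
qed

section \<open>Values of lgE up to 16\<close>

lemma lgE_1: "1 \<le> lgE 1"
  using lgE_ge_primes[of "{}" _ 1 "{1}"] card_core1 by simp

lemma lgE_2: "2 \<le> lgE 2"
  using lgE_ge_primes[of "{}" _ 2 "{1, 2}"] card_core2 log_nat_power[of 2 2 2] by simp

lemma lgE_3: "3 \<le> lgE 3"
  using lgE_ge_primes[of "{}" _ 3 "{1, 2, 3}"] card_core3 log_nat_power[of 2 2 3] by simp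

lemma lgE_4: "4 \<le> lgE 4"
  using lgE_ge_primes[of "{}" _ 4 "{1, 2, 3, 4}"] card_core4 log_nat_power[of 2 2 4] by simp

lemma core_not_dvd: "\<lbrakk>w \<in> core a b; p \<in> P; P \<subseteq> {5, 7, 11, 13}\<rbrakk> \<Longrightarrow> \<not> p dvd w"
  by (rule core_coprime) auto

lemma lgE_5: "5 \<le> lgE 5"
proof -
  have "log 2 (real (card (esums {1, 2, 3, 4}))) + (\<Sum>p\<in>{5 :: nat}. lgE ((\<lambda>_. 1) p)) \<le> lgE 5"
    by (rule lgE_ge_primes[where M = "\<lambda>_. 1"]) (use faithful_1[of 5] in auto)
  then show ?thesis using card_core4 log_nat_power[of 2 2 4] lgE_1 by simp
qed

lemma log2_core6: "47 / 10 \<le> log 2 (real (card (esums {1, 2, 3, 4, 6})))"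
proof -
  have "log 2 26 \<le> log 2 (real (card (esums {1, 2, 3, 4, 6})))"
    using card_core6 by (subst log_le_cancel_iff) linarith+
  then show ?thesis using log2_26 by linarith
qed

lemma log2_core6_8: "57 / 10 \<le> log 2 (real (card (esums {1, 2, 3, 4, 6, 8})))"
proof -
  have "card (esums {1, 2, 3, 4, 6}) * 2 \<le> card (esums (insert (2 ^ Suc 2) {1, 2, 3, 4, 6}))"
    by (rule card_esums_insert_prime_power) auto
  moreover have "insert (2 ^ Suc 2) {1, 2, 3, 4, 6} = {1, 2, 3, 4, 6, 8 :: nat}" by auto
  ultimately have "26 * 2 \<le> card (esums {1, 2, 3, 4, 6, 8})" using card_core6 by simp
  then have "log 2 (26 * 2) \<le> log 2 (real (card (esums {1, 2, 3, 4, 6, 8})))"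
    by (subst log_le_cancel_iff) linarith+
  moreover have "log 2 (26 * 2 :: real) = log 2 26 + 1" by (subst log_mult) auto
  ultimately show ?thesis using log2_26 by linarith
qed

lemma log2_core6_9: "67 / 10 \<le> log 2 (real (card (esums {1, 2, 3, 4, 6, 8, 9})))"
proof -
  have "card (esums {1, 2, 3, 4, 6}) * 2 \<le> card (esums (insert (2 ^ Suc 2) {1, 2, 3, 4, 6}))"
    by (rule card_esums_insert_prime_power) auto
  moreover have "insert (2 ^ Suc 2) {1, 2, 3, 4, 6} = {1, 2, 3, 4, 6, 8 :: nat}" by auto
  ultimately have "26 * 2 \<le> card (esums {1, 2, 3, 4, 6, 8})" using card_core6 by simp
  moreover have "card (esums {1, 2, 3, 4, 6, 8}) * 2 \<le> card (esums (insert (3 ^ Suc 1) {1, 2, 3, 4, 6, 8}))"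
    by (rule card_esums_insert_prime_power) auto
  moreover have "insert (3 ^ Suc 1) {1, 2, 3, 4, 6, 8} = {1, 2, 3, 4, 6, 8, 9 :: nat}" by auto
  ultimately have "26 * 4 \<le> card (esums {1, 2, 3, 4, 6, 8, 9})" by simp
  then have "log 2 (26 * 4) \<le> log 2 (real (card (esums {1, 2, 3, 4, 6, 8, 9})))"
    by (subst log_le_cancel_iff) linarith+
  moreover have "log 2 (26 * 4 :: real) = log 2 26 + 2"
    using log_nat_power[of 2 2 2] by (subst log_mult) auto
  ultimately show ?thesis using log2_26 by linarith
qed

text \<open>From here to 16, a base set of denominators composed of 2 and 3 is counted directly and
  the primes from 5 on are added, each with cofactor 1 or 2.\<close>

lemma lgE_6: "57 / 10 \<le> lgE 6"
proof -
  have "log 2 (real (card (esums ({1, 2, 3, 4, 6})))) + (\<Sum>p\<in>{5 :: nat}. lgE ((\<lambda>p. 1) p)) \<le> lgE 6"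
  proof (rule lgE_ge_primes[where M = "\<lambda>p. 1"])
  qed (use faithful_1[of 5] in auto)
  then show ?thesis using log2_core6 lgE_1 by simp
qed

lemma lgE_7: "67 / 10 \<le> lgE 7"
proof -
  have "log 2 (real (card (esums ({1, 2, 3, 4, 6})))) + (\<Sum>p\<in>{5 :: nat, 7}. lgE ((\<lambda>p. 1) p)) \<le> lgE 7"
  proof (rule lgE_ge_primes[where M = "\<lambda>p. 1"])
  qed (use faithful_1[of 5] faithful_1[of 7] in auto)
  then show ?thesis using log2_core6 lgE_1 by simp
qed

lemma lgE_8: "77 / 10 \<le> lgE 8"
proof -
  have "log 2 (real (card (esums ({1, 2, 3, 4, 6, 8})))) + (\<Sum>p\<in>{5 :: nat, 7}. lgE ((\<lambda>p. 1) p)) \<le> lgE 8"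
  proof (rule lgE_ge_primes[where M = "\<lambda>p. 1"])
  qed (use faithful_1[of 5] faithful_1[of 7] in auto)
  then show ?thesis using log2_core6_8 lgE_1 by simp
qed

lemma lgE_9: "87 / 10 \<le> lgE 9"
proof -
  have "log 2 (real (card (esums ({1, 2, 3, 4, 6, 8, 9})))) + (\<Sum>p\<in>{5 :: nat, 7}. lgE ((\<lambda>p. 1) p)) \<le> lgE 9"
  proof (rule lgE_ge_primes[where M = "\<lambda>p. 1"])
  qed (use faithful_1[of 5] faithful_1[of 7] in auto)
  then show ?thesis using log2_core6_9 lgE_1 by simp
qed

lemma lgE_10: "97 / 10 \<le> lgE 10"
proof -
  have "log 2 (real (card (esums ({1, 2, 3, 4, 6, 8, 9})))) + (\<Sum>p\<in>{5 :: nat, 7}. lgE ((\<lambda>p. if p < 6 then 2 else 1) p)) \<le> lgE 10"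
  proof (rule lgE_ge_primes[where M = "\<lambda>p. if p < 6 then 2 else 1"])
  qed (use faithful_2[of 5] faithful_1[of 7] in auto)
  then show ?thesis using log2_core6_9 lgE_1 lgE_2 by simp
qed

lemma lgE_11: "107 / 10 \<le> lgE 11"
proof -
  have "log 2 (real (card (esums ({1, 2, 3, 4, 6, 8, 9})))) + (\<Sum>p\<in>{5 :: nat, 7, 11}. lgE ((\<lambda>p. if p < 6 then 2 else 1) p)) \<le> lgE 11"
  proof (rule lgE_ge_primes[where M = "\<lambda>p. if p < 6 then 2 else 1"])
  qed (use faithful_2[of 5] faithful_1[of 7] faithful_1[of 11] in auto)
  then show ?thesis using log2_core6_9 lgE_1 lgE_2 by simp
qed

lemma lgE_12: "76 / 7 \<le> lgE 12"
proof -
  have "log 2 (real (card (esums (core 3 2)))) + (\<Sum>p\<in>{5 :: nat, 7, 11}. lgE ((\<lambda>p. if p < 6 then 2 else 1) p)) \<le> lgE 12"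
  proof (rule lgE_ge_primes[where M = "\<lambda>p. if p < 6 then 2 else 1"])
    show "core 3 2 \<subseteq> {1..12}" by (rule core_subset) simp_all
    show "\<not> p dvd w" if "w \<in> core 3 2" "p \<in> {5, 7, 11}" for w p :: nat
      using core_not_dvd[OF that] by simp
  qed (use faithful_2[of 5] faithful_1[of 7] faithful_1[of 11] in auto)
  then show ?thesis using log2_core_ge[of 3 2] lgE_1 lgE_2 by simp
qed

lemma lgE_13: "83 / 7 \<le> lgE 13"
proof -
  have "log 2 (real (card (esums (core 3 2)))) + (\<Sum>p\<in>{5 :: nat, 7, 11, 13}. lgE ((\<lambda>p. if p < 6 then 2 else 1) p)) \<le> lgE 13"
  proof (rule lgE_ge_primes[where M = "\<lambda>p. if p < 6 then 2 else 1"])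
    show "core 3 2 \<subseteq> {1..13}" by (rule core_subset) simp_all
    show "\<not> p dvd w" if "w \<in> core 3 2" "p \<in> {5, 7, 11, 13}" for w p :: nat
      using core_not_dvd[OF that] by simp
  qed (use faithful_2[of 5] faithful_1[of 7] faithful_1[of 11] faithful_1[of 13] in auto)
  then show ?thesis using log2_core_ge[of 3 2] lgE_1 lgE_2 by simp
qed

lemma lgE_14: "90 / 7 \<le> lgE 14"
proof -
  have "log 2 (real (card (esums (core 3 2)))) + (\<Sum>p\<in>{5 :: nat, 7, 11, 13}. lgE ((\<lambda>p. if p < 8 then 2 else 1) p)) \<le> lgE 14"
  proof (rule lgE_ge_primes[where M = "\<lambda>p. if p < 8 then 2 else 1"])
    show "core 3 2 \<subseteq> {1..14}" by (rule core_subset) simp_all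
    show "\<not> p dvd w" if "w \<in> core 3 2" "p \<in> {5, 7, 11, 13}" for w p :: nat
      using core_not_dvd[OF that] by simp
  qed (use faithful_2[of 5] faithful_2[of 7] faithful_1[of 11] faithful_1[of 13] in auto)
  then show ?thesis using log2_core_ge[of 3 2] lgE_1 lgE_2 by simp
qed

text \<open>The gain over 14 comes from the power 2^4 alone: the denominator 15 would require 5 to
  be faithful for 3, but the numerators over 6 reach 11.\<close>

lemma lgE_16: "97 / 7 \<le> lgE 16"
proof -
  have "log 2 (real (card (esums (core 4 2)))) + (\<Sum>p\<in>{5 :: nat, 7, 11, 13}. lgE ((\<lambda>p. if p < 8 then 2 else 1) p)) \<le> lgE 16"
  proof (rule lgE_ge_primes[where M = "\<lambda>p. if p < 8 then 2 else 1"])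
    show "core 4 2 \<subseteq> {1..16}" by (rule core_subset) simp_all
    show "\<not> p dvd w" if "w \<in> core 4 2" "p \<in> {5, 7, 11, 13}" for w p :: nat
      using core_not_dvd[OF that] by simp
  qed (use faithful_2[of 5] faithful_2[of 7] faithful_1[of 11] faithful_1[of 13] in auto)
  then show ?thesis using log2_core_ge[of 4 2] lgE_1 lgE_2 by simp
qed

section \<open>Chebyshev bounds\<close>

definition psi :: "nat \<Rightarrow> real" where
  "psi n = (\<Sum>d=1..n. mangoldt d)"

lemma of_nat_div_le: "real (n div d) \<le> real n / real d"
proof (cases "d = 0")
  case False
  have "n div d * d \<le> n" by (rule div_times_less_eq_dividend)
  then have "real (n div d) * real d \<le> real n" by (metis of_nat_le_iff of_nat_mult)
  then show ?thesis using False by (simp add: pos_le_divide_eq)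
qed simp

lemma le_of_nat_Suc_div:
  assumes "d > 0"
  shows "real n / real d \<le> real (Suc (n div d))"
proof -
  have "n \<le> Suc (n div d) * d"
    using dividend_less_times_div[OF assms, of n] by (simp add: mult.commute)
  then have "real n \<le> real (Suc (n div d)) * real d" by (metis of_nat_le_iff of_nat_mult)
  then show ?thesis using assms by (simp only: pos_divide_le_eq of_nat_0_less_iff)
qed

lemma card_multiples:
  fixes d n :: nat
  assumes "d > 0"
  shows "card {k\<in>{1..n}. d dvd k} = n div d"
proof -
  have "{k\<in>{1..n}. d dvd k} = (\<lambda>j. d * j) ` {1..n div d}"
  proof (intro equalityI subsetI)
    fix k assume k: "k \<in> {k\<in>{1..n}. d dvd k}"
    then obtain j where "k = d * j" by blast
    with k have j: "k = d * j" "1 \<le> k" "k \<le> n" by auto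
    then have "j \<le> n div d" "j \<ge> 1" using assms
      by (auto simp: less_eq_div_iff_mult_less_eq mult.commute Suc_le_eq)
    then show "k \<in> (\<lambda>j. d * j) ` {1..n div d}" using j by auto
  next
    fix k assume "k \<in> (\<lambda>j. d * j) ` {1..n div d}"
    then obtain j where "k = d * j" "j \<in> {1..n div d}" by blast
    then have j: "k = d * j" "1 \<le> j" "j \<le> n div d" by auto
    then have "d * j \<le> n" using assms by (simp add: less_eq_div_iff_mult_less_eq mult.commute)
    then show "k \<in> {k\<in>{1..n}. d dvd k}" using j assms by (auto simp: Suc_le_eq)
  qed
  moreover have "inj_on (\<lambda>j. d * j) {1..n div d}" using assms by (auto simp: inj_on_def)
  ultimately show ?thesis by (simp add: card_image)
qed

text \<open>Sum of the identity for ln k over the divisors of k, with the order exchanged. The range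
  up to \<open>n\<close> instead of \<open>m\<close> lets factorials of different sizes be combined
  in one sum.\<close>

lemma ln_fact_eq_sum:
  assumes "m \<le> n"
  shows "ln (fact m :: real) = (\<Sum>d=1..n. mangoldt d * real (m div d))"
proof -
  have "ln (fact m :: real) = (\<Sum>k=1..m. ln (real k))"
    unfolding fact_prod of_nat_prod by (subst ln_prod) auto
  also have "\<dots> = (\<Sum>k=1..m. \<Sum>d=1..n. if d dvd k then mangoldt d else 0)"
  proof (intro sum.cong refl)
    fix k assume k: "k \<in> {1..m}"
    have "{d. d dvd k} = {d\<in>{1..n}. d dvd k}"
      using k assms by (auto dest: dvd_imp_le dvd_pos_nat intro: Suc_leI)
    then have "ln (real k) = (\<Sum>d\<in>{d\<in>{1..n}. d dvd k}. mangoldt d)"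
      using mangoldt_sum[of k, where ?'a = real] k by simp
    also have "\<dots> = (\<Sum>d=1..n. if d dvd k then mangoldt d else 0)"
      by (rule sum.inter_filter) simp
    finally show "ln (real k) = (\<Sum>d=1..n. if d dvd k then mangoldt d else 0)" .
  qed
  also have "\<dots> = (\<Sum>d=1..n. \<Sum>k=1..m. if d dvd k then mangoldt d else 0)"
    by (rule sum.swap)
  also have "\<dots> = (\<Sum>d=1..n. mangoldt d * real (m div d))"
  proof (intro sum.cong refl)
    fix d assume d: "d \<in> {1..n}"
    have "(\<Sum>k=1..m. if d dvd k then mangoldt d else 0) = (\<Sum>k\<in>{k\<in>{1..m}. d dvd k}. mangoldt d :: real)"
      by (rule sum.inter_filter[symmetric]) simp
    also have "\<dots> = mangoldt d * real (m div d)"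
      using d card_multiples[of d m] by simp
    finally show "(\<Sum>k=1..m. if d dvd k then mangoldt d else 0) = mangoldt d * real (m div d)" .
  qed
  finally show ?thesis .
qed

text \<open>A prime power \<open>d\<close> is counted by \<open>psi (n div m)\<close> exactly when
  \<open>m \<le> n div d\<close>.\<close>

lemma sum_psi_div:
  "(\<Sum>m=1..k. psi (n div m)) = (\<Sum>d=1..n. mangoldt d * real (min k (n div d)))"
proof -
  have "(\<Sum>m=1..k. psi (n div m)) = (\<Sum>m=1..k. \<Sum>d=1..n. if d * m \<le> n then mangoldt d else 0)"
  proof (intro sum.cong refl)
    fix m assume m: "m \<in> {1..k}"
    have "{1..n div m} = {d\<in>{1..n}. d * m \<le> n}"
    proof (intro equalityI subsetI)
      fix d assume d: "d \<in> {1..n div m}"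
      then have "d * m \<le> n" using m by (simp add: less_eq_div_iff_mult_less_eq)
      moreover have "d \<le> d * m" using m by simp
      ultimately have "d * m \<le> n" "d \<le> n" by linarith+
      then show "d \<in> {d\<in>{1..n}. d * m \<le> n}" using d by simp
    next
      fix d assume "d \<in> {d\<in>{1..n}. d * m \<le> n}"
      then show "d \<in> {1..n div m}" using m by (simp add: less_eq_div_iff_mult_less_eq)
    qed
    then have "psi (n div m) = (\<Sum>d\<in>{d\<in>{1..n}. d * m \<le> n}. mangoldt d)"
      unfolding psi_def by (rule arg_cong)
    also have "\<dots> = (\<Sum>d=1..n. if d * m \<le> n then mangoldt d else 0)"
      by (rule sum.inter_filter) simp
    finally show "psi (n div m) = (\<Sum>d=1..n. if d * m \<le> n then mangoldt d else 0)" .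
  qed
  also have "\<dots> = (\<Sum>d=1..n. \<Sum>m=1..k. if d * m \<le> n then mangoldt d else 0)"
    by (rule sum.swap)
  also have "\<dots> = (\<Sum>d=1..n. mangoldt d * real (min k (n div d)))"
  proof (intro sum.cong refl)
    fix d assume d: "d \<in> {1..n}"
    have "{m\<in>{1..k}. d * m \<le> n} = {1..min k (n div d)}"
      using d by (auto simp: less_eq_div_iff_mult_less_eq mult.commute)
    then have "(\<Sum>m=1..k. if d * m \<le> n then mangoldt d else 0) = (\<Sum>m=1..min k (n div d). mangoldt d :: real)"
      using sum.inter_filter[of "{1..k}" "\<lambda>_. mangoldt d :: real" "\<lambda>m. d * m \<le> n"] by simp
    then show "(\<Sum>m=1..k. if d * m \<le> n then mangoldt d else 0) = mangoldt d * real (min k (n div d))"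
      by simp
  qed
  finally show ?thesis .
qed

text \<open>The coefficient of \<open>mangoldt d\<close> on the left is the remainder of
  \<open>n div d\<close> modulo \<open>k\<close>, which is at most both \<open>k\<close> and
  \<open>n div d\<close>.\<close>

lemma sum_psi_div_ge:
  assumes "k > 0"
  shows "ln (fact n) - real k * ln (fact (n div k)) \<le> (\<Sum>m=1..k. psi (n div m))"
proof -
  have "ln (fact n) - real k * ln (fact (n div k))
      = (\<Sum>d=1..n. mangoldt d * real (n div d)) - real k * (\<Sum>d=1..n. mangoldt d * real (n div k div d))"
    by (subst ln_fact_eq_sum[of n n], simp, subst ln_fact_eq_sum[of "n div k" n], simp_all)
  also have "\<dots> = (\<Sum>d=1..n. mangoldt d * (real (n div d) - real k * real (n div d div k)))"
    by (simp add: sum_distrib_left sum_subtractf algebra_simps div_mult2_eq[symmetric])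
  also have "\<dots> \<le> (\<Sum>d=1..n. mangoldt d * real (min k (n div d)))"
  proof (intro sum_mono mult_left_mono mangoldt_nonneg)
    fix d
    have "k * (n div d div k) + n div d mod k = n div d" by simp
    then have "real k * real (n div d div k) + real (n div d mod k) = real (n div d)"
      by (metis of_nat_add of_nat_mult)
    moreover have "n div d mod k \<le> min k (n div d)" if "k > 0"
      using that mod_less_divisor[of k "n div d"] mod_less_eq_dividend[of "n div d" k] by simp
    then have "real (n div d mod k) \<le> real (min k (n div d))" if "k > 0"
      using that of_nat_le_iff by blast
    ultimately show "real (n div d) - real k * real (n div d div k) \<le> real (min k (n div d))"
      using assms by linarith
  qed
  finally show ?thesis by (simp only: sum_psi_div)
qed

text \<open>Chebyshev's combination: since 1 - 1/2 - 1/3 - 1/5 + 1/30 = 0, the expression has period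
  30 and a check of 30 residues suffices.\<close>

lemma chebyshev_coefficient:
  fixes x :: nat
  shows "int x - int (x div 2) - int (x div 3) - int (x div 5) + int (x div 30) \<le> 1"
proof -
  define q r where "q = x div 30" and "r = x mod 30"
  have x: "x = 30 * q + r" and r: "r < 30" by (simp_all add: q_def r_def)
  have "x div 2 = 15 * q + r div 2" "x div 3 = 10 * q + r div 3" "x div 5 = 6 * q + r div 5"
    "x div 30 = q" using r unfolding x by linarith+
  then have "int x - int (x div 2) - int (x div 3) - int (x div 5) + int (x div 30)
    = int r - int (r div 2) - int (r div 3) - int (r div 5)"
    using x by linarith
  also have "\<dots> \<le> 1"
  proof -
    have "\<forall>r\<in>{..<30}. int r - int (r div 2) - int (r div 3) - int (r div 5) \<le> 1"
      by (simp add: lessThan_nat_numeral lessThan_Suc)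
    then show ?thesis using r by blast
  qed
  finally show ?thesis .
qed

lemma psi_ge_ln_fact:
  "ln (fact n) - ln (fact (n div 2)) - ln (fact (n div 3)) - ln (fact (n div 5)) + ln (fact (n div 30)) \<le> psi n"
proof -
  have "ln (fact n) - ln (fact (n div 2)) - ln (fact (n div 3)) - ln (fact (n div 5)) + ln (fact (n div 30))
    = (\<Sum>d=1..n. mangoldt d * real (n div d)) - (\<Sum>d=1..n. mangoldt d * real (n div 2 div d))
      - (\<Sum>d=1..n. mangoldt d * real (n div 3 div d)) - (\<Sum>d=1..n. mangoldt d * real (n div 5 div d))
      + (\<Sum>d=1..n. mangoldt d * real (n div 30 div d))"
    using ln_fact_eq_sum[of n n] ln_fact_eq_sum[of "n div 2" n] ln_fact_eq_sum[of "n div 3" n]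
      ln_fact_eq_sum[of "n div 5" n] ln_fact_eq_sum[of "n div 30" n] by simp
  also have "\<dots> = (\<Sum>d=1..n. mangoldt d * (real (n div d) - real (n div d div 2) - real (n div d div 3)
      - real (n div d div 5) + real (n div d div 30)))"
    by (simp add: sum_subtractf sum.distrib algebra_simps div_mult2_eq[symmetric])
  also have "\<dots> \<le> (\<Sum>d=1..n. mangoldt d * 1)"
  proof (intro sum_mono mult_left_mono mangoldt_nonneg)
    fix d
    have "real_of_int (int (n div d) - int (n div d div 2) - int (n div d div 3) - int (n div d div 5)
        + int (n div d div 30)) \<le> real_of_int 1"
      using chebyshev_coefficient of_int_le_iff by blast
    then show "real (n div d) - real (n div d div 2) - real (n div d div 3)
      - real (n div d div 5) + real (n div d div 30) \<le> 1" by simp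
  qed
  finally show ?thesis by (simp add: psi_def)
qed

text \<open>For odd \<open>n\<close> two equal central coefficients share the total 2^n, which saves
  the factor 2.\<close>

lemma choose_half_le: "n choose (n div 2) \<le> 4 ^ (n div 2)"
proof (cases "even n")
  case True
  then obtain a where a: "n = 2 * a" by auto
  have "n choose (n div 2) \<le> 2 ^ n" by (rule binomial_le_pow2)
  then show ?thesis by (simp add: a power_mult)
next
  case False
  then obtain a where a: "n = 2 * a + 1" by (auto elim: oddE)
  have "(n choose a) + (n choose Suc a) \<le> (\<Sum>k\<le>n. n choose k)"
  proof -
    have "(\<Sum>k\<in>{a, Suc a}. n choose k) \<le> (\<Sum>k\<le>n. n choose k)"
      by (rule sum_mono2) (auto simp: a)
    then show ?thesis by simp
  qed
  moreover have "n choose Suc a = n choose a"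
    using binomial_symmetric[of a n] by (simp add: a)
  ultimately have "2 * (n choose a) \<le> 2 ^ n" by (simp add: choose_row_sum)
  then show ?thesis by (simp add: a power_mult)
qed

text \<open>Halving induction with \<open>n = a + b\<close>: the prime powers between
  \<open>b\<close> and \<open>n\<close> all contribute to the logarithm of
  \<open>n choose a\<close>, which is at most \<open>a * ln 4\<close>; the rest is
  \<open>psi b\<close>.\<close>

lemma psi_le: "psi n \<le> real n * ln 4"
proof (induction n rule: less_induct)
  case (less n)
  show ?case
  proof (cases "n \<le> 1")
    case True
    then have "n = 0 \<or> n = 1" by auto
    then show ?thesis by (auto simp: psi_def)
  next
    case False
    define a b where "a = n div 2" and "b = n - a"
    have ab: "n = a + b" "a \<le> b" "b < n" "b \<le> a + 1" "a \<le> n" using False by (auto simp: a_def b_def)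
    have "psi n - psi b = (\<Sum>d\<in>{b<..n}. mangoldt d)"
      unfolding psi_def using ab by (subst sum_diff[symmetric]) (auto intro!: sum.cong)
    also have "\<dots> \<le> (\<Sum>d=1..n. mangoldt d * (real (n div d) - real (a div d) - real (b div d)))"
    proof -
      \<comment> \<open>For such \<open>d\<close> the quotients of \<open>n\<close>,
        \<open>a\<close>, \<open>b\<close> by \<open>d\<close> are 1, 0, 0, because
        \<open>a \<le> b < d\<close> and \<open>n \<le> 2 * b\<close>.\<close>
      have "(\<Sum>d\<in>{b<..n}. mangoldt d) = (\<Sum>d\<in>{b<..n}. mangoldt d * (real (n div d) - real (a div d) - real (b div d)))"
      proof (intro sum.cong refl)
        fix d assume d: "d \<in> {b<..n}"
        have "n div d = 1"
          using d ab by (intro div_nat_eqI) auto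
        then show "mangoldt d = mangoldt d * (real (n div d) - real (a div d) - real (b div d))"
          using d ab by simp
      qed
      also have "\<dots> \<le> (\<Sum>d=1..n. mangoldt d * (real (n div d) - real (a div d) - real (b div d)))"
      proof (rule sum_mono2)
        fix d assume "d \<in> {1..n} - {b<..n}"
        have "a div d + b div d \<le> n div d"
          using div_add1_eq[of a b d] unfolding ab(1) by linarith
        then have "real (a div d) + real (b div d) \<le> real (n div d)"
          by (metis of_nat_add of_nat_le_iff)
        then show "0 \<le> mangoldt d * (real (n div d) - real (a div d) - real (b div d))"
          by (simp add: mangoldt_nonneg)
      qed auto
      finally show ?thesis .
    qed
    also have "\<dots> = ln (fact n) - ln (fact a) - ln (fact b)"
      using ln_fact_eq_sum[of n n] ln_fact_eq_sum[of a n] ln_fact_eq_sum[of b n] ab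
      by (simp add: sum_subtractf right_diff_distrib)
    also have "\<dots> = ln (real (n choose a))"
      using binomial_fact[OF ab(5), where ?'a = real] by (simp add: ln_div ln_mult b_def)
    also have "\<dots> \<le> ln (real (4 ^ a))"
      using choose_half_le[of n] ab(5) unfolding a_def[symmetric]
      by (subst ln_le_cancel_iff) (auto simp del: of_nat_power)
    also have "\<dots> = real a * ln 4" by (simp add: ln_realpow)
    finally have "psi n \<le> psi b + real a * ln 4" by simp
    also have "psi b \<le> real b * ln 4" by (rule less.IH) (use ab in simp)
    finally show ?thesis using ab(1) by (simp add: algebra_simps)
  qed
qed

text \<open>A prime \<open>p\<close> enters psi with ln p for each power of \<open>p\<close> up to
  \<open>n\<close>. If there are k of them, the total is ln (p^k), at most ln n.\<close>

lemma psi_le_prime_count: "psi n \<le> real (prime_count n) * ln (real n)"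
proof -
  define P where "P = {p. prime p \<and> p \<le> n}"
  define D where "D = {d\<in>{1..n}. primepow d}"
  have "psi n = (\<Sum>d\<in>D. ln (real (aprimedivisor d)))"
    unfolding psi_def D_def by (subst sum.inter_filter) (auto simp: mangoldt_def intro!: sum.cong)
  also have "\<dots> = (\<Sum>p\<in>P. \<Sum>d\<in>{d\<in>D. aprimedivisor d = p}. ln (real (aprimedivisor d)))"
  proof (rule sum.group[symmetric])
    show "aprimedivisor ` D \<subseteq> P"
    proof
      fix p assume "p \<in> aprimedivisor ` D"
      then obtain d where d: "d \<in> D" "p = aprimedivisor d" by auto
      have "d > 1" using d by (auto simp: D_def dest: primepow_gt_Suc_0)
      have "prime p" unfolding d(2) by (rule aprimedivisor_nat(1)) (use \<open>d > 1\<close> in simp)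
      have "p dvd d" unfolding d(2) by (rule aprimedivisor_nat(2)) (use \<open>d > 1\<close> in simp)
      show "p \<in> P" using \<open>prime p\<close> \<open>p dvd d\<close> d(1) \<open>d > 1\<close> dvd_imp_le[of p d] by (auto simp: P_def D_def)
    qed
  qed (auto simp: P_def D_def finite_primes_le)
  also have "\<dots> \<le> (\<Sum>p\<in>P. ln (real n))"
  proof (rule sum_mono)
    fix p assume p: "p \<in> P"
    have p2: "p \<ge> 2" "p \<le> n" using p by (auto simp: P_def prime_ge_2_nat)
    define S where "S = {k. 1 \<le> k \<and> p ^ k \<le> n}"
    have "S \<subseteq> {1..n}"
    proof
      fix k assume "k \<in> S"
      then have k: "1 \<le> k" "p ^ k \<le> n" by (auto simp: S_def)
      have "k < 2 ^ k" by simp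
      also have "2 ^ k \<le> p ^ k" using p2 by (intro power_mono) auto
      finally show "k \<in> {1..n}" using k by simp
    qed
    moreover have "1 \<in> S" using p2 by (auto simp: S_def)
    moreover have "m' \<in> S" if "m \<in> S" "1 \<le> m'" "m' \<le> m" for m m'
    proof -
      have "p ^ m' \<le> p ^ m" using that p2 by (intro power_increasing) auto
      then show ?thesis using that by (auto simp: S_def)
    qed
    ultimately have S: "S = {1..Max S}" and finS: "finite S"
      using downward_closed_eq_atLeastAtMost[of S n] finite_subset[of S "{1..n}"] by blast+
    have "Max S \<in> S" using \<open>1 \<in> S\<close> finS by (intro Max_in) auto
    then have pow: "p ^ Max S \<le> n" unfolding S_def by auto
    have "(\<Sum>d\<in>{d\<in>D. aprimedivisor d = p}. ln (real (aprimedivisor d)))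
        = real (card {d\<in>D. aprimedivisor d = p}) * ln (real p)"
      by simp
    also have "{d\<in>D. aprimedivisor d = p} \<subseteq> (\<lambda>k. p ^ k) ` S"
    proof
      fix d assume "d \<in> {d\<in>D. aprimedivisor d = p}"
      then have d: "primepow d" "aprimedivisor d = p" "d \<le> n" by (auto simp: D_def)
      obtain q k where qk: "prime q" "k > 0" "d = q ^ k" using d(1) by (auto simp: primepow_def)
      then have "q = p" using d(2) by (simp add: aprimedivisor_prime_power)
      then show "d \<in> (\<lambda>k. p ^ k) ` S" using qk d(3) by (auto simp: S_def)
    qed
    then have "card {d\<in>D. aprimedivisor d = p} \<le> card ((\<lambda>k. p ^ k) ` S)"
      using finS by (intro card_mono) auto
    also have "\<dots> \<le> card S" by (rule card_image_le[OF finS])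
    also have "card S = Max S" by (subst S) simp
    finally have "real (card {d\<in>D. aprimedivisor d = p}) * ln (real p) \<le> real (Max S) * ln (real p)"
      using p2 by (intro mult_right_mono) auto
    also have "\<dots> = ln (real (p ^ Max S))" using p2 by (simp add: ln_realpow)
    also have "\<dots> \<le> ln (real n)"
      using pow p2 by (subst ln_le_cancel_iff) (auto simp del: of_nat_power)
    finally show "(\<Sum>d\<in>{d\<in>D. aprimedivisor d = p}. ln (real (aprimedivisor d))) \<le> ln (real n)"
      by simp
  qed
  also have "\<dots> = real (prime_count n) * ln (real n)"
    by (simp add: P_def prime_count_def)
  finally show ?thesis .
qed

text \<open>\<open>L\<close> is lcm {1..K}, written as a product of one prime factor for each prime
  power up to \<open>K\<close>; this form makes its logarithm literally psi.\<close>

lemma common_multiple_psi: "\<exists>L>0. (\<forall>m\<in>{1..K}. m dvd L) \<and> ln (real L) = psi K"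
proof -
  define D where "D = {d\<in>{1..K}. primepow d}"
  define L where "L = (\<Prod>d\<in>D. aprimedivisor d)"
  have pos: "aprimedivisor d > 0" if "primepow d" for d :: nat
    using that by (intro aprimedivisor_pos_nat) (auto dest: primepow_gt_Suc_0)
  have "L > 0" unfolding L_def using pos by (intro prod_pos) (auto simp: D_def)
  moreover have "ln (real L) = psi K"
    unfolding L_def psi_def of_nat_prod using pos
    by (subst ln_prod) (auto simp: D_def mangoldt_def sum.inter_filter[symmetric] intro: gr0I)
  moreover have "m dvd L" if m: "m \<in> {1..K}" for m
  proof -
    define E where "E = {d. d dvd m \<and> primepow d}"
    have ED: "E \<subseteq> D" using m by (auto simp: E_def D_def dest: dvd_imp_le dvd_pos_nat intro: Suc_leI)
    have fin: "finite E" "finite D" using ED finite_subset[of E D] by (auto simp: D_def)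
    have "ln (real m) = (\<Sum>d | d dvd m. mangoldt d)"
      using mangoldt_sum[of m, where ?'a = real] m by simp
    also have "\<dots> = (\<Sum>d\<in>E. ln (real (aprimedivisor d)))"
      using m by (intro sum.mono_neutral_cong_right) (auto simp: E_def mangoldt_def)
    also have "\<dots> = ln (real (\<Prod>d\<in>E. aprimedivisor d))"
      unfolding of_nat_prod using pos fin by (subst ln_prod) (auto simp: E_def intro: gr0I)
    finally have "real m = real (\<Prod>d\<in>E. aprimedivisor d)"
      using m pos by (subst (asm) ln_inj_iff) (auto simp: E_def intro!: prod_pos simp del: of_nat_prod)
    then have "m = (\<Prod>d\<in>E. aprimedivisor d)" by linarith
    moreover have "(\<Prod>d\<in>E. aprimedivisor d) dvd L"
      unfolding L_def by (rule prod_dvd_prod_subset[OF fin(2) ED])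
    ultimately show ?thesis by simp
  qed
  ultimately show ?thesis by blast
qed

section \<open>Stirling estimates for factorials of quotients\<close>

text \<open>This is ln (1 + x) >= 2x / (2 + x) at x = 1/n. It supplies the induction step for the
  upper Stirling bound with the term 1/2.\<close>

lemma ln_Suc_div_ge:
  assumes "n > 0"
  shows "1 \<le> (real n + 1 / 2) * (ln (real (Suc n)) - ln (real n))"
proof -
  define f :: "real \<Rightarrow> real" where "f = (\<lambda>x. ln (1 + x) - 2 * x / (2 + x))"
  define x where "x = 1 / real n"
  have x: "x > 0" using assms by (simp add: x_def)
  have "f 0 \<le> f x"
  proof (rule DERIV_nonneg_imp_nondecreasing[of 0 x f])
    show "0 \<le> x" using x by simp
    fix t :: real assume t: "0 \<le> t" "t \<le> x"
    have "(f has_real_derivative 1 / (1 + t) - (2 * (2 + t) - 2 * t) / ((2 + t) * (2 + t))) (at t)"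
      unfolding f_def using t by (auto intro!: derivative_eq_intros)
    moreover have "1 / (1 + t) - (2 * (2 + t) - 2 * t) / ((2 + t) * (2 + t)) = t ^ 2 / ((1 + t) * (2 + t) ^ 2)"
      using t by (simp add: divide_simps power2_eq_square) (simp add: algebra_simps)
    moreover have "0 \<le> t ^ 2 / ((1 + t) * (2 + t) ^ 2)" using t by simp
    ultimately show "\<exists>y. (f has_real_derivative y) (at t) \<and> 0 \<le> y"
      by (intro exI[of _ "t ^ 2 / ((1 + t) * (2 + t) ^ 2)"]) simp
  qed
  then have "2 * x / (2 + x) \<le> ln (1 + x)" by (simp add: f_def)
  moreover have "2 * x / (2 + x) = 1 / (real n + 1 / 2)" using assms by (simp add: x_def field_simps)
  moreover have "1 + x = real (Suc n) / real n" using assms by (simp add: x_def field_simps)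
  then have "ln (1 + x) = ln (real (Suc n)) - ln (real n)" using assms by (simp add: ln_div)
  ultimately have "1 / (real n + 1 / 2) \<le> ln (real (Suc n)) - ln (real n)" by linarith
  then show ?thesis by (simp add: pos_divide_le_eq mult.commute)
qed

lemma ln_fact_le:
  assumes "n > 0"
  shows "ln (fact n) \<le> (real n + 1 / 2) * ln (real n) - real n + 1"
  using assms
proof (induction n rule: nat_induct_non_zero)
  case 1
  then show ?case by simp
next
  case (Suc n)
  have "ln (fact (Suc n) :: real) = ln (real (Suc n)) + ln (fact n)"
    unfolding fact_Suc by (simp add: ln_mult)
  moreover have "(real (Suc n) + 1 / 2) * ln (real (Suc n))
      = (real n + 1 / 2) * ln (real (Suc n)) + ln (real (Suc n))"
    by (simp add: algebra_simps)
  moreover have "1 \<le> (real n + 1 / 2) * ln (real (Suc n)) - (real n + 1 / 2) * ln (real n)"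
    using ln_Suc_div_ge[OF Suc.hyps] unfolding right_diff_distrib .
  ultimately show ?case using Suc.IH by linarith
qed

lemma ln_fact_ge:
  assumes "n > 0"
  shows "real n * ln (real n) - real n + 1 \<le> ln (fact n)"
  using assms
proof (induction n rule: nat_induct_non_zero)
  case 1
  then show ?case by simp
next
  case (Suc n)
  have "ln (fact (Suc n) :: real) = ln (real (Suc n)) + ln (fact n)"
    unfolding fact_Suc by (simp add: ln_mult)
  moreover have "real n * (ln (real (Suc n)) - ln (real n)) \<le> 1"
  proof -
    have "ln (real (Suc n)) - ln (real n) = ln (real (Suc n) / real n)"
      using Suc.hyps by (simp add: ln_div)
    also have "real (Suc n) / real n = 1 + 1 / real n"
      using Suc.hyps by (simp add: field_simps)
    finally have "ln (real (Suc n)) - ln (real n) = ln (1 + 1 / real n)" .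
    also have "ln (1 + 1 / real n) \<le> 1 / real n" by (rule ln_add_one_self_le_self) simp
    finally show ?thesis using Suc.hyps by (simp add: field_simps)
  qed
  ultimately show ?case using Suc.IH by (simp add: algebra_simps)
qed

text \<open>The Stirling bound is increasing in its argument from 1 on, so the integer quotient may
  be replaced by the real one.\<close>

lemma ln_fact_div_le:
  fixes y :: real
  assumes "d > 0" "d \<le> n" "y = real n / real d"
  shows "ln (fact (n div d)) \<le> (y + 1 / 2) * ln y - y + 1"
proof -
  define k where "k = n div d"
  have k: "k > 0" using assms by (simp add: k_def div_greater_zero_iff)
  have ky: "real k \<le> y" unfolding assms(3) k_def by (rule of_nat_div_le)
  have "(real k + 1 / 2) * ln (real k) - real k \<le> (y + 1 / 2) * ln y - y"
  proof (rule DERIV_nonneg_imp_nondecreasing[OF ky])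
    fix t assume t: "real k \<le> t" "t \<le> y"
    have t1: "t \<ge> 1" using t k by linarith
    have "((\<lambda>t. (t + 1 / 2) * ln t - t) has_real_derivative ln t + (t + 1 / 2) / t - 1) (at t)"
      using t1 by (auto intro!: derivative_eq_intros)
    moreover have "0 \<le> ln t + (t + 1 / 2) / t - 1" using t1 by (simp add: add_divide_distrib)
    ultimately show "\<exists>z. ((\<lambda>t. (t + 1 / 2) * ln t - t) has_real_derivative z) (at t) \<and> 0 \<le> z"
      by blast
  qed
  then show ?thesis using ln_fact_le[OF k] by (simp add: k_def)
qed

text \<open>To round down, the bound is applied to the factorial of k + 1 >= y; removing the last
  factor costs ln (y + 1).\<close>

lemma ln_fact_div_ge:
  fixes y :: real
  assumes "d > 0" "d \<le> n" "y = real n / real d"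
  shows "y * ln y - y + 1 - ln (y + 1) \<le> ln (fact (n div d))"
proof -
  define k where "k = n div d"
  have y1: "y \<ge> 1" using assms by simp
  have ky: "real k \<le> y" unfolding assms(3) k_def by (rule of_nat_div_le)
  have yk: "y \<le> real (Suc k)"
    unfolding assms(3) k_def by (rule le_of_nat_Suc_div[OF assms(1)])
  have "y * ln y - y \<le> real (Suc k) * ln (real (Suc k)) - real (Suc k)"
  proof (rule DERIV_nonneg_imp_nondecreasing[OF yk])
    fix t assume t: "y \<le> t" "t \<le> real (Suc k)"
    have t1: "t \<ge> 1" using t y1 by linarith
    have "((\<lambda>t. t * ln t - t) has_real_derivative ln t) (at t)"
      using t1 by (auto intro!: derivative_eq_intros)
    moreover have "0 \<le> ln t" using t1 by simp
    ultimately show "\<exists>z. ((\<lambda>t. t * ln t - t) has_real_derivative z) (at t) \<and> 0 \<le> z"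
      by blast
  qed
  also have "\<dots> + 1 \<le> ln (fact (Suc k))" using ln_fact_ge[of "Suc k"] by simp
  also have "ln (fact (Suc k) :: real) = ln (real (Suc k)) + ln (fact k)"
    unfolding fact_Suc by (simp add: ln_mult)
  also have "ln (real (Suc k)) \<le> ln (y + 1)" using ky y1 by (subst ln_le_cancel_iff) auto
  finally show ?thesis by (simp add: k_def)
qed

text \<open>With Stirling's estimates the terms \<open>n * ln n\<close> cancel and
  \<open>n * ln k\<close> remains, with leading constant 1. This is the mean value that loses no
  constant factor.\<close>

lemma sum_psi_div_ge_ln:
  assumes "0 < k" "k \<le> n"
  shows "real n * ln (real k) - real k * (ln (real n) / 2 + 1) \<le> (\<Sum>m=1..k. psi (n div m))"
proof -
  define y where "y = real n / real k"
  have y: "y \<ge> 1" "ln y = ln (real n) - ln (real k)" "real k * y = real n"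
    using assms by (auto simp: y_def ln_div)
  have "real k * ln (fact (n div k)) \<le> real k * ((y + 1 / 2) * ln y - y + 1)"
    using ln_fact_div_le[OF assms y_def] by (intro mult_left_mono) auto
  also have "\<dots> = real k * y * ln y + real k / 2 * ln y - real k * y + real k"
    by (simp add: algebra_simps)
  also have "\<dots> = real n * (ln (real n) - ln (real k)) + real k / 2 * (ln (real n) - ln (real k)) - real n + real k"
    unfolding y(2,3) ..
  finally have "real k * ln (fact (n div k)) \<le> real n * (ln (real n) - ln (real k)) + real k / 2 * (ln (real n) - ln (real k)) - real n + real k" .
  moreover have "real n * ln (real n) - real n + 1 \<le> ln (fact n)"
    using assms by (intro ln_fact_ge) auto
  moreover have "ln (real k) * real k \<ge> 0" using assms by simp
  ultimately show ?thesis using sum_psi_div_ge[OF assms(1), of n]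
    by (simp add: algebra_simps)
qed

section \<open>Numerical logarithms and the lower bound for psi\<close>

lemma ln_2_bounds: "6931 / 10000 \<le> ln (2::real)" "ln (2::real) \<le> 6932 / 10000"
  using ln_approx_bounds[of 2 4] by (simp_all add: eval_nat_numeral)

lemma ln_3_2_bounds: "4054 / 10000 \<le> ln (3 / 2::real)" "ln (3 / 2::real) \<le> 4055 / 10000"
  using ln_approx_bounds[of "3 / 2" 3] by (simp_all add: eval_nat_numeral)

lemma ln_5_4_bounds: "2231 / 10000 \<le> ln (5 / 4::real)" "ln (5 / 4::real) \<le> 2232 / 10000"
  using ln_approx_bounds[of "5 / 4" 2] by (simp_all add: eval_nat_numeral)

lemma ln_3_bounds: "10985 / 10000 \<le> ln (3::real)" "ln (3::real) \<le> 10987 / 10000"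
proof -
  have "ln (3::real) = ln 2 + ln (3 / 2)" using ln_mult[of 2 "3 / 2 :: real"] by simp
  then show "10985 / 10000 \<le> ln (3::real)" "ln (3::real) \<le> 10987 / 10000"
    using ln_2_bounds ln_3_2_bounds by simp_all
qed

lemma ln_4_eq: "ln (4::real) = 2 * ln 2"
  using ln_realpow[of 2 2] by simp

lemma ln_5_bounds: "16093 / 10000 \<le> ln (5::real)" "ln (5::real) \<le> 16096 / 10000"
proof -
  have "ln (5::real) = ln 4 + ln (5 / 4)" using ln_mult[of 4 "5 / 4 :: real"] by simp
  then show "16093 / 10000 \<le> ln (5::real)" "ln (5::real) \<le> 16096 / 10000"
    using ln_2_bounds ln_5_4_bounds by (simp_all add: ln_4_eq)
qed

lemma ln_30_eq: "ln (30::real) = ln 2 + ln 3 + ln 5"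
  using ln_mult[of 6 "5 :: real"] ln_mult[of 2 "3 :: real"] by simp

text \<open>Chebyshev's constant ln 2 / 2 + ln 3 / 3 + ln 5 / 5 - ln 30 / 30 slightly exceeds 0.921.
  The coefficient 5/2 collects 1/2 from each of the three subtracted factorials and 1 from the
  rounding of \<open>n div 30\<close>; the constant 4 is below 3/2 * ln 30 - 1 - 3/40.\<close>

lemma psi_ge:
  assumes n: "n \<ge> 400"
  shows "921 / 1000 * real n - 5 / 2 * ln (real n) + 4 \<le> psi n"
proof -
  define L where "L = ln (real n)"
  have T: "real n * L - real n + 1 \<le> ln (fact n)"
    unfolding L_def using n by (intro ln_fact_ge) auto
  have U: "ln (fact (n div d)) \<le> real n / real d * (L - ln (real d)) + (L - ln (real d)) / 2 - real n / real d + 1"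
    if "d > 0" "d \<le> 30" for d
  proof -
    have "ln (real n / real d) = L - ln (real d)" using that n by (simp add: ln_div L_def)
    then show ?thesis using ln_fact_div_le[of d n "real n / real d"] that n
      by (simp add: distrib_right)
  qed
  \<comment> \<open>Here \<open>n \<ge> 400\<close> enters, as 30 / 400 = 3 / 40.\<close>
  have "ln (real n / 30 + 1) \<le> L - ln 30 + 3 / 40"
  proof -
    have "real n / 30 + 1 = real n / 30 * (1 + 30 / real n)" using n by (simp add: field_simps)
    also have "ln \<dots> = ln (real n / 30) + ln (1 + 30 / real n)"
      using n add_pos_nonneg[of 1 "30 / real n"] by (intro ln_mult_pos) auto
    also have "ln (real n / 30) = L - ln 30" using n by (simp add: ln_div L_def)
    also have "ln (1 + 30 / real n) \<le> 30 / real n" by (rule ln_add_one_self_le_self) simp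
    also have "30 / real n \<le> 3 / 40" using n by (simp add: field_simps)
    finally show ?thesis by simp
  qed
  moreover have "real n / 30 * ln (real n / 30) - real n / 30 + 1 - ln (real n / 30 + 1) \<le> ln (fact (n div 30))"
    using ln_fact_div_ge[of 30 n "real n / 30"] n by simp
  moreover have "ln (real n / 30) = L - ln 30" using n by (simp add: ln_div L_def)
  ultimately have V: "real n / 30 * (L - ln 30) - real n / 30 + 1 - (L - ln 30 + 3 / 40) \<le> ln (fact (n div 30))"
    by simp
  have "psi n \<ge> real n * (ln 2 / 2 + ln 3 / 3 + ln 5 / 5 - ln 30 / 30)
      - 5 / 2 * L + 3 / 2 * ln 30 - 1 - 3 / 40"
    using psi_ge_ln_fact[of n] T U[of 2] U[of 3] U[of 5] V
    unfolding ln_30_eq by (simp add: algebra_simps add_divide_distrib diff_divide_distrib)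
  moreover have "921 / 1000 * real n \<le> real n * (ln 2 / 2 + ln 3 / 3 + ln 5 / 5 - ln 30 / 30)"
  proof -
    have "921 / 1000 \<le> ln 2 / 2 + ln 3 / 3 + ln 5 / 5 - ln (30::real) / 30"
      using ln_2_bounds ln_3_bounds ln_5_bounds
      unfolding ln_30_eq add_divide_distrib by linarith
    then have "921 / 1000 * real n \<le> (ln 2 / 2 + ln 3 / 3 + ln 5 / 5 - ln (30::real) / 30) * real n"
      by (rule mult_right_mono) simp
    then show ?thesis by (simp only: mult.commute)
  qed
  moreover have "ln (30::real) \<ge> 34 / 10"
    using ln_2_bounds ln_3_bounds ln_5_bounds by (simp add: ln_30_eq)
  ultimately show ?thesis unfolding L_def by linarith
qed

lemma prime_count_ge:
  assumes "n \<ge> 400"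
  shows "(921 / 1000 * real n + 4) / ln (real n) - 5 / 2 \<le> real (prime_count n)"
proof -
  have pos: "ln (real n) > 0" using assms by (subst ln_gt_zero_iff) auto
  have "921 / 1000 * real n - 5 / 2 * ln (real n) + 4 \<le> real (prime_count n) * ln (real n)"
    using psi_ge[OF assms] psi_le_prime_count[of n] by linarith
  then show ?thesis using pos by (simp add: field_simps)
qed

section \<open>Prime counts below 2334\<close>

definition primes_149 :: "nat list" where
  "primes_149 = [2, 3, 5, 7, 11, 13, 17, 19, 23, 29, 31, 37, 41, 43, 47, 53, 59, 61, 67, 71, 73, 79, 83, 89, 97,
    101, 103, 107, 109, 113, 127, 131, 137, 139]"

text \<open>The bound is \<open>3481 = 59\<^sup>2\<close>.\<close>

definition no_small_factor :: "nat \<Rightarrow> bool" where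
  "no_small_factor n \<longleftrightarrow> 1 < n \<and> n < 3481 \<and> list_all (\<lambda>q. q dvd n \<longrightarrow> q = n)
    [2, 3, 5, 7, 11, 13, 17, 19, 23, 29, 31, 37, 41, 43, 47, 53]"

text \<open>A composite number below 13^2 = 169 has a prime factor of at most 11, so these five
  divisibility tests leave only the listed primes.\<close>

lemma primes_less_149:
  assumes "prime (p::nat)" "p < 149"
  shows "p \<in> set primes_149"
proof -
  have "p = q" if "prime q" "q dvd p" for q
    using primes_dvd_imp_eq[OF that(1) assms(1) that(2)] by simp
  then have "(2 dvd p \<longrightarrow> p = 2) \<and> (3 dvd p \<longrightarrow> p = 3) \<and> (5 dvd p \<longrightarrow> p = 5)
      \<and> (7 dvd p \<longrightarrow> p = 7) \<and> (11 dvd p \<longrightarrow> p = 11)"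
    by simp
  moreover have "p > 1" using assms(1) by (rule prime_gt_1_nat)
  moreover have "list_all (\<lambda>p. p > 1 \<longrightarrow> (2 dvd p \<longrightarrow> p = 2) \<and> (3 dvd p \<longrightarrow> p = 3) \<and> (5 dvd p \<longrightarrow> p = 5)
      \<and> (7 dvd p \<longrightarrow> p = 7) \<and> (11 dvd p \<longrightarrow> p = (11::nat)) \<longrightarrow> p \<in> set primes_149)
    [148, 147, 146, 145, 144, 143, 142, 141, 140, 139, 138, 137, 136, 135, 134, 133, 132, 131, 130,
     129, 128, 127, 126, 125, 124, 123, 122, 121, 120, 119, 118, 117, 116, 115, 114, 113, 112, 111,
     110, 109, 108, 107, 106, 105, 104, 103, 102, 101, 100, 99, 98, 97, 96, 95, 94, 93, 92, 91, 90,
     89, 88, 87, 86, 85, 84, 83, 82, 81, 80, 79, 78, 77, 76, 75, 74, 73, 72, 71, 70, 69, 68, 67, 66,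
     65, 64, 63, 62, 61, 60, 59, 58, 57, 56, 55, 54, 53, 52, 51, 50, 49, 48, 47, 46, 45, 44, 43, 42,
     41, 40, 39, 38, 37, 36, 35, 34, 33, 32, 31, 30, 29, 28, 27, 26, 25, 24, 23, 22, 21, 20, 19, 18,
     17, 16, 15, 14, 13, 12, 11, 10, 9, 8, 7, 6, 5, 4, 3, 2, 1, 0]" (is "list_all _ ?xs")
    by (simp add: primes_149_def)
  moreover have "{..<149} = set ?xs"
    by (simp add: lessThan_nat_numeral lessThan_Suc)
  then have "p \<in> set ?xs" using assms(2) by blast
  ultimately show ?thesis by (simp only: list_all_iff)
qed

lemma prime_count_le_filter:
  assumes "x < 149"
  shows "prime_count x \<le> length (filter (\<lambda>p. p \<le> x) primes_149)"
proof -
  have "prime_count x \<le> card (set (filter (\<lambda>p. p \<le> x) primes_149))"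
    unfolding prime_count_def using primes_less_149 assms by (intro card_mono) auto
  also have "\<dots> \<le> length (filter (\<lambda>p. p \<le> x) primes_149)" by (rule card_length)
  finally show ?thesis .
qed

text \<open>Upper bounds are needed only at the thresholds, for the primes that must be
  discarded.\<close>

lemma prime_count_upper: "prime_count 4 \<le> 2" "prime_count 12 \<le> 5" "prime_count 28 \<le> 9"
  "prime_count 138 \<le> 33" "prime_count 148 \<le> 34"
  using prime_count_le_filter[of 4] prime_count_le_filter[of 12] prime_count_le_filter[of 28]
    prime_count_le_filter[of 138] prime_count_le_filter[of 148] by (simp_all add: primes_149_def)

text \<open>The smaller of two complementary divisors has a prime factor whose square is at most
  \<open>n\<close>, hence below 59^2.\<close>

lemma prime_by_trial_division:
  assumes "no_small_factor n"
  shows "prime n"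
proof (rule ccontr)
  assume "\<not> prime n"
  have n: "1 < n" "n < 3481" using assms by (auto simp: no_small_factor_def)
  obtain q where q: "prime q" "q dvd n" "q * q \<le> n"
  proof -
    obtain k where k: "k dvd n" "k \<noteq> 1" "k \<noteq> n"
      using \<open>\<not> prime n\<close> n(1) by (auto simp: prime_nat_iff)
    then obtain l where l: "n = k * l" by auto
    have "k \<noteq> 0" "l \<noteq> 0" using l n(1) by (cases k; cases l; simp)+
    have "l \<noteq> 1" using l k(3) by auto
    have "\<exists>m. m dvd n \<and> m \<noteq> 1 \<and> m \<noteq> 0 \<and> m * m \<le> n"
    proof (cases "k \<le> l")
      case True
      then have "k * k \<le> n" unfolding l by (rule mult_le_mono2)
      then show ?thesis using k \<open>k \<noteq> 0\<close> by blast
    next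
      case False
      then have "l \<le> k" by simp
      then have "l * l \<le> n" unfolding l by (rule mult_le_mono1)
      then show ?thesis using l \<open>l \<noteq> 0\<close> \<open>l \<noteq> 1\<close> by (intro exI[of _ l]) simp
    qed
    then obtain m where m: "m dvd n" "m \<noteq> 1" "m \<noteq> 0" "m * m \<le> n" by blast
    obtain q where q: "prime q" "q dvd m" using m(2) prime_factor_nat by blast
    have "q \<le> m" using q(2) m(3) by (intro dvd_imp_le) auto
    then have "q * q \<le> n" using m(4) mult_le_mono[of q m q m] by linarith
    moreover have "q dvd n" using q(2) m(1) by (rule dvd_trans)
    ultimately show ?thesis using q(1) that by blast
  qed
  have "q < 59"
  proof (rule ccontr)
    assume "\<not> q < 59"
    then have "59 * 59 \<le> q * q" by (intro mult_le_mono) auto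
    then show False using q(3) n(2) by simp
  qed
  then have "q \<in> set primes_149" using primes_less_149[OF q(1)] by simp
  with \<open>q < 59\<close> have mem: "q \<in> set (filter (\<lambda>q. q < 59) primes_149)" by simp
  have eq: "filter (\<lambda>q. q < 59) primes_149 = [2, 3, 5, 7, 11, 13, 17, 19, 23, 29, 31, 37, 41, 43, 47, 53]"
    by (simp add: primes_149_def)
  have "list_all (\<lambda>q. q dvd n \<longrightarrow> q = n) (filter (\<lambda>q. q < 59) primes_149)"
    unfolding eq using assms by (simp only: no_small_factor_def)
  then have "q = n" using mem q(2) unfolding list_all_iff by blast
  moreover have "q < q * q" using prime_gt_1_nat[OF q(1)] by simp
  ultimately show False using q(3) by simp
qed

text \<open>Only lower bounds are claimed, so the entries of \<open>ps\<close> must be prime but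
  need not be all primes of the interval. The end points in the chain below are the arguments at
  which the later table evaluates prime counts.\<close>

lemma prime_count_step:
  assumes "c \<le> prime_count x"
    and "list_all (\<lambda>n. x < n \<and> n \<le> y \<and> no_small_factor n) ps"
    and "distinct ps" "c + length ps = c'" "x \<le> y"
  shows "c' \<le> prime_count y"
proof -
  have sub: "set ps \<subseteq> {p. prime p \<and> x < p \<and> p \<le> y}"
    using assms(2) prime_by_trial_division by (auto simp: list_all_iff)
  have un: "{p. prime p \<and> p \<le> y} = {p. prime p \<and> p \<le> x} \<union> {p. prime p \<and> x < p \<and> p \<le> y}"
    using assms(5) by auto
  have fin: "finite {p. prime p \<and> x < p \<and> p \<le> y}"
    by (rule finite_subset[OF _ finite_primes_le[of y]]) auto
  have "prime_count y = prime_count x + card {p. prime p \<and> x < p \<and> p \<le> y}"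
    unfolding prime_count_def un using fin finite_primes_le[of x]
    by (intro card_Un_disjoint) auto
  moreover have "card (set ps) \<le> card {p. prime p \<and> x < p \<and> p \<le> y}"
    using fin sub by (rule card_mono)
  ultimately show ?thesis using assms(1,3,4) distinct_card[of ps] by linarith
qed

lemma prime_count_7: "4 \<le> prime_count 7"
  by (rule prime_count_step[of 0 0 _ "[2, 3, 5, 7]"])
    (simp_all add: no_small_factor_def)

lemma prime_count_11: "5 \<le> prime_count 11"
  by (rule prime_count_step[OF prime_count_7, of _ "[11]"])
    (simp_all add: no_small_factor_def)

lemma prime_count_13: "6 \<le> prime_count 13"
  by (rule prime_count_step[OF prime_count_11, of _ "[13]"])
    (simp_all add: no_small_factor_def)

lemma prime_count_17: "7 \<le> prime_count 17"
  by (rule prime_count_step[OF prime_count_13, of _ "[17]"])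
    (simp_all add: no_small_factor_def)

lemma prime_count_19: "8 \<le> prime_count 19"
  by (rule prime_count_step[OF prime_count_17, of _ "[19]"])
    (simp_all add: no_small_factor_def)

lemma prime_count_23: "9 \<le> prime_count 23"
  by (rule prime_count_step[OF prime_count_19, of _ "[23]"])
    (simp_all add: no_small_factor_def)

lemma prime_count_29: "10 \<le> prime_count 29"
  by (rule prime_count_step[OF prime_count_23, of _ "[29]"])
    (simp_all add: no_small_factor_def)

lemma prime_count_31: "11 \<le> prime_count 31"
  by (rule prime_count_step[OF prime_count_29, of _ "[31]"])
    (simp_all add: no_small_factor_def)

lemma prime_count_37: "12 \<le> prime_count 37"
  by (rule prime_count_step[OF prime_count_31, of _ "[37]"])
    (simp_all add: no_small_factor_def)

lemma prime_count_41: "13 \<le> prime_count 41"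
  by (rule prime_count_step[OF prime_count_37, of _ "[41]"])
    (simp_all add: no_small_factor_def)

lemma prime_count_47: "15 \<le> prime_count 47"
  by (rule prime_count_step[OF prime_count_41, of _ "[43, 47]"])
    (simp_all add: no_small_factor_def)

lemma prime_count_53: "16 \<le> prime_count 53"
  by (rule prime_count_step[OF prime_count_47, of _ "[53]"])
    (simp_all add: no_small_factor_def)

lemma prime_count_59: "17 \<le> prime_count 59"
  by (rule prime_count_step[OF prime_count_53, of _ "[59]"])
    (simp_all add: no_small_factor_def)

lemma prime_count_67: "19 \<le> prime_count 67"
  by (rule prime_count_step[OF prime_count_59, of _ "[61, 67]"])
    (simp_all add: no_small_factor_def)

lemma prime_count_71: "20 \<le> prime_count 71"
  by (rule prime_count_step[OF prime_count_67, of _ "[71]"])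
    (simp_all add: no_small_factor_def)

lemma prime_count_79: "22 \<le> prime_count 79"
  by (rule prime_count_step[OF prime_count_71, of _ "[73, 79]"])
    (simp_all add: no_small_factor_def)

lemma prime_count_83: "23 \<le> prime_count 83"
  by (rule prime_count_step[OF prime_count_79, of _ "[83]"])
    (simp_all add: no_small_factor_def)

lemma prime_count_89: "24 \<le> prime_count 89"
  by (rule prime_count_step[OF prime_count_83, of _ "[89]"])
    (simp_all add: no_small_factor_def)

lemma prime_count_97: "25 \<le> prime_count 97"
  by (rule prime_count_step[OF prime_count_89, of _ "[97]"])
    (simp_all add: no_small_factor_def)

lemma prime_count_103: "27 \<le> prime_count 103"
  by (rule prime_count_step[OF prime_count_97, of _ "[101, 103]"])
    (simp_all add: no_small_factor_def)

lemma prime_count_109: "29 \<le> prime_count 109"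
  by (rule prime_count_step[OF prime_count_103, of _ "[107, 109]"])
    (simp_all add: no_small_factor_def)

lemma prime_count_137: "33 \<le> prime_count 137"
  by (rule prime_count_step[OF prime_count_109, of _ "[113, 127, 131, 137]"])
    (simp_all add: no_small_factor_def)

lemma prime_count_149: "35 \<le> prime_count 149"
  by (rule prime_count_step[OF prime_count_137, of _ "[139, 149]"])
    (simp_all add: no_small_factor_def)

lemma prime_count_167: "39 \<le> prime_count 167"
  by (rule prime_count_step[OF prime_count_149, of _ "[151, 157, 163, 167]"])
    (simp_all add: no_small_factor_def)

lemma prime_count_179: "41 \<le> prime_count 179"
  by (rule prime_count_step[OF prime_count_167, of _ "[173, 179]"])
    (simp_all add: no_small_factor_def)

lemma prime_count_191: "43 \<le> prime_count 191"
  by (rule prime_count_step[OF prime_count_179, of _ "[181, 191]"])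
    (simp_all add: no_small_factor_def)

lemma prime_count_211: "47 \<le> prime_count 211"
  by (rule prime_count_step[OF prime_count_191, of _ "[193, 197, 199, 211]"])
    (simp_all add: no_small_factor_def)

lemma prime_count_223: "48 \<le> prime_count 223"
  by (rule prime_count_step[OF prime_count_211, of _ "[223]"])
    (simp_all add: no_small_factor_def)

lemma prime_count_239: "52 \<le> prime_count 239"
  by (rule prime_count_step[OF prime_count_223, of _ "[227, 229, 233, 239]"])
    (simp_all add: no_small_factor_def)

lemma prime_count_269: "57 \<le> prime_count 269"
  by (rule prime_count_step[OF prime_count_239, of _ "[241, 251, 257, 263, 269]"])
    (simp_all add: no_small_factor_def)

lemma prime_count_283: "61 \<le> prime_count 283"
  by (rule prime_count_step[OF prime_count_269, of _ "[271, 277, 281, 283]"])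
    (simp_all add: no_small_factor_def)

lemma prime_count_349: "70 \<le> prime_count 349"
  by (rule prime_count_step[OF prime_count_283, of _ "[293, 307, 311, 313, 317, 331, 337, 347, 349]"])
    (simp_all add: no_small_factor_def)

lemma prime_count_367: "73 \<le> prime_count 367"
  by (rule prime_count_step[OF prime_count_349, of _ "[353, 359, 367]"])
    (simp_all add: no_small_factor_def)

lemma prime_count_389: "77 \<le> prime_count 389"
  by (rule prime_count_step[OF prime_count_367, of _ "[373, 379, 383, 389]"])
    (simp_all add: no_small_factor_def)

lemma prime_count_431: "83 \<le> prime_count 431"
  by (rule prime_count_step[OF prime_count_389, of _ "[397, 401, 409, 419, 421, 431]"])
    (simp_all add: no_small_factor_def)

lemma prime_count_457: "88 \<le> prime_count 457"
  by (rule prime_count_step[OF prime_count_431, of _ "[433, 439, 443, 449, 457]"])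
    (simp_all add: no_small_factor_def)

lemma prime_count_521: "98 \<le> prime_count 521"
  by (rule prime_count_step[OF prime_count_457, of _ "[461, 463, 467, 479, 487, 491, 499, 503, 509, 521]"])
    (simp_all add: no_small_factor_def)

lemma prime_count_557: "102 \<le> prime_count 557"
  by (rule prime_count_step[OF prime_count_521, of _ "[523, 541, 547, 557]"])
    (simp_all add: no_small_factor_def)

lemma prime_count_587: "107 \<le> prime_count 587"
  by (rule prime_count_step[OF prime_count_557, of _ "[563, 569, 571, 577, 587]"])
    (simp_all add: no_small_factor_def)

lemma prime_count_691: "125 \<le> prime_count 691"
  by (rule prime_count_step[OF prime_count_587, of _ "[593, 599, 601, 607, 613, 617, 619, 631, 641, 643, 647, 653, 659, 661, 673, 677, 683, 691]"])
    (simp_all add: no_small_factor_def)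

lemma prime_count_769: "136 \<le> prime_count 769"
  by (rule prime_count_step[OF prime_count_691, of _ "[701, 709, 719, 727, 733, 739, 743, 751, 757, 761, 769]"])
    (simp_all add: no_small_factor_def)

lemma prime_count_853: "147 \<le> prime_count 853"
  by (rule prime_count_step[OF prime_count_769, of _ "[773, 787, 797, 809, 811, 821, 823, 827, 829, 839, 853]"])
    (simp_all add: no_small_factor_def)

lemma prime_count_907: "155 \<le> prime_count 907"
  by (rule prime_count_step[OF prime_count_853, of _ "[857, 859, 863, 877, 881, 883, 887, 907]"])
    (simp_all add: no_small_factor_def)

lemma prime_count_1061: "178 \<le> prime_count 1061"
  by (rule prime_count_step[OF prime_count_907, of _ "[911, 919, 929, 937, 941, 947, 953, 967, 971, 977, 983, 991, 997, 1009, 1013, 1019, 1021, 1031, 1033, 1039, 1049, 1051, 1061]"])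
    (simp_all add: no_small_factor_def)

lemma prime_count_1181: "194 \<le> prime_count 1181"
  by (rule prime_count_step[OF prime_count_1061, of _ "[1063, 1069, 1087, 1091, 1093, 1097, 1103, 1109, 1117, 1123, 1129, 1151, 1153, 1163, 1171, 1181]"])
    (simp_all add: no_small_factor_def)

lemma prime_count_1319: "215 \<le> prime_count 1319"
  by (rule prime_count_step[OF prime_count_1181, of _ "[1187, 1193, 1201, 1213, 1217, 1223, 1229, 1231, 1237, 1249, 1259, 1277, 1279, 1283, 1289, 1291, 1297, 1301, 1303, 1307, 1319]"])
    (simp_all add: no_small_factor_def)

lemma prime_count_1801: "279 \<le> prime_count 1801"
  by (rule prime_count_step[OF prime_count_1319, of _ "[1321, 1327, 1361, 1367, 1373, 1381, 1399, 1409, 1423, 1427, 1429, 1433, 1439, 1447, 1451, 1453, 1459, 1471, 1481, 1483, 1487, 1489, 1493, 1499, 1511, 1523, 1531, 1543, 1549, 1553, 1559, 1567, 1571, 1579, 1583, 1597, 1601, 1607, 1609, 1613, 1619, 1621, 1627, 1637, 1657, 1663, 1667, 1669, 1693, 1697, 1699, 1709, 1721, 1723, 1733, 1741, 1747, 1753, 1759, 1777, 1783, 1787, 1789, 1801]"])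
    (simp_all add: no_small_factor_def)

lemma prime_count_2333: "345 \<le> prime_count 2333"
  by (rule prime_count_step[OF prime_count_1801, of _ "[1811, 1823, 1831, 1847, 1861, 1867, 1871, 1873, 1877, 1879, 1889, 1901, 1907, 1913, 1931, 1933, 1949, 1951, 1973, 1979, 1987, 1993, 1997, 1999, 2003, 2011, 2017, 2027, 2029, 2039, 2053, 2063, 2069, 2081, 2083, 2087, 2089, 2099, 2111, 2113, 2129, 2131, 2137, 2141, 2143, 2153, 2161, 2179, 2203, 2207, 2213, 2221, 2237, 2239, 2243, 2251, 2267, 2269, 2273, 2281, 2287, 2293, 2297, 2309, 2311, 2333]"])
    (simp_all add: no_small_factor_def)

section \<open>The bound by N / ln N\<close>

text \<open>The increments of the bounds 1, 2, 3, 4, 5, 57/10 for \<open>lgE 1\<close> to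
  \<open>lgE 6\<close>.\<close>

definition wt :: "nat \<Rightarrow> real" where
  "wt m = (if m \<le> 5 then 1 else 7 / 10)"

text \<open>Primes above \<open>thr m\<close> exceed \<open>\<Sum>i=1..m. L / i\<close> for \<open>L = lcm {1..m}\<close>; there are at most \<open>thr_count m\<close> primes below.\<close>

definition thr :: "nat \<Rightarrow> nat" where
  "thr m = (if m \<le> 2 then 4 else if m = 3 then 12 else if m = 4 then 28 else if m = 5 then 138 else 148)"

definition thr_count :: "nat \<Rightarrow> real" where
  "thr_count m = (if m \<le> 2 then 2 else if m = 3 then 5 else if m = 4 then 9 else if m = 5 then 33 else 34)"

lemma le_6_cases:
  fixes m :: nat
  assumes "1 \<le> m" "m \<le> 6"
  obtains "m = 1" | "m = 2" | "m = 3" | "m = 4" | "m = 5" | "m = 6"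
  using assms by linarith

lemma sum_wt_le_lgE:
  assumes "1 \<le> M" "M \<le> 6"
  shows "(\<Sum>m=1..M. wt m) \<le> lgE M"
  using le_6_cases[OF assms]
  by cases (use lgE_1 lgE_2 lgE_3 lgE_4 lgE_5 lgE_6 in \<open>simp_all add: wt_def eval_nat_numeral\<close>)

lemma faithful_thr:
  assumes "1 \<le> m" "m \<le> 6" "thr m < p"
  shows "faithful p m"
  using le_6_cases[OF assms(1,2)]
  by cases (use assms(3) faithful_1 faithful_2 faithful_3 faithful_4 faithful_5 faithful_6 in
    \<open>simp_all add: thr_def\<close>)

lemma prime_count_thr:
  assumes "1 \<le> m" "m \<le> 6"
  shows "real (prime_count (thr m)) \<le> thr_count m"
  using le_6_cases[OF assms]
  by cases (use prime_count_upper in \<open>simp_all add: thr_def thr_count_def\<close>)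

text \<open>\<open>core a b\<close> serves as the extra set of denominators; it is admissible
  because \<open>thr 1 = 4\<close> keeps the primes 2 and 3 out of the weighted sum.\<close>

lemma lgE_ge_weights:
  assumes "N \<ge> 12" "a \<ge> 2" "b \<ge> 1" "2 ^ a \<le> N" "3 ^ b \<le> N" "K \<le> 6"
    and c: "\<And>m. 1 \<le> m \<Longrightarrow> m \<le> K \<Longrightarrow> c m \<le> real (prime_count (N div m))"
  shows "34 / 7 + real (a - 2) + real (b - 1) + (\<Sum>m=1..K. wt m * (c m - thr_count m)) \<le> lgE N"
proof -
  have "log 2 (real (card (esums (core a b))))
    + (\<Sum>m=1..K. wt m * (real (prime_count (N div m)) - real (prime_count (thr m)))) \<le> lgE N"
  proof (rule lgE_ge_weighted)
    show "\<not> p dvd w" if "w \<in> core a b" "prime p" "thr 1 < p" for w p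
      using core_coprime[OF that(1,2)] that(3) by (simp add: thr_def)
    show "thr m \<le> thr m'" if "m \<le> m'" for m m'
      using that by (auto simp: thr_def)
  qed (use assms(1,4-6) core_subset sum_wt_le_lgE faithful_thr in \<open>auto simp: wt_def\<close>)
  moreover have "(\<Sum>m=1..K. wt m * (c m - thr_count m))
    \<le> (\<Sum>m=1..K. wt m * (real (prime_count (N div m)) - real (prime_count (thr m))))"
  proof (intro sum_mono mult_left_mono)
    fix m assume "m \<in> {1..K}"
    then show "c m - thr_count m \<le> real (prime_count (N div m)) - real (prime_count (thr m))"
      using c[of m] prime_count_thr[of m] assms(6) by auto
  qed (simp add: wt_def)
  ultimately show ?thesis using log2_core_ge[OF assms(2,3)] by linarith
qed

lemma real_prime_count_ge: "c \<le> prime_count x \<Longrightarrow> x \<le> y \<Longrightarrow> real c \<le> real (prime_count y)"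
  using prime_count_mono[of x y] by simp

text \<open>The versions with 2 to 6 counts are tailored to numerical evaluation: \<open>c1\<close>,
  \<open>c2\<close>, ... bound the prime counts at \<open>N div 1\<close>, \<open>N div 2\<close>,
  ..., the subtracted numbers are the values of \<open>thr_count\<close>, and the factor 7/10 in the
  last version is \<open>wt 6\<close>.\<close>

lemma lgE_ge_counts_2:
  assumes "N \<ge> 12" "a \<ge> 2" "b \<ge> 1" "2 ^ a \<le> N" "3 ^ b \<le> N"
    and "c1 \<le> prime_count x1" "x1 \<le> N div 1"
    and "c2 \<le> prime_count x2" "x2 \<le> N div 2"
  shows "34 / 7 + real (a - 2) + real (b - 1) + (real c1 - 2) + (real c2 - 2) \<le> lgE N"
proof -
  have "34 / 7 + real (a - 2) + real (b - 1)
      + (\<Sum>m=1..2. wt m * ((\<lambda>m. real (if m = 1 then c1 else c2)) m - thr_count m)) \<le> lgE N"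
  proof (rule lgE_ge_weights)
    fix m :: nat assume m: "1 \<le> m" "m \<le> 2"
    then have "m \<le> 6" by simp
    from m(1) this show "real (if m = 1 then c1 else c2) \<le> real (prime_count (N div m))"
      by (cases rule: le_6_cases) (use m real_prime_count_ge[OF assms(6,7)] real_prime_count_ge[OF assms(8,9)] in simp_all)
  qed (use assms in simp_all)
  then show ?thesis by (simp add: eval_nat_numeral wt_def thr_count_def)
qed

lemma lgE_ge_counts_3:
  assumes "N \<ge> 12" "a \<ge> 2" "b \<ge> 1" "2 ^ a \<le> N" "3 ^ b \<le> N"
    and "c1 \<le> prime_count x1" "x1 \<le> N div 1"
    and "c2 \<le> prime_count x2" "x2 \<le> N div 2"
    and "c3 \<le> prime_count x3" "x3 \<le> N div 3"
  shows "34 / 7 + real (a - 2) + real (b - 1) + (real c1 - 2) + (real c2 - 2) + (real c3 - 5) \<le> lgE N"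
proof -
  have "34 / 7 + real (a - 2) + real (b - 1)
      + (\<Sum>m=1..3. wt m * ((\<lambda>m. real (if m = 1 then c1 else if m = 2 then c2 else c3)) m - thr_count m)) \<le> lgE N"
  proof (rule lgE_ge_weights)
    fix m :: nat assume m: "1 \<le> m" "m \<le> 3"
    then have "m \<le> 6" by simp
    from m(1) this show "real (if m = 1 then c1 else if m = 2 then c2 else c3) \<le> real (prime_count (N div m))"
      by (cases rule: le_6_cases) (use m real_prime_count_ge[OF assms(6,7)] real_prime_count_ge[OF assms(8,9)] real_prime_count_ge[OF assms(10,11)] in simp_all)
  qed (use assms in simp_all)
  then show ?thesis by (simp add: eval_nat_numeral wt_def thr_count_def)
qed

lemma lgE_ge_counts_4:
  assumes "N \<ge> 12" "a \<ge> 2" "b \<ge> 1" "2 ^ a \<le> N" "3 ^ b \<le> N"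
    and "c1 \<le> prime_count x1" "x1 \<le> N div 1"
    and "c2 \<le> prime_count x2" "x2 \<le> N div 2"
    and "c3 \<le> prime_count x3" "x3 \<le> N div 3"
    and "c4 \<le> prime_count x4" "x4 \<le> N div 4"
  shows "34 / 7 + real (a - 2) + real (b - 1) + (real c1 - 2) + (real c2 - 2) + (real c3 - 5) + (real c4 - 9) \<le> lgE N"
proof -
  have "34 / 7 + real (a - 2) + real (b - 1)
      + (\<Sum>m=1..4. wt m * ((\<lambda>m. real (if m = 1 then c1 else if m = 2 then c2 else if m = 3 then c3 else c4)) m - thr_count m)) \<le> lgE N"
  proof (rule lgE_ge_weights)
    fix m :: nat assume m: "1 \<le> m" "m \<le> 4"
    then have "m \<le> 6" by simp
    from m(1) this show "real (if m = 1 then c1 else if m = 2 then c2 else if m = 3 then c3 else c4) \<le> real (prime_count (N div m))"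
      by (cases rule: le_6_cases) (use m real_prime_count_ge[OF assms(6,7)] real_prime_count_ge[OF assms(8,9)] real_prime_count_ge[OF assms(10,11)] real_prime_count_ge[OF assms(12,13)] in simp_all)
  qed (use assms in simp_all)
  then show ?thesis by (simp add: eval_nat_numeral wt_def thr_count_def)
qed

lemma lgE_ge_counts_5:
  assumes "N \<ge> 12" "a \<ge> 2" "b \<ge> 1" "2 ^ a \<le> N" "3 ^ b \<le> N"
    and "c1 \<le> prime_count x1" "x1 \<le> N div 1"
    and "c2 \<le> prime_count x2" "x2 \<le> N div 2"
    and "c3 \<le> prime_count x3" "x3 \<le> N div 3"
    and "c4 \<le> prime_count x4" "x4 \<le> N div 4"
    and "c5 \<le> prime_count x5" "x5 \<le> N div 5"
  shows "34 / 7 + real (a - 2) + real (b - 1) + (real c1 - 2) + (real c2 - 2) + (real c3 - 5) + (real c4 - 9) + (real c5 - 33) \<le> lgE N"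
proof -
  have "34 / 7 + real (a - 2) + real (b - 1)
      + (\<Sum>m=1..5. wt m * ((\<lambda>m. real (if m = 1 then c1 else if m = 2 then c2 else if m = 3 then c3 else if m = 4 then c4 else c5)) m - thr_count m)) \<le> lgE N"
  proof (rule lgE_ge_weights)
    fix m :: nat assume m: "1 \<le> m" "m \<le> 5"
    then have "m \<le> 6" by simp
    from m(1) this show "real (if m = 1 then c1 else if m = 2 then c2 else if m = 3 then c3 else if m = 4 then c4 else c5) \<le> real (prime_count (N div m))"
      by (cases rule: le_6_cases) (use m real_prime_count_ge[OF assms(6,7)] real_prime_count_ge[OF assms(8,9)] real_prime_count_ge[OF assms(10,11)] real_prime_count_ge[OF assms(12,13)] real_prime_count_ge[OF assms(14,15)] in simp_all)
  qed (use assms in simp_all)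
  then show ?thesis by (simp add: eval_nat_numeral wt_def thr_count_def)
qed

lemma lgE_ge_counts_6:
  assumes "N \<ge> 12" "a \<ge> 2" "b \<ge> 1" "2 ^ a \<le> N" "3 ^ b \<le> N"
    and "c1 \<le> prime_count x1" "x1 \<le> N div 1"
    and "c2 \<le> prime_count x2" "x2 \<le> N div 2"
    and "c3 \<le> prime_count x3" "x3 \<le> N div 3"
    and "c4 \<le> prime_count x4" "x4 \<le> N div 4"
    and "c5 \<le> prime_count x5" "x5 \<le> N div 5"
    and "c6 \<le> prime_count x6" "x6 \<le> N div 6"
  shows "34 / 7 + real (a - 2) + real (b - 1) + (real c1 - 2) + (real c2 - 2) + (real c3 - 5) + (real c4 - 9) + (real c5 - 33) + 7 / 10 * (real c6 - 34) \<le> lgE N"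
proof -
  have "34 / 7 + real (a - 2) + real (b - 1)
      + (\<Sum>m=1..6. wt m * ((\<lambda>m. real (if m = 1 then c1 else if m = 2 then c2 else if m = 3 then c3 else if m = 4 then c4 else if m = 5 then c5 else c6)) m - thr_count m)) \<le> lgE N"
  proof (rule lgE_ge_weights)
    fix m :: nat assume m: "1 \<le> m" "m \<le> 6"
    then have "m \<le> 6" by simp
    from m(1) this show "real (if m = 1 then c1 else if m = 2 then c2 else if m = 3 then c3 else if m = 4 then c4 else if m = 5 then c5 else c6) \<le> real (prime_count (N div m))"
      by (cases rule: le_6_cases) (use m real_prime_count_ge[OF assms(6,7)] real_prime_count_ge[OF assms(8,9)] real_prime_count_ge[OF assms(10,11)] real_prime_count_ge[OF assms(12,13)] real_prime_count_ge[OF assms(14,15)] real_prime_count_ge[OF assms(16,17)] in simp_all)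
  qed (use assms in simp_all)
  then show ?thesis by (simp add: eval_nat_numeral wt_def thr_count_def)
qed

section \<open>The table for N up to 3216\<close>

lemma ln_7_6_bounds: "1541 / 10000 \<le> ln (7 / 6::real)"
  using ln_approx_bounds[of "7 / 6" 2] by (simp add: eval_nat_numeral)

lemma ln_7_ge: "19451 / 10000 \<le> ln (7::real)"
proof -
  have "ln (7::real) = ln 2 + ln 3 + ln (7 / 6)"
    using ln_mult[of 6 "7 / 6 :: real"] ln_mult[of 2 "3 :: real"] by simp
  then show ?thesis using ln_2_bounds ln_3_bounds ln_7_6_bounds by simp
qed

text \<open>The logarithms of 2, 3, 5, 7 give cheap lower bounds for logarithms of smooth numbers;
  the table uses a smooth number at or slightly below the end of each block.\<close>

lemma ln_smooth_ge:
  assumes "m = 2 ^ a * 3 ^ b * 5 ^ c * 7 ^ d"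
  shows "(6931 * real a + 10985 * real b + 16093 * real c + 19451 * real d) / 10000 \<le> ln (real m)"
proof -
  have "ln (real m) = real a * ln 2 + real b * ln 3 + real c * ln 5 + real d * ln 7"
    unfolding assms by (simp add: ln_mult ln_realpow)
  moreover have "real a * (6931 / 10000) \<le> real a * ln 2"
    using ln_2_bounds(1) by (rule mult_left_mono) simp
  moreover have "real b * (10985 / 10000) \<le> real b * ln 3"
    using ln_3_bounds(1) by (rule mult_left_mono) simp
  moreover have "real c * (16093 / 10000) \<le> real c * ln 5"
    using ln_5_bounds(1) by (rule mult_left_mono) simp
  moreover have "real d * (19451 / 10000) \<le> real d * ln 7"
    using ln_7_ge by (rule mult_left_mono) simp
  ultimately show ?thesis by simp
qed

lemma x_over_ln_mono:
  fixes x y :: real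
  assumes "exp 1 \<le> x" "x \<le> y"
  shows "x / ln x \<le> y / ln y"
proof (rule DERIV_nonneg_imp_nondecreasing[OF assms(2), of "\<lambda>x. x / ln x"])
  fix t assume "x \<le> t" "t \<le> y"
  then have t: "exp 1 \<le> t" using assms by simp
  have t0: "t > 0" using t exp_gt_zero[of 1] by linarith
  have l: "ln t \<ge> 1" using t t0 by (simp add: ln_ge_iff)
  have "((\<lambda>x. x / ln x) has_real_derivative (1 * ln t - t * (1 / t)) / (ln t * ln t)) (at t)"
    using t0 l by (auto intro!: derivative_eq_intros)
  moreover have "0 \<le> (1 * ln t - t * (1 / t)) / (ln t * ln t)" using t0 l by simp
  ultimately show "\<exists>y. ((\<lambda>x. x / ln x) has_real_derivative y) (at t) \<and> 0 \<le> y" by blast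
qed

lemma exp_1_le_3: "exp (1::real) \<le> 3"
  by (rule exp_le)

text \<open>Both sides are monotone, so a whole block follows from its ends: \<open>lgE\<close> is
  at least its value at \<open>A\<close>, and \<open>N / ln N\<close> is at most its value at
  \<open>B\<close>, where \<open>ln B\<close> is bounded below through the smooth number
  \<open>S\<close>.\<close>

lemma lgE_block:
  assumes "f \<le> lgE A" "l \<le> ln (real S)" "S \<le> B" "3 \<le> A" "0 < l" "218 / 100 * real B \<le> f * l"
    and "A \<le> N" "N \<le> B"
  shows "218 / 100 * (real N / ln (real N)) \<le> lgE N"
proof -
  have S: "real S > 0" using assms(2,5) by (cases "S = 0") auto
  have "ln (real S) \<le> ln (real B)" using S assms(3) by (subst ln_le_cancel_iff) auto
  then have lB: "l \<le> ln (real B)" using assms(2) by linarith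
  have "3 \<le> real N" using assms(4,7) by linarith
  then have e: "exp 1 \<le> real N" using exp_1_le_3 by linarith
  have "218 / 100 * (real N / ln (real N)) \<le> 218 / 100 * (real B / ln (real B))"
    using e assms(8) by (intro mult_left_mono x_over_ln_mono) simp_all
  also have "\<dots> = 218 / 100 * real B / ln (real B)" by simp
  also have "\<dots> \<le> 218 / 100 * real B / l"
    using lB assms(5) by (intro divide_left_mono) auto
  also have "\<dots> \<le> f" using assms(5,6) by (simp add: pos_divide_le_eq)
  also have "\<dots> \<le> lgE N" using assms(1) lgE_mono[OF assms(7)] by linarith
  finally show ?thesis .
qed

definition lgE_bound_upto :: "nat \<Rightarrow> bool" where
  "lgE_bound_upto B \<longleftrightarrow> (\<forall>N. 16 \<le> N \<and> N \<le> B \<longrightarrow> 218 / 100 * (real N / ln (real N)) \<le> lgE N)"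

lemma lgE_bound_upto_extend:
  assumes "lgE_bound_upto A" "f \<le> lgE A" "l \<le> ln (real S)"
    and "S \<le> B" "3 \<le> A" "0 < l" "218 / 100 * real B \<le> f * l"
  shows "lgE_bound_upto B"
  unfolding lgE_bound_upto_def
proof (intro allI impI)
  fix N assume N: "16 \<le> N \<and> N \<le> B"
  show "218 / 100 * (real N / ln (real N)) \<le> lgE N"
  proof (cases "N \<le> A")
    case True
    then show ?thesis using assms(1) N by (simp add: lgE_bound_upto_def)
  next
    case False
    then show ?thesis using N by (intro lgE_block[OF assms(2-7)]) auto
  qed
qed

lemma lgE_bound_upto_16: "lgE_bound_upto 16"
  unfolding lgE_bound_upto_def
proof (intro allI impI)
  fix N :: nat assume "16 \<le> N \<and> N \<le> 16"
  then have "16 \<le> N" "N \<le> 16" by auto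
  then show "218 / 100 * (real N / ln (real N)) \<le> lgE N"
    by (rule lgE_block[of "97 / 7" 16 "27724 / 10000" 16 16, rotated -2])
      (use lgE_16 ln_smooth_ge[of 16 4 0 0 0] in simp_all)
qed

lemma lgE_bound_upto_18: "lgE_bound_upto 18"
proof (rule lgE_bound_upto_extend[OF lgE_bound_upto_16])
  show "97 / 7 \<le> lgE 16"
    using lgE_16 by simp
  show "28901 / 10000 \<le> ln (real 18)"
    using ln_smooth_ge[of 18 1 2 0 0] by simp
qed simp_all

text \<open>As in all later blocks, the value at the left end comes from prime counts, and the right
  end is limited by 2.18 * B <= f * l. The numbers after 18 are the exponents of the powers 2^4 and
  3^2 not exceeding it.\<close>

lemma lgE_bound_upto_20: "lgE_bound_upto 20"
proof (rule lgE_bound_upto_extend[OF lgE_bound_upto_18])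
  show "104 / 7 \<le> lgE 18"
    using lgE_ge_counts_2[of 18 4 2, OF _ _ _ _ _ prime_count_17 _ prime_count_7 _] by simp
  show "29955 / 10000 \<le> ln (real 20)"
    using ln_smooth_ge[of 20 2 0 1 0] by simp
qed simp_all

lemma lgE_bound_upto_22: "lgE_bound_upto 22"
proof (rule lgE_bound_upto_extend[OF lgE_bound_upto_20])
  show "111 / 7 \<le> lgE 20"
    using lgE_ge_counts_2[of 20 4 2, OF _ _ _ _ _ prime_count_19 _ prime_count_7 _] by simp
  show "30436 / 10000 \<le> ln (real 21)"
    using ln_smooth_ge[of 21 0 1 0 1] by simp
qed simp_all

lemma lgE_bound_upto_24: "lgE_bound_upto 24"
proof (rule lgE_bound_upto_extend[OF lgE_bound_upto_22])
  show "118 / 7 \<le> lgE 22"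
    using lgE_ge_counts_2[of 22 4 2, OF _ _ _ _ _ prime_count_19 _ prime_count_11 _] by simp
  show "31778 / 10000 \<le> ln (real 24)"
    using ln_smooth_ge[of 24 3 1 0 0] by simp
qed simp_all

lemma lgE_bound_upto_26: "lgE_bound_upto 26"
proof (rule lgE_bound_upto_extend[OF lgE_bound_upto_24])
  show "125 / 7 \<le> lgE 24"
    using lgE_ge_counts_2[of 24 4 2, OF _ _ _ _ _ prime_count_23 _ prime_count_11 _] by simp
  show "32186 / 10000 \<le> ln (real 25)"
    using ln_smooth_ge[of 25 0 0 2 0] by simp
qed simp_all

lemma lgE_bound_upto_28: "lgE_bound_upto 28"
proof (rule lgE_bound_upto_extend[OF lgE_bound_upto_26])
  show "132 / 7 \<le> lgE 26"
    using lgE_ge_counts_2[of 26 4 2, OF _ _ _ _ _ prime_count_23 _ prime_count_13 _] by simp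
  show "33313 / 10000 \<le> ln (real 28)"
    using ln_smooth_ge[of 28 2 0 0 1] by simp
qed simp_all

lemma lgE_bound_upto_30: "lgE_bound_upto 30"
proof (rule lgE_bound_upto_extend[OF lgE_bound_upto_28])
  show "139 / 7 \<le> lgE 28"
    using lgE_ge_counts_2[of 28 4 3, OF _ _ _ _ _ prime_count_23 _ prime_count_13 _] by simp
  show "34009 / 10000 \<le> ln (real 30)"
    using ln_smooth_ge[of 30 1 1 1 0] by simp
qed simp_all

lemma lgE_bound_upto_33: "lgE_bound_upto 33"
proof (rule lgE_bound_upto_extend[OF lgE_bound_upto_30])
  show "146 / 7 \<le> lgE 30"
    using lgE_ge_counts_2[of 30 4 3, OF _ _ _ _ _ prime_count_29 _ prime_count_13 _] by simp
  show "34655 / 10000 \<le> ln (real 32)"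
    using ln_smooth_ge[of 32 5 0 0 0] by simp
qed simp_all

lemma lgE_bound_upto_37: "lgE_bound_upto 37"
proof (rule lgE_bound_upto_extend[OF lgE_bound_upto_33])
  show "160 / 7 \<le> lgE 33"
    using lgE_ge_counts_2[of 33 5 3, OF _ _ _ _ _ prime_count_31 _ prime_count_13 _] by simp
  show "35832 / 10000 \<le> ln (real 36)"
    using ln_smooth_ge[of 36 2 2 0 0] by simp
qed simp_all

lemma lgE_bound_upto_42: "lgE_bound_upto 42"
proof (rule lgE_bound_upto_extend[OF lgE_bound_upto_37])
  show "174 / 7 \<le> lgE 37"
    using lgE_ge_counts_2[of 37 5 3, OF _ _ _ _ _ prime_count_37 _ prime_count_17 _] by simp
  show "37367 / 10000 \<le> ln (real 42)"
    using ln_smooth_ge[of 42 1 1 0 1] by simp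
qed simp_all

lemma lgE_bound_upto_49: "lgE_bound_upto 49"
proof (rule lgE_bound_upto_extend[OF lgE_bound_upto_42])
  show "195 / 7 \<le> lgE 42"
    using lgE_ge_counts_3[of 42 5 3, OF _ _ _ _ _ prime_count_41 _ prime_count_19 _ prime_count_13 _] by simp
  show "38902 / 10000 \<le> ln (real 49)"
    using ln_smooth_ge[of 49 0 0 0 2] by simp
qed simp_all

lemma lgE_bound_upto_56: "lgE_bound_upto 56"
proof (rule lgE_bound_upto_extend[OF lgE_bound_upto_49])
  show "216 / 7 \<le> lgE 49"
    using lgE_ge_counts_3[of 49 5 3, OF _ _ _ _ _ prime_count_47 _ prime_count_23 _ prime_count_13 _] by simp
  show "40244 / 10000 \<le> ln (real 56)"
    using ln_smooth_ge[of 56 3 0 0 1] by simp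
qed simp_all

lemma lgE_bound_upto_61: "lgE_bound_upto 61"
proof (rule lgE_bound_upto_extend[OF lgE_bound_upto_56])
  show "230 / 7 \<le> lgE 56"
    using lgE_ge_counts_3[of 56 5 3, OF _ _ _ _ _ prime_count_53 _ prime_count_23 _ prime_count_17 _] by simp
  show "40940 / 10000 \<le> ln (real 60)"
    using ln_smooth_ge[of 60 2 1 1 0] by simp
qed simp_all

lemma lgE_bound_upto_68: "lgE_bound_upto 68"
proof (rule lgE_bound_upto_extend[OF lgE_bound_upto_61])
  show "251 / 7 \<le> lgE 61"
    using lgE_ge_counts_3[of 61 5 3, OF _ _ _ _ _ prime_count_59 _ prime_count_29 _ prime_count_19 _] by simp
  show "41586 / 10000 \<le> ln (real 64)"
    using ln_smooth_ge[of 64 6 0 0 0] by simp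
qed simp_all

lemma lgE_bound_upto_80: "lgE_bound_upto 80"
proof (rule lgE_bound_upto_extend[OF lgE_bound_upto_68])
  show "279 / 7 \<le> lgE 68"
    using lgE_ge_counts_3[of 68 6 3, OF _ _ _ _ _ prime_count_67 _ prime_count_31 _ prime_count_19 _] by simp
  show "43817 / 10000 \<le> ln (real 80)"
    using ln_smooth_ge[of 80 4 0 1 0] by simp
qed simp_all

lemma lgE_bound_upto_92: "lgE_bound_upto 92"
proof (rule lgE_bound_upto_extend[OF lgE_bound_upto_80])
  show "314 / 7 \<le> lgE 80"
    using lgE_ge_counts_3[of 80 6 3, OF _ _ _ _ _ prime_count_79 _ prime_count_37 _ prime_count_23 _] by simp
  show "44994 / 10000 \<le> ln (real 90)"
    using ln_smooth_ge[of 90 1 2 1 0] by simp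
qed simp_all

lemma lgE_bound_upto_106: "lgE_bound_upto 106"
proof (rule lgE_bound_upto_extend[OF lgE_bound_upto_92])
  show "349 / 7 \<le> lgE 92"
    using lgE_ge_counts_3[of 92 6 4, OF _ _ _ _ _ prime_count_89 _ prime_count_41 _ prime_count_29 _] by simp
  show "46529 / 10000 \<le> ln (real 105)"
    using ln_smooth_ge[of 105 0 1 1 1] by simp
qed simp_all

lemma lgE_bound_upto_126: "lgE_bound_upto 126"
proof (rule lgE_bound_upto_extend[OF lgE_bound_upto_106])
  show "398 / 7 \<le> lgE 106"
    using lgE_ge_counts_3[of 106 6 4, OF _ _ _ _ _ prime_count_103 _ prime_count_53 _ prime_count_31 _] by simp
  show "48352 / 10000 \<le> ln (real 126)"
    using ln_smooth_ge[of 126 1 2 0 1] by simp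
qed simp_all

lemma lgE_bound_upto_145: "lgE_bound_upto 145"
proof (rule lgE_bound_upto_extend[OF lgE_bound_upto_126])
  show "447 / 7 \<le> lgE 126"
    using lgE_ge_counts_4[of 126 6 4, OF _ _ _ _ _ prime_count_109 _ prime_count_59 _ prime_count_41 _ prime_count_31 _] by simp
  show "49694 / 10000 \<le> ln (real 144)"
    using ln_smooth_ge[of 144 4 2 0 0] by simp
qed simp_all

lemma lgE_bound_upto_173: "lgE_bound_upto 173"
proof (rule lgE_bound_upto_extend[OF lgE_bound_upto_145])
  show "517 / 7 \<le> lgE 145"
    using lgE_ge_counts_4[of 145 7 4, OF _ _ _ _ _ prime_count_137 _ prime_count_71 _ prime_count_47 _ prime_count_31 _] by simp
  show "51229 / 10000 \<le> ln (real 168)"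
    using ln_smooth_ge[of 168 3 1 0 1] by simp
qed simp_all

lemma lgE_bound_upto_208: "lgE_bound_upto 208"
proof (rule lgE_bound_upto_extend[OF lgE_bound_upto_173])
  show "601 / 7 \<le> lgE 173"
    using lgE_ge_counts_4[of 173 7 4, OF _ _ _ _ _ prime_count_167 _ prime_count_83 _ prime_count_53 _ prime_count_41 _] by simp
  show "52979 / 10000 \<le> ln (real 200)"
    using ln_smooth_ge[of 200 3 0 2 0] by simp
qed simp_all

lemma lgE_bound_upto_250: "lgE_bound_upto 250"
proof (rule lgE_bound_upto_extend[OF lgE_bound_upto_208])
  show "692 / 7 \<le> lgE 208"
    using lgE_ge_counts_4[of 208 7 4, OF _ _ _ _ _ prime_count_191 _ prime_count_103 _ prime_count_67 _ prime_count_47 _] by simp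
  show "55210 / 10000 \<le> ln (real 250)"
    using ln_smooth_ge[of 250 1 0 3 0] by simp
qed simp_all

lemma lgE_bound_upto_305: "lgE_bound_upto 305"
proof (rule lgE_bound_upto_extend[OF lgE_bound_upto_250])
  show "818 / 7 \<le> lgE 250"
    using lgE_ge_counts_4[of 250 7 5, OF _ _ _ _ _ prime_count_239 _ prime_count_109 _ prime_count_83 _ prime_count_59 _] by simp
  show "57033 / 10000 \<le> ln (real 300)"
    using ln_smooth_ge[of 300 2 1 2 0] by simp
qed simp_all

lemma lgE_bound_upto_372: "lgE_bound_upto 372"
proof (rule lgE_bound_upto_extend[OF lgE_bound_upto_305])
  show "965 / 7 \<le> lgE 305"
    using lgE_ge_counts_4[of 305 8 5, OF _ _ _ _ _ prime_count_283 _ prime_count_149 _ prime_count_97 _ prime_count_71 _] by simp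
  show "58856 / 10000 \<le> ln (real 360)"
    using ln_smooth_ge[of 360 3 2 1 0] by simp
qed simp_all

lemma lgE_bound_upto_459: "lgE_bound_upto 459"
proof (rule lgE_bound_upto_extend[OF lgE_bound_upto_372])
  show "1147 / 7 \<le> lgE 372"
    using lgE_ge_counts_4[of 372 8 5, OF _ _ _ _ _ prime_count_367 _ prime_count_179 _ prime_count_109 _ prime_count_89 _] by simp
  show "61087 / 10000 \<le> ln (real 450)"
    using ln_smooth_ge[of 450 1 2 2 0] by simp
qed simp_all

lemma lgE_bound_upto_572: "lgE_bound_upto 572"
proof (rule lgE_bound_upto_extend[OF lgE_bound_upto_459])
  show "1378 / 7 \<le> lgE 459"
    using lgE_ge_counts_4[of 459 8 5, OF _ _ _ _ _ prime_count_457 _ prime_count_223 _ prime_count_149 _ prime_count_109 _] by simp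
  show "63391 / 10000 \<le> ln (real 567)"
    using ln_smooth_ge[of 567 0 4 0 1] by simp
qed simp_all

lemma lgE_bound_upto_705: "lgE_bound_upto 705"
proof (rule lgE_bound_upto_extend[OF lgE_bound_upto_572])
  show "1644 / 7 \<le> lgE 572"
    using lgE_ge_counts_4[of 572 9 5, OF _ _ _ _ _ prime_count_557 _ prime_count_283 _ prime_count_179 _ prime_count_137 _] by simp
  show "65499 / 10000 \<le> ln (real 700)"
    using ln_smooth_ge[of 700 2 0 2 1] by simp
qed simp_all

lemma lgE_bound_upto_867: "lgE_bound_upto 867"
proof (rule lgE_bound_upto_extend[OF lgE_bound_upto_705])
  show "1959 / 7 \<le> lgE 705"
    using lgE_ge_counts_4[of 705 9 5, OF _ _ _ _ _ prime_count_691 _ prime_count_349 _ prime_count_223 _ prime_count_167 _] by simp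
  show "67610 / 10000 \<le> ln (real 864)"
    using ln_smooth_ge[of 864 5 3 0 0] by simp
qed simp_all

lemma lgE_bound_upto_1098: "lgE_bound_upto 1098"
proof (rule lgE_bound_upto_extend[OF lgE_bound_upto_867])
  show "2400 / 7 \<le> lgE 867"
    using lgE_ge_counts_5[of 867 9 6, OF _ _ _ _ _ prime_count_853 _ prime_count_431 _ prime_count_283 _ prime_count_211 _ prime_count_167 _] by simp
  show "69841 / 10000 \<le> ln (real 1080)"
    using ln_smooth_ge[of 1080 3 3 1 0] by simp
qed simp_all

lemma lgE_bound_upto_1397: "lgE_bound_upto 1397"
proof (rule lgE_bound_upto_extend[OF lgE_bound_upto_1098])
  show "29523 / 70 \<le> lgE 1098"
    using lgE_ge_counts_6[of 1098 10 6, OF _ _ _ _ _ prime_count_1061 _ prime_count_521 _ prime_count_349 _ prime_count_269 _ prime_count_211 _ prime_count_179 _] by simp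
  show "72215 / 10000 \<le> ln (real 1372)"
    using ln_smooth_ge[of 1372 2 0 0 3] by simp
qed simp_all

lemma lgE_bound_upto_1827: "lgE_bound_upto 1827"
proof (rule lgE_bound_upto_extend[OF lgE_bound_upto_1397])
  show "18608 / 35 \<le> lgE 1397"
    using lgE_ge_counts_6[of 1397 10 6, OF _ _ _ _ _ prime_count_1319 _ prime_count_691 _ prime_count_457 _ prime_count_349 _ prime_count_269 _ prime_count_223 _] by simp
  show "74949 / 10000 \<le> ln (real 1800)"
    using ln_smooth_ge[of 1800 3 2 2 0] by simp
qed simp_all

lemma lgE_bound_upto_2426: "lgE_bound_upto 2426"
proof (rule lgE_bound_upto_extend[OF lgE_bound_upto_1827])
  show "47583 / 70 \<le> lgE 1827"
    using lgE_ge_counts_6[of 1827 10 6, OF _ _ _ _ _ prime_count_1801 _ prime_count_907 _ prime_count_587 _ prime_count_431 _ prime_count_349 _ prime_count_283 _] by simp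
  show "77804 / 10000 \<le> ln (real 2401)"
    using ln_smooth_ge[of 2401 0 0 0 4] by simp
qed simp_all

lemma lgE_bound_upto_3216: "lgE_bound_upto 3216"
proof (rule lgE_bound_upto_extend[OF lgE_bound_upto_2426])
  show "60827 / 70 \<le> lgE 2426"
    using lgE_ge_counts_6[of 2426 11 7, OF _ _ _ _ _ prime_count_2333 _ prime_count_1181 _ prime_count_769 _ prime_count_587 _ prime_count_457 _ prime_count_389 _] by simp
  show "80703 / 10000 \<le> ln (real 3200)"
    using ln_smooth_ge[of 3200 7 0 2 0] by simp
qed simp_all

section \<open>The bound by N / ln N from 3000 on\<close>

lemma ln_3000_bounds: "ln (3000::real) \<le> 80071 / 10000" "8 \<le> ln (3000::real)"
proof -
  have "ln (2 ^ 3 * 3 * 5 ^ 3 :: real) = 3 * ln 2 + ln 3 + 3 * ln 5"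
    by (simp only: ln_mult_pos ln_realpow zero_less_numeral zero_less_power mult_pos_pos)
  then have "ln (3000::real) = 3 * ln 2 + ln 3 + 3 * ln 5" by simp
  then show "ln (3000::real) \<le> 80071 / 10000" "8 \<le> ln (3000::real)"
    using ln_2_bounds ln_3_bounds ln_5_bounds by simp_all
qed

text \<open>1 / (y - l) >= 1 / y + l / y^2 with l = ln m. The second-order term is kept because at
  \<open>N = 3000\<close> the leading terms alone do not make up for the discarded primes.\<close>

lemma prime_count_div_ge:
  fixes N m :: nat
  defines "y \<equiv> ln (real N)"
  assumes "N \<ge> 3000" "1 \<le> m" "m \<le> 6"
  shows "921 / 1000 * (real N / real m) * (1 / y + ln (real m) / y ^ 2) - 5 / 2
    \<le> real (prime_count (N div m))"
proof -
  define n where "n = N div m"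
  define z where "z = real N / real m"
  have "500 * m \<le> N" using assms by simp
  then have n: "500 \<le> n" unfolding n_def using assms(3) by (simp add: less_eq_div_iff_mult_less_eq)
  have nz: "real n \<le> z" unfolding n_def z_def by (rule of_nat_div_le)
  have zn: "z \<le> real n + 1" unfolding n_def z_def using le_of_nat_Suc_div[of m N] assms(3) by simp
  have lz: "ln z = y - ln (real m)" unfolding z_def y_def using assms by (simp add: ln_div)
  have ln0: "0 < ln (real n)" using n by (subst ln_gt_zero_iff) auto
  have lnz: "ln (real n) \<le> ln z" using nz n by (subst ln_le_cancel_iff) auto
  have lm: "0 \<le> ln (real m)" using assms by simp
  have y0: "y > 0" using ln0 lnz lm lz by linarith
  have z0: "z \<ge> 0" using nz by linarith
  have "1 / y + ln (real m) / y ^ 2 \<le> 1 / ln z"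
  proof -
    have "(1 / y + ln (real m) / y ^ 2) * (y - ln (real m)) = 1 - (ln (real m) / y) ^ 2"
      using y0 by (simp add: field_simps power2_eq_square)
    also have "\<dots> \<le> 1" by simp
    finally show ?thesis using ln0 lnz lz by (simp add: pos_le_divide_eq)
  qed
  then have "921 / 1000 * z * (1 / y + ln (real m) / y ^ 2) \<le> 921 / 1000 * z * (1 / ln z)"
    using z0 by (intro mult_left_mono) auto
  \<comment> \<open>The constant 4 absorbs the loss of at most 0.921 by rounding
    \<open>N / m\<close> down.\<close>
  also have "\<dots> \<le> (921 / 1000 * real n + 4) * (1 / ln z)"
    using zn ln0 lnz by (intro mult_right_mono) auto
  also have "\<dots> \<le> (921 / 1000 * real n + 4) * (1 / ln (real n))"
    using ln0 lnz by (intro mult_left_mono divide_left_mono) auto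
  also have "\<dots> \<le> real (prime_count n) + 5 / 2"
    using prime_count_ge[of n] n by simp
  finally show ?thesis by (simp add: n_def z_def)
qed

lemma lgE_ge_large:
  assumes "N \<ge> 3000"
  shows "218 / 100 * (real N / ln (real N)) \<le> lgE N"
proof -
  define y where "y = ln (real N)"
  define u where "u = real N / y"
  define w where "w = real N / y ^ 2"
  define c where "c m = 921 / 1000 * (real N / real m) * (1 / y + ln (real m) / y ^ 2) - 5 / 2" for m
  have e: "exp 1 \<le> (3000::real)" using exp_1_le_3 by linarith
  have u: "370 \<le> u"
  proof -
    have "370 \<le> 3000 / ln (3000::real)" using ln_3000_bounds by (simp add: pos_le_divide_eq)
    also have "\<dots> \<le> u" unfolding u_def y_def using assms e by (intro x_over_ln_mono) auto
    finally show ?thesis .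
  qed
  have w: "46 \<le> w"
  proof -
    \<comment> \<open>x / (ln x)^2 is a quarter of the square of \<open>x / ln x\<close> taken at
      the square root of x, so its monotonicity is reduced to that of
      \<open>x / ln x\<close>.\<close>
    have s: "sqrt (real N) / ln (sqrt (real N)) \<ge> sqrt 3000 / ln (sqrt 3000)"
    proof (rule x_over_ln_mono)
      have "sqrt (3 ^ 2) \<le> sqrt (3000::real)" by (subst real_sqrt_le_iff) simp
      then show "exp 1 \<le> sqrt (3000::real)" using exp_1_le_3 by simp
    qed (use assms in simp)
    have "0 \<le> sqrt 3000 / ln (sqrt (3000::real))" using ln_3000_bounds by (simp add: ln_sqrt)
    then have "(sqrt 3000 / ln (sqrt 3000)) ^ 2 \<le> (sqrt (real N) / ln (sqrt (real N))) ^ 2"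
      using s by (intro power_mono)
    moreover have "(sqrt x / ln (sqrt x)) ^ 2 = 4 * (x / ln x ^ 2)" if "x > 0" for x :: real
      using that by (simp add: ln_sqrt power_divide)
    ultimately have "4 * (3000 / ln 3000 ^ 2) \<le> 4 * w"
      unfolding w_def y_def using assms by simp
    moreover have "46 \<le> 3000 / ln (3000::real) ^ 2"
    proof -
      have "ln (3000::real) ^ 2 \<le> (80071 / 10000) ^ 2"
        using ln_3000_bounds by (intro power_mono) auto
      then have "46 * ln (3000::real) ^ 2 \<le> 3000" by (simp add: power2_eq_square)
      moreover have "ln (3000::real) ^ 2 > 0" using ln_3000_bounds by simp
      ultimately show ?thesis by (simp add: pos_le_divide_eq)
    qed
    ultimately show ?thesis by linarith
  qed
  \<comment> \<open>2^11 = 2048 and 3^7 = 2187 lie below 3000.\<close>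
  have "34 / 7 + real (11 - 2) + real (7 - 1) + (\<Sum>m=1..6. wt m * (c m - thr_count m)) \<le> lgE N"
  proof (rule lgE_ge_weights)
    show "c m \<le> real (prime_count (N div m))" if "1 \<le> m" "m \<le> 6" for m
      unfolding c_def y_def using assms that by (intro prime_count_div_ge)
  qed (use assms in simp_all)
  moreover have c_eq: "c m = 921 / 1000 * (u / real m) + 921 / 1000 * (w * (ln (real m) / real m)) - 5 / 2" for m
  proof -
    have "real N / real m * (1 / y + ln (real m) / y ^ 2) = u / real m + w * (ln (real m) / real m)"
      unfolding u_def w_def distrib_left by (simp add: mult_ac)
    then have "c m = 921 / 1000 * (u / real m + w * (ln (real m) / real m)) - 5 / 2"
      unfolding c_def mult.assoc by (rule arg_cong)
    then show ?thesis by (simp only: distrib_left)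
  qed
  \<comment> \<open>24/10 is the sum of \<open>wt m / m\<close>, and 1781/20 is the sum of
    \<open>wt m * (thr_count m + 5/2)\<close>. The leading constant 0.921 * 2.4 is about 2.21,
    leaving a margin over 2.18.\<close>
  have "(\<Sum>m=1..6. wt m * (c m - thr_count m))
      = 921 / 1000 * (24 / 10) * u
        + 921 / 1000 * (w * (ln 2 / 2 + ln 3 / 3 + ln 4 / 4 + ln 5 / 5 + 7 / 60 * ln 6)) - 1781 / 20"
    unfolding c_eq by (simp add: eval_nat_numeral wt_def thr_count_def)
      (simp add: algebra_simps add_divide_distrib diff_divide_distrib)
  moreover have "159 / 100 * 46 \<le> w * (ln 2 / 2 + ln 3 / 3 + ln 4 / 4 + ln 5 / 5 + 7 / 60 * ln 6)"
  proof -
    have "ln (6::real) = ln 2 + ln 3" using ln_mult[of 2 "3 :: real"] by simp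
    then have "159 / 100 \<le> ln 2 / 2 + ln 3 / 3 + ln 4 / 4 + ln 5 / 5 + 7 / 60 * ln (6::real)"
      using ln_2_bounds ln_3_bounds ln_5_bounds ln_4_eq by linarith
    then show ?thesis using w by (subst mult.commute) (intro mult_mono, auto)
  qed
  ultimately have "218 / 100 * u \<le> lgE N" using u by linarith
  then show ?thesis by (simp add: u_def y_def)
qed

text \<open>16 is the least integer with ln_2 N >= 1. The excess of 2.18 over 2 is spent on the
  Chebyshev constant 0.921 in the next step.\<close>

theorem lgE_ge:
  assumes "N \<ge> 16"
  shows "218 / 100 * (real N / ln (real N)) \<le> lgE N"
proof (cases "N \<ge> 3000")
  case True
  then show ?thesis by (rule lgE_ge_large)
next
  case False
  then show ?thesis using assms lgE_bound_upto_3216 by (simp add: lgE_bound_upto_def)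
qed

section \<open>The third iterated logarithm\<close>

lemma esums_empty: "esums {} = {0}"
  by (simp add: esums_def)

lemma lgE_ln_ge:
  fixes g :: "nat \<Rightarrow> real"
  assumes "N \<ge> 1"
    and g: "\<And>m. m \<in> {1..K} \<Longrightarrow> g m \<ge> 0"
    and gE: "\<And>M. M \<in> {1..K} \<Longrightarrow> (\<Sum>m=1..M. g m) \<le> lgE M"
    and faith: "\<And>p. P\<^sub>0 < p \<Longrightarrow> faithful p K"
  shows "(\<Sum>m=1..K. g m * psi (N div m)) - ln (real N) * real P\<^sub>0 * (\<Sum>m=1..K. g m) \<le> lgE N * ln (real N)"
proof -
  have L0: "0 \<le> ln (real N)" using assms(1) by simp
  have "log 2 (real (card (esums {})))
    + (\<Sum>m=1..K. g m * (real (prime_count (N div m)) - real (prime_count P\<^sub>0))) \<le> lgE N"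
    using g gE faithful_mono[OF faith] by (intro lgE_ge_weighted) auto
  then have "(\<Sum>m=1..K. g m * (real (prime_count (N div m)) - real (prime_count P\<^sub>0))) \<le> lgE N"
    by (simp add: esums_empty)
  then have "(\<Sum>m=1..K. g m * (real (prime_count (N div m)) - real (prime_count P\<^sub>0))) * ln (real N)
      \<le> lgE N * ln (real N)"
    using L0 by (rule mult_right_mono)
  moreover have "(\<Sum>m=1..K. g m * psi (N div m)) - ln (real N) * real P\<^sub>0 * (\<Sum>m=1..K. g m)
      = (\<Sum>m=1..K. g m * (psi (N div m) - ln (real N) * real P\<^sub>0))"
    by (simp add: sum_subtractf right_diff_distrib sum_distrib_left mult_ac)
  moreover have "\<dots> \<le> (\<Sum>m=1..K. g m * ((real (prime_count (N div m)) - real (prime_count P\<^sub>0)) * ln (real N)))"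
  proof (intro sum_mono mult_left_mono)
    fix m
    have "psi (N div m) \<le> real (prime_count (N div m)) * ln (real (N div m))"
      by (rule psi_le_prime_count)
    also have "\<dots> \<le> real (prime_count (N div m)) * ln (real N)"
    proof (cases "N div m = 0")
      case False
      have "N div m \<le> N" by (rule div_le_dividend)
      then have "ln (real (N div m)) \<le> ln (real N)"
        using False assms(1) by (subst ln_le_cancel_iff) auto
      then show ?thesis by (intro mult_left_mono) auto
    qed (use L0 in simp)
    finally have 1: "psi (N div m) \<le> real (prime_count (N div m)) * ln (real N)" .
    have "real (prime_count P\<^sub>0) * ln (real N) \<le> real P\<^sub>0 * ln (real N)"
      using prime_count_le[of P\<^sub>0] L0 by (intro mult_right_mono) auto
    with 1 show "psi (N div m) - ln (real N) * real P\<^sub>0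
      \<le> (real (prime_count (N div m)) - real (prime_count P\<^sub>0)) * ln (real N)"
      unfolding left_diff_distrib by (simp only: mult.commute)
  qed (use g in auto)
  ultimately show ?thesis by (simp add: sum_distrib_right mult.assoc)
qed

lemma psi_div_ge:
  assumes "1 \<le> m" "400 * m \<le> N"
  shows "921 / 1000 * (real N / real m) - 5 / 2 * ln (real N) \<le> psi (N div m)"
proof -
  have n: "400 \<le> N div m" using assms by (simp add: less_eq_div_iff_mult_less_eq)
  have "real N / real m \<le> real (N div m) + 1" using le_of_nat_Suc_div[of m N] assms(1) by simp
  moreover have "ln (real (N div m)) \<le> ln (real N)"
  proof -
    have "N div m \<le> N" by (rule div_le_dividend)
    moreover have "N div m > 0" using n by linarith
    ultimately show ?thesis by (subst ln_le_cancel_iff) linarith+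
  qed
  ultimately show ?thesis using psi_ge[OF n] by linarith
qed

lemma lgE_ln_ge_sum:
  fixes g :: "nat \<Rightarrow> real"
  assumes N: "N \<ge> 1" "400 * K \<le> N"
    and g: "\<And>m. m \<in> {1..K} \<Longrightarrow> g m \<ge> 0"
    and gE: "\<And>M. M \<in> {1..K} \<Longrightarrow> (\<Sum>m=1..M. g m) \<le> lgE M"
    and faith: "\<And>p. P\<^sub>0 < p \<Longrightarrow> faithful p K"
  shows "921 / 1000 * real N * (\<Sum>m=1..K. g m / real m)
      - ln (real N) * (real P\<^sub>0 + 5 / 2) * (\<Sum>m=1..K. g m) \<le> lgE N * ln (real N)"
proof -
  have "(\<Sum>m=1..K. g m * (921 / 1000 * (real N / real m) - 5 / 2 * ln (real N)))
      \<le> (\<Sum>m=1..K. g m * psi (N div m))"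
  proof (intro sum_mono mult_left_mono g)
    fix m assume m: "m \<in> {1..K}"
    then have "400 * m \<le> 400 * K" by simp
    also have "\<dots> \<le> N" by (rule N(2))
    finally show "921 / 1000 * (real N / real m) - 5 / 2 * ln (real N) \<le> psi (N div m)"
      using m by (intro psi_div_ge) auto
  qed
  moreover have "(\<Sum>m=1..K. g m * (921 / 1000 * (real N / real m) - 5 / 2 * ln (real N)))
      = (\<Sum>m=1..K. 921 / 1000 * real N * (g m / real m) - 5 / 2 * ln (real N) * g m)"
    by (intro sum.cong refl) (simp add: right_diff_distrib mult_ac)
  then have "(\<Sum>m=1..K. g m * (921 / 1000 * (real N / real m) - 5 / 2 * ln (real N)))
      = 921 / 1000 * real N * (\<Sum>m=1..K. g m / real m) - 5 / 2 * ln (real N) * (\<Sum>m=1..K. g m)"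
    by (simp only: sum_subtractf sum_distrib_left)
  moreover have "ln (real N) * (real P\<^sub>0 + 5 / 2) * (\<Sum>m=1..K. g m)
      = ln (real N) * real P\<^sub>0 * (\<Sum>m=1..K. g m) + 5 / 2 * ln (real N) * (\<Sum>m=1..K. g m)"
    by (simp add: algebra_simps)
  moreover have "(\<Sum>m=1..K. g m * psi (N div m)) - ln (real N) * real P\<^sub>0 * (\<Sum>m=1..K. g m) \<le> lgE N * ln (real N)"
    using N(1) g gE faith by (rule lgE_ln_ge)
  ultimately show ?thesis by linarith
qed

section \<open>Weights from the increments of x / ln x\<close>

text \<open>The derivative of \<open>x / ln x\<close>, expressed in \<open>u = ln x\<close>.\<close>

definition slope :: "real \<Rightarrow> real" where
  "slope u = 1 / u - 1 / u ^ 2"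

text \<open>The difference factors as (1/a - 1/b)(1 - 1/a - 1/b), and the second factor is
  nonnegative once both arguments are at least 2. For \<open>u = ln m\<close> this holds from
  \<open>m = 16\<close> on.\<close>

lemma slope_antimono:
  assumes "2 \<le> a" "a \<le> b"
  shows "slope b \<le> slope a"
proof -
  have "0 \<le> (1 / a - 1 / b) * (1 - (1 / a + 1 / b))"
  proof (rule mult_nonneg_nonneg)
    show "0 \<le> 1 / a - 1 / b" using assms by (simp add: frac_le)
    have "1 / a \<le> 1 / 2" "1 / b \<le> 1 / 2" using assms by (auto intro: frac_le)
    then show "0 \<le> 1 - (1 / a + 1 / b)" by linarith
  qed
  also have "\<dots> = slope a - slope b"
    by (simp add: slope_def algebra_simps power2_eq_square)
  finally show ?thesis by simp
qed

lemma slope_nonneg: "1 \<le> u \<Longrightarrow> 0 \<le> slope u"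
  using mult_left_mono[of 1 u u] by (simp add: slope_def power2_eq_square frac_le)

lemma x_over_ln_deriv:
  assumes "1 < t"
  shows "((\<lambda>x. x / ln x) has_real_derivative slope (ln t)) (at t)"
proof -
  have "ln t > 0" using assms by simp
  then have "((\<lambda>x. x / ln x) has_real_derivative (1 * ln t - t * (1 / t)) / (ln t * ln t)) (at t)"
    using assms by (auto intro!: derivative_eq_intros)
  moreover have "(1 * ln t - t * (1 / t)) / (ln t * ln t) = slope (ln t)"
    using assms \<open>ln t > 0\<close> by (simp add: slope_def diff_divide_distrib power2_eq_square)
  ultimately show ?thesis by simp
qed

text \<open>The weights up to 16 come from the computed values of \<^const>\<open>lgE\<close>; the later ones are dominated by the
  increments of \<open>218 / 100 * (x / ln x)\<close>, whose derivative is given by \<^const>\<open>slope\<close>.\<close>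

definition gw :: "nat \<Rightarrow> real" where
  "gw m = (if m \<le> 5 then 1 else if m = 6 then 7 / 10 else if m \<le> 11 then 1 else if m = 12 then 11 / 70
    else if m = 13 then 1 else if m = 14 then 7 / 10 else if m \<le> 16 then 0
    else 218 / 100 * slope (ln (real m)))"

lemma ln_16_eq: "ln (16::real) = 4 * ln 2"
  using ln_realpow[of 2 4] by simp

lemma ln_ge_2: "m \<ge> 16 \<Longrightarrow> 2 \<le> ln (real m)"
proof -
  assume "m \<ge> 16"
  then have "ln 16 \<le> ln (real m)" by (subst ln_le_cancel_iff) auto
  then show ?thesis using ln_2_bounds ln_16_eq by linarith
qed

lemma gw_nonneg: "0 \<le> gw m"
proof (cases "m \<ge> 16")
  case True
  then have "0 \<le> slope (ln (real m))" using ln_ge_2[OF True] by (intro slope_nonneg) linarith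
  then show ?thesis by (simp add: gw_def)
qed (simp add: gw_def)

lemma sum_gw_16: "(\<Sum>m=1..16. gw m) = 879 / 70"
  by (simp add: eval_nat_numeral gw_def)

text \<open>By the mean value theorem an increment of \<open>x / ln x\<close> is a slope inside the
  interval, which is at least the slope at the right end. At 16 the sum 879/70 is only just below
  the bound; this is why the weights of 15 and 16 are 0.\<close>

lemma sum_gw_le: "16 \<le> M \<Longrightarrow> (\<Sum>m=1..M. gw m) \<le> 218 / 100 * (real M / ln (real M))"
proof (induction M rule: dec_induct)
  case base
  have "879 / 70 * ln 16 \<le> 218 / 100 * (16::real)"
    using ln_2_bounds ln_16_eq by linarith
  moreover have "ln (16::real) > 0" by simp
  ultimately have "879 / 70 \<le> 218 / 100 * (16 / ln (16::real))" by (simp add: field_simps)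
  then show ?case unfolding sum_gw_16 by simp
next
  case (step M)
  have "gw (Suc M) \<le> 218 / 100 * (real (Suc M) / ln (real (Suc M)) - real M / ln (real M))"
  proof -
    have "\<exists>z. real M < z \<and> z < real (Suc M) \<and>
        real (Suc M) / ln (real (Suc M)) - real M / ln (real M) = (real (Suc M) - real M) * slope (ln z)"
    proof (rule MVT2)
      fix x assume "real M \<le> x" "x \<le> real (Suc M)"
      then show "((\<lambda>x. x / ln x) has_real_derivative slope (ln x)) (at x)"
        using step.hyps by (intro x_over_ln_deriv) linarith
    qed simp
    then obtain z where z: "real M < z" "z < real (Suc M)"
      "real (Suc M) / ln (real (Suc M)) - real M / ln (real M) = slope (ln z)" by auto
    have "ln (real M) \<le> ln z" "ln z \<le> ln (real (Suc M))" using z step.hyps by auto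
    then have "slope (ln (real (Suc M))) \<le> slope (ln z)"
      using ln_ge_2[of M] step.hyps by (intro slope_antimono) auto
    moreover have "gw (Suc M) = 218 / 100 * slope (ln (real (Suc M)))"
      using step.hyps unfolding gw_def by simp
    ultimately show ?thesis unfolding z(3) by linarith
  qed
  then show ?case using step.IH by simp
qed

lemma sum_gw_le_lgE:
  assumes "1 \<le> M"
  shows "(\<Sum>m=1..M. gw m) \<le> lgE M"
proof (cases "M \<ge> 16")
  case True
  then show ?thesis using sum_gw_le[OF True] lgE_ge[OF True] by linarith
next
  case False
  then have "M = 1 \<or> M = 2 \<or> M = 3 \<or> M = 4 \<or> M = 5 \<or> M = 6 \<or> M = 7 \<or> M = 8 \<or> M = 9 \<or> M = 10
    \<or> M = 11 \<or> M = 12 \<or> M = 13 \<or> M = 14 \<or> M = 15"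
    using assms by presburger
  then show ?thesis
    by (elim disjE) (use lgE_1 lgE_2 lgE_3 lgE_4 lgE_5 lgE_6 lgE_7 lgE_8 lgE_9 lgE_10 lgE_11 lgE_12 lgE_13
      lgE_14 lgE_mono[of 14 15] in \<open>simp_all add: gw_def eval_nat_numeral\<close>)
qed

lemma lgE_ln_ge_gw:
  assumes "N \<ge> 1" "400 * K \<le> N" "\<And>p. P\<^sub>0 < p \<Longrightarrow> faithful p K"
  shows "921 / 1000 * real N * (\<Sum>m=1..K. gw m / real m)
      - ln (real N) * (real P\<^sub>0 + 5 / 2) * (\<Sum>m=1..K. gw m) \<le> lgE N * ln (real N)"
  using assms gw_nonneg sum_gw_le_lgE by (intro lgE_ln_ge_sum) auto

section \<open>The bound with ln_3 in three ranges of ln N\<close>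

lemma e_ge: "271 / 100 \<le> exp (1::real)"
proof -
  have "ln (27 / 10 :: real) = 3 * ln 3 - ln 2 - ln 5"
  proof -
    have "ln (27 / 10 :: real) = ln 27 - ln 10" by (simp add: ln_div)
    moreover have "ln (27::real) = 3 * ln 3" using ln_realpow[of 3 3] by simp
    moreover have "ln (10::real) = ln 2 + ln 5" using ln_mult[of 2 "5::real"] by simp
    ultimately show ?thesis by simp
  qed
  moreover have "ln (271 / 270 :: real) \<le> 271 / 270 - 1" by (rule ln_le_minus_one) simp
  moreover have "ln (271 / 100 :: real) = ln (27 / 10) + ln (271 / 270)"
    using ln_mult[of "27 / 10" "271 / 270 :: real"] by simp
  ultimately have "ln (271 / 100 :: real) \<le> 1" using ln_3_bounds ln_2_bounds ln_5_bounds by linarith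
  then show ?thesis by (metis exp_le_cancel_iff exp_ln divide_pos_pos zero_less_numeral)
qed

lemma ln_le_of_x_over_ln:
  assumes "exp a \<ge> c" "1 \<le> a" "a \<le> ln (real N)" "N \<ge> 1"
  shows "ln (real N) * c \<le> a * real N"
proof -
  have N: "exp a \<le> real N" using assms(3,4) by (simp add: ln_ge_iff)
  have "exp 1 \<le> exp a" using assms(2) by simp
  then have "exp a / ln (exp a) \<le> real N / ln (real N)" using N by (rule x_over_ln_mono)
  moreover have "ln (real N) > 0" using assms(2,3) by linarith
  ultimately have "exp a * ln (real N) \<le> real N * a" using assms(2) by (simp add: field_simps)
  moreover have "c * ln (real N) \<le> exp a * ln (real N)" using assms(1) \<open>ln (real N) > 0\<close> by (intro mult_right_mono) auto
  ultimately show ?thesis by (simp add: mult.commute)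
qed

text \<open>The number is 2^10 * 5^5, so that its logarithm is available; the next lemma uses 2^15 *
  5^9 likewise.\<close>

lemma exp_15_ge: "3200000 \<le> exp (15::real)"
proof -
  have "ln (2 ^ 10 * 5 ^ 5 :: real) = 10 * ln 2 + 5 * ln 5"
    by (simp only: ln_mult_pos ln_realpow zero_less_numeral zero_less_power)
  then have "ln (3200000::real) \<le> 15" using ln_2_bounds ln_5_bounds by simp
  then show ?thesis by (metis exp_le_cancel_iff exp_ln zero_less_numeral)
qed

lemma exp_25_ge: "64000000000 \<le> exp (25::real)"
proof -
  have "ln (2 ^ 15 * 5 ^ 9 :: real) = 15 * ln 2 + 9 * ln 5"
    by (simp only: ln_mult_pos ln_realpow zero_less_numeral zero_less_power)
  then have "ln (64000000000::real) \<le> 25" using ln_2_bounds ln_5_bounds by simp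
  then show ?thesis by (metis exp_le_cancel_iff exp_ln zero_less_numeral)
qed

lemma le_exp_of_ln: "N \<ge> 1 \<Longrightarrow> a \<le> ln (real N) \<Longrightarrow> exp a \<le> real N"
  by (simp add: ln_ge_iff)

text \<open>In this range the fixed cutoff 8 with threshold 2283 suffices: the main term is about
  2.457 N, the discarded primes cost less than 0.083 N, and 2 ln_3 N is at most 2.344.\<close>

lemma lgE_ge_ln3_15_25:
  assumes "N \<ge> 1" "15 \<le> ln (real N)" "ln (real N) \<le> 25"
  shows "2 * real N * ln (ln (ln (real N))) \<le> lgE N * ln (real N)"
proof -
  have "3200000 \<le> real N" using exp_15_ge le_exp_of_ln[OF assms(1,2)] by linarith
  then have "400 * 8 \<le> N" by simp
  then have main: "921 / 1000 * real N * (\<Sum>m=1..8. gw m / real m)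
      - ln (real N) * (real 2283 + 5 / 2) * (\<Sum>m=1..8. gw m) \<le> lgE N * ln (real N)"
    using assms(1) faithful_8 by (intro lgE_ln_ge_gw) auto
  have v: "(\<Sum>m=1..8. gw m / real m) = 2241 / 840" "(\<Sum>m=1..8. gw m) = 77 / 10"
    by (simp_all add: eval_nat_numeral gw_def)
  note main[unfolded v of_nat_numeral]
  moreover have "ln (real N) * 3200000 \<le> 15 * real N"
    using exp_15_ge assms by (intro ln_le_of_x_over_ln) auto
  moreover have "ln (ln (ln (real N))) \<le> 1172 / 1000"
  proof -
    have "ln (25::real) = 2 * ln 5" using ln_realpow[of 5 2] by simp
    moreover have "ln (ln (real N)) \<le> ln 25" using assms by (subst ln_le_cancel_iff) linarith+
    ultimately have "ln (ln (real N)) \<le> 32192 / 10000" using ln_5_bounds by linarith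
    moreover have "ln (ln (real N)) > 0" using assms by (subst ln_gt_zero_iff) linarith+
    ultimately have "ln (ln (ln (real N))) \<le> ln (32192 / 10000)" by (subst ln_le_cancel_iff) auto
    also have "\<dots> = ln 3 + ln (32192 / 30000)" using ln_mult[of 3 "32192 / 30000 :: real"] by simp
    also have "ln (32192 / 30000 :: real) \<le> 32192 / 30000 - 1" by (rule ln_le_minus_one) simp
    finally show ?thesis using ln_3_bounds by linarith
  qed
  then have "2 * real N * ln (ln (ln (real N))) \<le> 2 * real N * (1172 / 1000)"
    by (rule mult_left_mono) simp
  moreover have "921 / 1000 * real N * (2241 / 840) = 687987 / 280000 * real N"
    "ln (real N) * (2283 + 5 / 2) * (77 / 10) = 351967 / 20 * ln (real N)"
    "2 * real N * (1172 / 1000) = 293 / 125 * real N" by simp_all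
  ultimately show ?thesis by linarith
qed

text \<open>The cutoff 16 gives a main term of at least 2.855 N, and its threshold 2436559 is
  harmless beyond exp 25. At the upper end ln_3 N stays below ln 4.\<close>

lemma lgE_ge_ln3_25_45:
  assumes "N \<ge> 1" "25 \<le> ln (real N)" "ln (real N) \<le> 45"
  shows "2 * real N * ln (ln (ln (real N))) \<le> lgE N * ln (real N)"
proof -
  have "64000000000 \<le> real N" using exp_25_ge le_exp_of_ln[OF assms(1,2)] by linarith
  then have "400 * 16 \<le> N" by simp
  then have main: "921 / 1000 * real N * (\<Sum>m=1..16. gw m / real m)
      - ln (real N) * (real 2436559 + 5 / 2) * (\<Sum>m=1..16. gw m) \<le> lgE N * ln (real N)"
    using assms(1) faithful_16 by (intro lgE_ln_ge_gw) auto
  note main[unfolded sum_gw_16 of_nat_numeral]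
  moreover have "(\<Sum>m=1..16. gw m / real m) \<ge> 31 / 10"
    by (simp add: eval_nat_numeral gw_def)
  then have "921 / 1000 * real N * (31 / 10) \<le> 921 / 1000 * real N * (\<Sum>m=1..16. gw m / real m)"
    by (rule mult_left_mono) simp
  moreover have "ln (real N) * 64000000000 \<le> 25 * real N"
    using exp_25_ge assms by (intro ln_le_of_x_over_ln) auto
  moreover have "ln (ln (ln (real N))) \<le> 13864 / 10000"
  proof -
    have "ln (45::real) = 2 * ln 3 + ln 5" using ln_mult[of 9 "5::real"] ln_realpow[of 3 2] by simp
    moreover have "ln (ln (real N)) \<le> ln 45" using assms by (subst ln_le_cancel_iff) linarith+
    ultimately have "ln (ln (real N)) \<le> 4" using ln_5_bounds ln_3_bounds by linarith
    moreover have "ln (ln (real N)) > 0" using assms by (subst ln_gt_zero_iff) linarith+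
    ultimately have "ln (ln (ln (real N))) \<le> ln 4" by (subst ln_le_cancel_iff) auto
    then show ?thesis using ln_2_bounds ln_4_eq by linarith
  qed
  then have "2 * real N * ln (ln (ln (real N))) \<le> 2 * real N * (13864 / 10000)"
    by (rule mult_left_mono) simp
  moreover have "921 / 1000 * real N * (31 / 10) = 28551 / 10000 * real N"
    "ln (real N) * (2436559 + 5 / 2) * (879 / 70) = 4283475117 / 140 * ln (real N)"
    "2 * real N * (13864 / 10000) = 1733 / 625 * real N" by simp_all
  ultimately show ?thesis by linarith
qed

text \<open>The numerators over \<open>L = lcm {1..K}\<close> are at most \<open>K * L\<close>, and
  \<open>L = exp (psi K)\<close>.\<close>

lemma faithful_psi:
  assumes "1 \<le> K"
  shows "\<exists>P\<^sub>0. (\<forall>p>P\<^sub>0. faithful p K) \<and> real P\<^sub>0 = real K * exp (psi K)"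
proof -
  obtain L where L: "L > 0" "\<forall>m\<in>{1..K}. m dvd L" "ln (real L) = psi K"
    using common_multiple_psi by blast
  have "(\<Sum>m=1..K. L div m) \<le> (\<Sum>m=1..K. L)" by (intro sum_mono div_le_dividend)
  then have "(\<Sum>m=1..K. L div m) \<le> K * L" by simp
  then have "\<forall>p>K * L. faithful p K"
    unfolding faithful_def using L(1,2) assms by fastforce
  moreover have "real (K * L) = real K * exp (psi K)" using L(1) unfolding L(3)[symmetric] by simp
  ultimately show ?thesis by blast
qed

lemma lgE_le: "lgE K \<le> real K"
proof -
  have "card (egyptian K) \<le> card (Pow {1..K})"
    unfolding egyptian_eq_esums esums_def by (rule card_image_le) simp
  then have "card (egyptian K) \<le> 2 ^ K" by (simp add: card_Pow)
  then have "log 2 (real (card (egyptian K))) \<le> log 2 (2 ^ K)"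
    using card_egyptian_pos[of K] by (subst log_le_cancel_iff) (auto simp flip: of_nat_power)
  then show ?thesis by (simp add: lgE_def)
qed

text \<open>An antiderivative of \<open>slope (ln t) / t\<close>, to which the sum of
  \<open>gw m / m\<close> is compared.\<close>

definition Phi :: "real \<Rightarrow> real" where
  "Phi t = ln (ln t) + 1 / ln t"

lemma Phi_deriv:
  assumes "1 < t"
  shows "(Phi has_real_derivative slope (ln t) / t) (at t)"
proof -
  have l: "ln t > 0" using assms by simp
  have "((\<lambda>t. ln (ln t) + 1 / ln t) has_real_derivative 1 / t / ln t + (0 * ln t - 1 * (1 / t)) / (ln t * ln t)) (at t)"
    using assms l by (auto intro!: derivative_eq_intros)
  moreover have "1 / t / ln t + (0 * ln t - 1 * (1 / t)) / (ln t * ln t) = slope (ln t) / t"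
    using assms l by (simp add: slope_def field_simps power2_eq_square)
  ultimately show ?thesis by (simp add: Phi_def[abs_def])
qed

lemma Phi_step:
  assumes "m \<ge> 17"
  shows "Phi (real (Suc m)) - Phi (real m) \<le> slope (ln (real m)) / real m"
proof -
  have "\<exists>z. real m < z \<and> z < real (Suc m) \<and>
      Phi (real (Suc m)) - Phi (real m) = (real (Suc m) - real m) * (slope (ln z) / z)"
    by (rule MVT2) (use assms in \<open>auto intro!: Phi_deriv\<close>)
  then obtain z where z: "real m < z" "z < real (Suc m)"
    "Phi (real (Suc m)) - Phi (real m) = slope (ln z) / z" by auto
  have "slope (ln z) \<le> slope (ln (real m))"
    using z(1) assms ln_ge_2[of m] by (intro slope_antimono) auto
  then have "slope (ln z) / z \<le> slope (ln (real m)) / real m"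
    using z(1) assms ln_ge_2[of m] slope_nonneg[of "ln (real m)"] by (intro frac_le) auto
  with z(3) show ?thesis by simp
qed

lemma sum_gw_div_ge:
  assumes "16 \<le> K"
  shows "31 / 10 + 218 / 100 * (Phi (real (Suc K)) - Phi 17) \<le> (\<Sum>m=1..K. gw m / real m)"
  using assms
proof (induction K rule: dec_induct)
  case base
  then show ?case by (simp add: eval_nat_numeral gw_def)
next
  case (step K)
  have "gw (Suc K) = 218 / 100 * slope (ln (real (Suc K)))" using step.hyps unfolding gw_def by simp
  then have "218 / 100 * (Phi (real (Suc (Suc K))) - Phi (real (Suc K))) \<le> gw (Suc K) / real (Suc K)"
    using Phi_step[of "Suc K"] step.hyps by simp
  moreover have "(\<Sum>m=1..Suc K. gw m / real m) = (\<Sum>m=1..K. gw m / real m) + gw (Suc K) / real (Suc K)"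
    by simp
  ultimately show ?case using step.IH unfolding right_diff_distrib by linarith
qed

lemma ln_plus_inverse_mono:
  fixes a b :: real
  assumes "1 \<le> a" "a \<le> b"
  shows "ln a + 1 / a \<le> ln b + 1 / b"
proof (rule DERIV_nonneg_imp_nondecreasing[OF assms(2), of "\<lambda>x. ln x + 1 / x"])
  fix x assume "a \<le> x" "x \<le> b"
  then have x: "1 \<le> x" using assms(1) by simp
  have "((\<lambda>x. ln x + 1 / x) has_real_derivative slope x) (at x)"
    using x by (auto intro!: derivative_eq_intros simp: slope_def power2_eq_square)
  then show "\<exists>y. ((\<lambda>x. ln x + 1 / x) has_real_derivative y) (at x) \<and> 0 \<le> y"
    using slope_nonneg[OF x] by blast
qed

lemma ln_le_ln_minus_one_plus:
  fixes U :: real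
  assumes "2 \<le> U"
  shows "ln U \<le> ln (U - 1) + 1 / (U - 1)"
proof -
  have "ln (U / (U - 1)) \<le> U / (U - 1) - 1" using assms by (intro ln_le_minus_one) auto
  moreover have "ln (U / (U - 1)) = ln U - ln (U - 1)" using assms by (simp add: ln_div)
  moreover have "U / (U - 1) - 1 = 1 / (U - 1)" using assms by (simp add: field_simps)
  ultimately show ?thesis by simp
qed

lemma Phi_17_le: "Phi 17 \<le> 1397 / 1000"
proof -
  have "ln (17::real) = ln 16 + ln (17 / 16)" using ln_mult[of 16 "17 / 16 :: real"] by simp
  moreover have "ln (17 / 16 :: real) \<le> 17 / 16 - 1" by (rule ln_le_minus_one) simp
  ultimately have u: "ln (17::real) \<le> 28353 / 10000" using ln_16_eq ln_2_bounds by linarith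
  have "ln 2 \<le> ln (17::real)" by simp
  have "1 \<le> ln (17::real)" using ln_ge_2[of 17] by simp
  then have "Phi 17 \<le> ln (28353 / 10000) + 1 / (28353 / 10000)"
    unfolding Phi_def using u by (rule ln_plus_inverse_mono)
  moreover have "ln (28353 / 10000 :: real) = ln 3 + ln (28353 / 30000)"
    using ln_mult[of 3 "28353 / 30000 :: real"] by simp
  moreover have "ln (28353 / 30000 :: real) \<le> 28353 / 30000 - 1" by (rule ln_le_minus_one) simp
  ultimately show ?thesis using ln_3_bounds by simp
qed

lemma exp_ge_linear: "271 / 100 * x \<le> exp (x::real)" if "0 \<le> x"
proof -
  have "271 / 100 * x \<le> exp 1 * x" using e_ge that by (rule mult_right_mono)
  also have "\<dots> \<le> exp 1 * exp (x - 1)" using exp_ge_add_one_self[of "x - 1"] by (intro mult_left_mono) auto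
  also have "\<dots> = exp x" by (simp flip: exp_add)
  finally show ?thesis .
qed

text \<open>Tenth power of exp x >= 2.71 x at x = 0.044 y, where seven of the ten factors y are
  bounded below by 45. The exponent 0.44 is what 0.56 leaves of 1 in the cutoff estimate.\<close>

lemma power3_le_exp:
  fixes y :: real
  assumes "45 \<le> y"
  shows "200 * y ^ 3 \<le> exp (44 / 100 * y)"
proof -
  have "(119 / 1000 * y) ^ 10 \<le> exp (44 / 1000 * y) ^ 10"
    using exp_ge_linear[of "44 / 1000 * y"] assms by (intro power_mono) auto
  also have "\<dots> = exp (44 / 100 * y)" by (simp flip: exp_of_nat_mult)
  also have "(119 / 1000 * y) ^ 10 = (119 / 1000) ^ 10 * (y ^ 7 * y ^ 3)"
    unfolding power_mult_distrib by (simp flip: power_add)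
  finally have "(119 / 1000) ^ 10 * (y ^ 7 * y ^ 3) \<le> exp (44 / 100 * y)" .
  moreover have "45 ^ 7 \<le> y ^ 7" using assms by (intro power_mono) auto
  then have "(119 / 1000) ^ 10 * (45 ^ 7 * y ^ 3) \<le> (119 / 1000) ^ 10 * (y ^ 7 * y ^ 3)"
    using assms by (intro mult_left_mono mult_right_mono) auto
  moreover have "200 * y ^ 3 \<le> (119 / 1000) ^ 10 * (45 ^ 7 * y ^ 3)" using assms by (simp add: power_divide)
  ultimately show ?thesis by linarith
qed

text \<open>The factor 2/5 is a little above 1/e, so that even after rounding \<open>ln K\<close> is
  at least \<open>ln y - 1\<close>; it is also small enough for the thresholds to remain below a
  power of N with exponent less than 1.\<close>

lemma cutoff_bounds:
  fixes y :: real
  assumes "45 \<le> y"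
  defines "K \<equiv> nat \<lfloor>2 / 5 * y\<rfloor>"
  shows "17 \<le> K" "real K \<le> 2 / 5 * y" "ln y - 1 \<le> ln (real K)"
proof -
  have K: "real K \<le> 2 / 5 * y" "2 / 5 * y - 1 < real K" using assms unfolding K_def by linarith+
  then show "real K \<le> 2 / 5 * y" by simp
  show "17 \<le> K" using K(2) assms(1) by linarith
  have "y * (100 / 271) \<le> real K" using K(2) assms(1) by linarith
  moreover have "y / exp 1 \<le> y / (271 / 100)" using assms e_ge by (intro divide_left_mono) auto
  moreover have "y / (271 / 100) = y * (100 / 271)" by simp
  ultimately have "y / exp 1 \<le> real K" by (metis order_trans)
  then have "ln (y / exp 1) \<le> ln (real K)" using assms by (subst ln_le_cancel_iff) auto
  then show "ln y - 1 \<le> ln (real K)" using assms by (simp add: ln_div)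
qed

text \<open>psi K <= K ln 4 <= 0.56 y, so the threshold grows like exp (0.56 y) and the polynomial
  factors fit into exp (0.44 y).\<close>

lemma cutoff_error:
  fixes y :: real
  assumes "45 \<le> y" "1 \<le> K" "real K \<le> 2 / 5 * y" "real P\<^sub>0 = real K * exp (psi K)"
  shows "y * (real P\<^sub>0 + 5 / 2) * real K \<le> 1 / 100 * exp y"
proof -
  have "psi K \<le> real K * ln 4" by (rule psi_le)
  also have "\<dots> \<le> 2 / 5 * y * (14 / 10)" using assms(1,3) ln_2_bounds ln_4_eq by (intro mult_mono) auto
  finally have "exp (psi K) \<le> exp (56 / 100 * y)" by simp
  moreover have "1 \<le> exp (56 / 100 * y)" using assms(1) by simp
  ultimately have "real P\<^sub>0 + 5 / 2 \<le> real K * exp (56 / 100 * y) + 5 / 2 * exp (56 / 100 * y)"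
    unfolding assms(4) by (intro add_mono mult_left_mono) auto
  also have "\<dots> = (real K + 5 / 2) * exp (56 / 100 * y)" by (simp add: distrib_right)
  also have "\<dots> \<le> (1 / 2 * y) * exp (56 / 100 * y)" using assms(1,3) by (intro mult_right_mono) auto
  finally have "y * (real P\<^sub>0 + 5 / 2) * real K \<le> y * ((1 / 2 * y) * exp (56 / 100 * y)) * (2 / 5 * y)"
    using assms(1,3) by (intro mult_mono mult_nonneg_nonneg) auto
  also have "\<dots> = 1 / 5 * y ^ 3 * exp (56 / 100 * y)" by (simp add: power3_eq_cube)
  also have "\<dots> \<le> 1 / 1000 * exp (44 / 100 * y) * exp (56 / 100 * y)"
    using power3_le_exp[OF assms(1)] by (intro mult_right_mono) auto
  also have "\<dots> = 1 / 1000 * exp y" by (simp flip: exp_add)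
  also have "\<dots> \<le> 1 / 100 * exp y" by simp
  finally show ?thesis .
qed

lemma lgE_ge_ln3_45:
  assumes "N \<ge> 1" "45 \<le> ln (real N)"
  shows "2 * real N * ln (ln (ln (real N))) \<le> lgE N * ln (real N)"
proof -
  define y where "y = ln (real N)"
  define K where "K = nat \<lfloor>2 / 5 * y\<rfloor>"
  have y: "45 \<le> y" using assms by (simp add: y_def)
  have N: "real N = exp y" using assms(1) by (simp add: y_def)
  note K = cutoff_bounds[OF y, folded K_def]
  have "K \<ge> 1" using K(1) by simp
  then obtain P\<^sub>0 where P: "\<forall>p>P\<^sub>0. faithful p K" "real P\<^sub>0 = real K * exp (psi K)"
    using faithful_psi by blast
  have "400 * K \<le> N"
  proof -
    have "400 * real K \<le> 160 * y" using K(2) by simp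
    also have "\<dots> \<le> 200 * y ^ 3"
    proof -
      have "1 \<le> y ^ 2" using y by simp
      then have "y * 1 \<le> y * y ^ 2" using y by (intro mult_left_mono) auto
      then show ?thesis using y by (simp add: power3_eq_cube power2_eq_square)
    qed
    also have "\<dots> \<le> exp (44 / 100 * y)" by (rule power3_le_exp[OF y])
    also have "\<dots> \<le> real N" using y unfolding N by simp
    finally show ?thesis by linarith
  qed
  then have "921 / 1000 * real N * (\<Sum>m=1..K. gw m / real m)
      - ln (real N) * (real P\<^sub>0 + 5 / 2) * (\<Sum>m=1..K. gw m) \<le> lgE N * ln (real N)"
    using assms(1) P(1) by (intro lgE_ln_ge_gw) auto
  moreover have "ln (real N) * (real P\<^sub>0 + 5 / 2) * (\<Sum>m=1..K. gw m) \<le> 1 / 100 * real N"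
  proof -
    have "(\<Sum>m=1..K. gw m) \<le> real K"
      using sum_gw_le_lgE[OF \<open>K \<ge> 1\<close>] lgE_le[of K] by linarith
    then have "ln (real N) * (real P\<^sub>0 + 5 / 2) * (\<Sum>m=1..K. gw m) \<le> y * (real P\<^sub>0 + 5 / 2) * real K"
      using y unfolding y_def[symmetric] by (intro mult_left_mono) auto
    also have "\<dots> \<le> 1 / 100 * exp y" by (rule cutoff_error[OF y \<open>K \<ge> 1\<close> K(2) P(2)])
    finally show ?thesis by (simp add: N)
  qed
  \<comment> \<open>The coefficient is right because 2.18 * 0.921 > 2; the constant because 3.1 -
    2.18 * \<open>Phi 17\<close> > 0.05.\<close>
  moreover have "2 * ln (ln y) + 1 / 100 \<le> 921 / 1000 * (\<Sum>m=1..K. gw m / real m)"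
  proof -
    have "ln 16 \<le> ln y" using y by (subst ln_le_cancel_iff) auto
    then have U: "2 \<le> ln y - 1 + 3 / 10" "2 \<le> ln y" using ln_16_eq ln_2_bounds by linarith+
    have "Phi (real K) = ln (ln (real K)) + 1 / ln (real K)" by (simp add: Phi_def)
    \<comment> \<open>The summand \<open>1 / ln t\<close> of \<open>Phi\<close> makes up for the 1
      lost in \<open>ln K \<ge> ln y - 1\<close>.\<close>
    moreover have "ln (ln y - 1) + 1 / (ln y - 1) \<le> ln (ln (real K)) + 1 / ln (real K)"
      using U K(3) by (intro ln_plus_inverse_mono) auto
    moreover have "ln (ln y) \<le> ln (ln y - 1) + 1 / (ln y - 1)"
      using U by (intro ln_le_ln_minus_one_plus)
    moreover have "Phi (real K) \<le> Phi (real (Suc K))"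
    proof -
      have "1 \<le> ln (real K)" using ln_ge_2[of K] K(1) by simp
      moreover have "ln (real K) \<le> ln (real (Suc K))" using K(1) by (subst ln_le_cancel_iff) auto
      ultimately show ?thesis unfolding Phi_def by (rule ln_plus_inverse_mono)
    qed
    ultimately have "ln (ln y) \<le> Phi (real (Suc K))" by linarith
    moreover have "ln (ln y) \<ge> 0" using U by simp
    moreover have "31 / 10 + 218 / 100 * (Phi (real (Suc K)) - Phi 17) \<le> (\<Sum>m=1..K. gw m / real m)"
      using K(1) by (intro sum_gw_div_ge) simp
    ultimately show ?thesis using Phi_17_le unfolding right_diff_distrib by linarith
  qed
  then have "real N * (2 * ln (ln y) + 1 / 100) \<le> real N * (921 / 1000 * (\<Sum>m=1..K. gw m / real m))"
    by (rule mult_left_mono) simp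
  ultimately show ?thesis by (simp add: y_def distrib_left mult_ac)
qed

lemma lgE_ge_ln3:
  assumes "N \<ge> 1" "15 \<le> ln (real N)"
  shows "2 * (real N / ln (real N)) * ln (ln (ln (real N))) \<le> lgE N"
proof -
  have "2 * real N * ln (ln (ln (real N))) \<le> lgE N * ln (real N)"
    using lgE_ge_ln3_15_25[OF assms] lgE_ge_ln3_25_45[OF assms(1)] lgE_ge_ln3_45[OF assms(1)] by linarith
  moreover have "ln (real N) > 0" using assms by linarith
  ultimately show ?thesis by (simp add: field_simps)
qed

section \<open>Decreasing weights\<close>

text \<open>Upper companion of the sharp lower mean value. The excess
  \<open>t * psi (n div t)\<close> is at most \<open>n * ln 4\<close>, an error that does not grow
  with ln t.\<close>

lemma sum_psi_div_le_ln:
  assumes "1 \<le> t" "t \<le> n"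
  shows "(\<Sum>m=1..t. psi (n div m))
    \<le> real n * (ln (real t) + ln 4) + (real t + 1) * (ln (real n) + 1)"
proof -
  define y where "y = real n / real t"
  have y: "y \<ge> 1" "ln y = ln (real n) - ln (real t)" "real t * y = real n"
    using assms by (auto simp: y_def ln_div)
  have t0: "t > 0" using assms by simp
  have "(\<Sum>m=1..t. psi (n div m)) = (\<Sum>d=1..n. mangoldt d * real (min t (n div d)))"
    by (rule sum_psi_div)
  \<comment> \<open>With q the quotient of \<open>n\<close> by \<open>d\<close>: if q < t then q is
    its own remainder modulo \<open>t\<close>, otherwise the minimum is \<open>t\<close>, supplied
    by the last term.\<close>
  also have "\<dots> \<le> (\<Sum>d=1..n. mangoldt d * (real (n div d) - real t * real (n div t div d)
      + real t * (if d \<le> n div t then 1 else 0)))"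
  proof (intro sum_mono mult_left_mono mangoldt_nonneg)
    fix d assume d: "d \<in> {1..n}"
    have "t * (n div d div t) + n div d mod t = n div d" by simp
    moreover have "n div d div t = n div t div d" by (simp add: div_mult2_eq[symmetric] mult.commute)
    ultimately have "real t * real (n div t div d) + real (n div d mod t) = real (n div d)"
      by (metis of_nat_add of_nat_mult)
    moreover have "d \<le> n div t \<longleftrightarrow> t \<le> n div d"
      using d t0 by (simp add: less_eq_div_iff_mult_less_eq mult.commute)
    moreover have "t \<le> n div d \<or> n div d mod t = n div d" by (cases "t \<le> n div d") auto
    ultimately show "real (min t (n div d)) \<le> real (n div d) - real t * real (n div t div d)
      + real t * (if d \<le> n div t then 1 else 0)"
      by (auto simp: min_def)
  qed
  also have "\<dots> = (\<Sum>d=1..n. mangoldt d * real (n div d)) - real t * (\<Sum>d=1..n. mangoldt d * real (n div t div d))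
      + real t * (\<Sum>d=1..n. mangoldt d * (if d \<le> n div t then 1 else 0))"
    by (simp add: sum_distrib_left sum_subtractf sum.distrib algebra_simps)
  also have "(\<Sum>d=1..n. mangoldt d * real (n div d)) = ln (fact n)"
    by (rule ln_fact_eq_sum[symmetric]) simp
  also have "(\<Sum>d=1..n. mangoldt d * real (n div t div d)) = ln (fact (n div t))"
    by (rule ln_fact_eq_sum[symmetric]) simp
  also have "(\<Sum>d=1..n. mangoldt d * (if d \<le> n div t then 1 else 0)) = psi (n div t)"
    unfolding psi_def using div_le_dividend[of n t] by (intro sum.mono_neutral_cong_right) auto
  finally have "(\<Sum>m=1..t. psi (n div m)) \<le> ln (fact n) - real t * ln (fact (n div t)) + real t * psi (n div t)" .
  moreover have "ln (fact n) \<le> (real n + 1 / 2) * ln (real n) - real n + 1"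
    using assms by (intro ln_fact_le) auto
  moreover have "real t * (y * ln y - y + 1 - ln (y + 1)) \<le> real t * ln (fact (n div t))"
    using ln_fact_div_ge[OF t0 assms(2) y_def] by (intro mult_left_mono) auto
  moreover have "real t * psi (n div t) \<le> real n * ln 4"
  proof -
    have "psi (n div t) \<le> real (n div t) * ln 4" by (rule psi_le)
    also have "\<dots> \<le> y * ln 4" unfolding y_def by (intro mult_right_mono of_nat_div_le) auto
    finally have "real t * psi (n div t) \<le> real t * (y * ln 4)" by (rule mult_left_mono) simp
    then show ?thesis by (simp only: y(3) mult.assoc[symmetric])
  qed
  moreover have "real t * (y * ln y - y + 1 - ln (y + 1))
      = real n * (ln (real n) - ln (real t)) - real n + real t - real t * ln (y + 1)"
  proof -
    have "real t * (y * ln y - y + 1 - ln (y + 1)) = (real t * y) * ln y - real t * y + real t - real t * ln (y + 1)"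
      by (simp add: algebra_simps)
    then show ?thesis by (simp only: y(2,3))
  qed
  moreover have "real t * ln (y + 1) \<le> real t * (ln (real n) + 1)"
  proof -
    have "y \<le> real n" using y(1) y(3) assms(1) mult_right_mono[of 1 "real t" y] by simp
    then have "ln (y + 1) \<le> ln (2 * real n)" using y(1) by (subst ln_le_cancel_iff) auto
    also have "\<dots> = ln 2 + ln (real n)" using assms by (simp add: ln_mult)
    also have "ln (2::real) \<le> 1" using ln_2_bounds by simp
    finally show ?thesis by (intro mult_left_mono) auto
  qed
  moreover have "ln (real n) \<ge> 0" using assms by simp
  ultimately show ?thesis by (simp add: algebra_simps)
qed

text \<open>Summation by parts in the form of an induction: the surplus of \<open>D\<close> over
  \<open>d\<close> carried at the end shrinks with \<open>g\<close>, so a lower bound on the partial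
  sums suffices for nonincreasing weights.\<close>

lemma abel_summation_le:
  fixes g D d :: "nat \<Rightarrow> real"
  assumes "a \<le> K"
    and "\<And>m. a \<le> m \<Longrightarrow> m < K \<Longrightarrow> g (Suc m) \<le> g m"
    and "\<And>m. a \<le> m \<Longrightarrow> m \<le> K \<Longrightarrow> 0 \<le> g m"
    and "\<And>m. a \<le> m \<Longrightarrow> m \<le> K \<Longrightarrow> d m \<le> D m"
  shows "g a * d a + (\<Sum>m=Suc a..K. g m * (d m - d (m - 1))) + g K * (D K - d K)
    \<le> g a * D a + (\<Sum>m=Suc a..K. g m * (D m - D (m - 1)))"
  using assms
proof (induction K rule: dec_induct)
  case base
  then show ?case by (simp add: algebra_simps)
next
  case (step K)
  have IH: "g a * d a + (\<Sum>m=Suc a..K. g m * (d m - d (m - 1))) + g K * (D K - d K)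
    \<le> g a * D a + (\<Sum>m=Suc a..K. g m * (D m - D (m - 1)))"
    using step.prems by (intro step.IH) auto
  have "0 \<le> (g K - g (Suc K)) * (D K - d K)"
    using step.prems(1)[of K] step.prems(3)[of K] step.hyps by (intro mult_nonneg_nonneg) auto
  then show ?case using IH step.hyps by (simp add: algebra_simps)
qed

text \<open>Partial sums of psi beyond \<open>T\<close> are differences of two mean values, hence at
  least N (ln k - ln T - ln 4) up to small terms. In the summation by parts the constant ln 4 drops
  out of all differences and survives only with the first weight.\<close>

lemma lgE_ge_decreasing_weights:
  fixes g :: "nat \<Rightarrow> real" and N T :: nat
  defines "y \<equiv> ln (real N)"
  defines "K \<equiv> nat \<lfloor>2 / 5 * y\<rfloor>"
  assumes N: "N \<ge> 1" and y: "45 \<le> y" and T: "1 \<le> T" "T < K"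
    and dec: "\<And>m. T < m \<Longrightarrow> m < K \<Longrightarrow> g (Suc m) \<le> g m"
    and nonneg: "\<And>m. T < m \<Longrightarrow> m \<le> K \<Longrightarrow> 0 \<le> g m"
    and gE: "\<And>M. T < M \<Longrightarrow> M \<le> K \<Longrightarrow> (\<Sum>m=Suc T..M. g m) \<le> lgE M"
  shows "real N * ((\<Sum>m=Suc (Suc T)..K. g m / real m) - ln 4 * g (Suc T)) - 15 / 1000 * real N
    \<le> lgE N * y"
proof -
  have Ny: "real N = exp y" using N by (simp add: y_def)
  note K = cutoff_bounds[OF y, folded K_def]
  have K1: "1 \<le> K" using T by simp
  obtain P\<^sub>0 where P: "\<forall>p>P\<^sub>0. faithful p K" "real P\<^sub>0 = real K * exp (psi K)"
    using faithful_psi[OF K1] by blast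
  have y3: "200 * y ^ 3 \<le> exp (44 / 100 * y)" by (rule power3_le_exp[OF y])
  have "exp (44 / 100 * y) \<le> exp y" using y by simp
  then have y3N: "200 * y ^ 3 \<le> real N" using y3 Ny by linarith
  have yy: "y \<le> y ^ 2" "y ^ 2 \<le> y ^ 3"
    using y power_increasing[of 1 2 y] power_increasing[of 2 3 y] by auto
  have KN: "K \<le> N"
    using K(2) yy y3N y by linarith
  \<comment> \<open>Weights vanishing up to \<open>T\<close> make the condition on partial sums
    trivial there, since \<open>lgE\<close> is nonnegative.\<close>
  define h where "h m = (if m \<le> T then 0 else g m)" for m
  have hsum: "(\<Sum>m=1..M. h m * c m) = (\<Sum>m=Suc T..M. g m * c m)" if "M \<le> K" for M and c :: "nat \<Rightarrow> real"
    by (intro sum.mono_neutral_cong_right) (auto simp: h_def)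
  have hsum1: "(\<Sum>m=1..M. h m) = (\<Sum>m=Suc T..M. g m)" if "M \<le> K" for M
    using hsum[OF that, of "\<lambda>_. 1"] by simp
  have L: "(\<Sum>m=1..K. h m * psi (N div m)) - ln (real N) * real P\<^sub>0 * (\<Sum>m=1..K. h m) \<le> lgE N * ln (real N)"
  proof (rule lgE_ln_ge[OF N])
    show "0 \<le> h m" if "m \<in> {1..K}" for m using that nonneg[of m] by (auto simp: h_def)
    show "(\<Sum>m=1..M. h m) \<le> lgE M" if "M \<in> {1..K}" for M
    proof (cases "T < M")
      case True
      then show ?thesis using hsum1[of M] gE[of M] that by simp
    next
      case False
      then show ?thesis using hsum1[of M] lgE_nonneg[of M] that by simp
    qed
  qed (use P(1) in blast)
  have g1: "g (Suc T) \<le> real K"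
  proof -
    have "g (Suc T) \<le> lgE (Suc T)" using gE[of "Suc T"] T by simp
    also have "\<dots> \<le> real (Suc T)" by (rule lgE_le)
    also have "\<dots> \<le> real K" using T by simp
    finally show ?thesis .
  qed
  \<comment> \<open>The lower-order terms of the two mean values, taken at \<open>k = K\<close> so
    as not to depend on \<open>k\<close>. Even multiplied by the crude bound \<open>K\<close> for
    the first weight they are cubic in \<open>y\<close>.\<close>
  define E where "E = real K * (y / 2 + 1) + (real T + 1) * (y + 1)"
  define D where "D k = (\<Sum>m=Suc T..k. psi (N div m))" for k
  define d where "d k = real N * (ln (real k) - ln (real T) - ln 4) - E" for k
  have dD: "d k \<le> D k" if "Suc T \<le> k" "k \<le> K" for k
  proof -
    have "(\<Sum>m=1..k. psi (N div m)) = (\<Sum>m=1..T. psi (N div m)) + D k"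
    proof -
      have "{1..k} = {1..T} \<union> {Suc T..k}" using that by auto
      then show ?thesis unfolding D_def by (simp add: sum.union_disjoint)
    qed
    moreover have "real N * ln (real k) - real k * (y / 2 + 1) \<le> (\<Sum>m=1..k. psi (N div m))"
      unfolding y_def using that KN by (intro sum_psi_div_ge_ln) auto
    moreover have "(\<Sum>m=1..T. psi (N div m)) \<le> real N * (ln (real T) + ln 4) + (real T + 1) * (y + 1)"
      unfolding y_def using T KN by (intro sum_psi_div_le_ln) auto
    moreover have "real k * (y / 2 + 1) \<le> real K * (y / 2 + 1)"
      using that y by (intro mult_right_mono) auto
    ultimately show ?thesis unfolding d_def E_def by (simp add: algebra_simps)
  qed
  have "g (Suc T) * d (Suc T) + (\<Sum>m=Suc (Suc T)..K. g m * (d m - d (m - 1))) + g K * (D K - d K)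
      \<le> g (Suc T) * D (Suc T) + (\<Sum>m=Suc (Suc T)..K. g m * (D m - D (m - 1)))"
    using T dec nonneg dD by (intro abel_summation_le) auto
  moreover have "0 \<le> g K * (D K - d K)" using nonneg[of K] dD[of K] T by (intro mult_nonneg_nonneg) auto
  moreover have "g (Suc T) * D (Suc T) + (\<Sum>m=Suc (Suc T)..K. g m * (D m - D (m - 1)))
      = (\<Sum>m=Suc T..K. g m * psi (N div m))"
  proof -
    have "(\<Sum>m=Suc (Suc T)..K. g m * (D m - D (m - 1))) = (\<Sum>m=Suc (Suc T)..K. g m * psi (N div m))"
    proof (intro sum.cong refl)
      fix m assume "m \<in> {Suc (Suc T)..K}"
      then obtain n where n: "m = Suc n" "Suc T \<le> n" by (cases m) auto
      then show "g m * (D m - D (m - 1)) = g m * psi (N div m)" by (simp add: D_def)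
    qed
    moreover have "D (Suc T) = psi (N div Suc T)" by (simp add: D_def)
    ultimately show ?thesis using T sum.atLeast_Suc_atMost[of "Suc T" K "\<lambda>m. g m * psi (N div m)"] by simp
  qed
  moreover have "real N * (\<Sum>m=Suc (Suc T)..K. g m / real m) \<le> (\<Sum>m=Suc (Suc T)..K. g m * (d m - d (m - 1)))"
    unfolding sum_distrib_left
  proof (rule sum_mono)
    fix m assume m: "m \<in> {Suc (Suc T)..K}"
    have m1: "real (m - 1) = real m - 1" "real m > 1" using m by auto
    \<comment> \<open>The increment of \<open>ln\<close> from \<open>m - 1\<close> to
      \<open>m\<close> is at least \<open>1 / m\<close>.\<close>
    have "ln ((real m - 1) / real m) \<le> (real m - 1) / real m - 1" using m1 by (intro ln_le_minus_one) auto
    moreover have "ln ((real m - 1) / real m) = ln (real m - 1) - ln (real m)" using m1 by (simp add: ln_div)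
    moreover have "(real m - 1) / real m - 1 = - (1 / real m)" using m1 by (simp add: field_simps)
    ultimately have "1 / real m \<le> ln (real m) - ln (real (m - 1))" using m1 by simp
    then have "real N * g m * (1 / real m) \<le> real N * g m * (ln (real m) - ln (real (m - 1)))"
      using nonneg[of m] m by (intro mult_left_mono) auto
    then show "real N * (g m / real m) \<le> g m * (d m - d (m - 1))"
      by (simp add: d_def algebra_simps)
  qed
  moreover have "real N * (- (ln 4 * g (Suc T))) - real K * E \<le> g (Suc T) * d (Suc T)"
  proof -
    have "0 \<le> ln (real (Suc T)) - ln (real T)" using T by simp
    then have "0 \<le> g (Suc T) * (real N * (ln (real (Suc T)) - ln (real T)))"
      using nonneg[of "Suc T"] T by (intro mult_nonneg_nonneg) auto
    moreover have "g (Suc T) * E \<le> real K * E"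
      using g1 y unfolding E_def by (intro mult_right_mono) auto
    ultimately show ?thesis by (simp add: d_def algebra_simps)
  qed
  ultimately have S: "real N * ((\<Sum>m=Suc (Suc T)..K. g m / real m) - ln 4 * g (Suc T)) - real K * E
      \<le> (\<Sum>m=1..K. h m * psi (N div m))"
    unfolding hsum[OF order_refl] by (simp add: right_diff_distrib)
  have "real K * E \<le> 5 / 1000 * real N"
  proof -
    have "E \<le> 2 / 5 * y * (y / 2 + 1) + 2 / 5 * y * (y + 1)"
      unfolding E_def using K(2) T y by (intro add_mono mult_right_mono) auto
    also have "\<dots> = 3 / 5 * y ^ 2 + 4 / 5 * y" by (simp add: field_simps power2_eq_square)
    also have "\<dots> \<le> 7 / 5 * y ^ 2" using yy by simp
    finally have "real K * E \<le> 2 / 5 * y * (7 / 5 * y ^ 2)"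
      using K(2) y unfolding E_def by (intro mult_mono) auto
    also have "\<dots> \<le> y ^ 3" using y by (simp add: power3_eq_cube power2_eq_square)
    finally show ?thesis using y3N by simp
  qed
  moreover have "y * real P\<^sub>0 * (\<Sum>m=1..K. h m) \<le> 1 / 100 * real N"
  proof -
    have "(\<Sum>m=1..K. h m) \<le> real K" using hsum1[of K] gE[of K] lgE_le[of K] T by simp
    then have "y * real P\<^sub>0 * (\<Sum>m=1..K. h m) \<le> y * (real P\<^sub>0 + 5 / 2) * real K"
      using y nonneg hsum1[of K] by (intro mult_mono mult_left_mono) (auto intro!: sum_nonneg simp: h_def)
    also have "\<dots> \<le> 1 / 100 * exp y" by (rule cutoff_error[OF y K1 K(2) P(2)])
    finally show ?thesis by (simp add: Ny)
  qed
  ultimately show ?thesis using S L unfolding y_def[symmetric] by linarith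
qed

section \<open>The induction step\<close>

text \<open>The inverse of the \<open>j\<close>-fold logarithm. The recurring hypothesis
  \<open>tower j 1 \<le> z\<close> keeps the first \<open>j\<close> iterated logarithms of
  \<open>z\<close> at least 1, away from the default values of \<open>ln\<close>.\<close>

definition tower :: "nat \<Rightarrow> real \<Rightarrow> real" where
  "tower j x = (exp ^^ j) x"

lemma tower_0 [simp]: "tower 0 x = x"
  by (simp add: tower_def)

lemma tower_Suc: "tower (Suc j) x = exp (tower j x)"
  by (simp add: tower_def)

lemma tower_diff_ge:
  assumes "0 \<le> a" "a \<le> b"
  shows "b - a \<le> tower j b - tower j a" "0 \<le> tower j a"
proof (induction j)
  case (Suc j)
  show "0 \<le> tower (Suc j) a" by (simp add: tower_Suc)
  have "tower j b - tower j a \<le> exp (tower j b) - exp (tower j a)"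
  proof -
    define x where "x = tower j b - tower j a"
    have x: "0 \<le> x" using Suc assms by (simp add: x_def)
    have "1 + x \<le> exp x" by (rule exp_ge_add_one_self)
    then have "x \<le> exp x - 1" by linarith
    then have "x * 1 \<le> (exp x - 1) * exp (tower j a)"
      using x Suc(2) by (intro mult_mono) auto
    also have "\<dots> = exp (x + tower j a) - exp (tower j a)" by (simp add: exp_add algebra_simps)
    finally show ?thesis by (simp add: x_def)
  qed
  then show "b - a \<le> tower (Suc j) b - tower (Suc j) a" using Suc(1) by (simp add: tower_Suc)
qed (use assms in simp_all)

lemma tower_mono: "a \<le> b \<Longrightarrow> tower j a \<le> tower j b"
  by (induction j) (simp_all add: tower_Suc)

lemma tower_ge_self: "x \<le> tower j x"
proof (induction j)
  case (Suc j)
  have "1 + tower j x \<le> exp (tower j x)" by (rule exp_ge_add_one_self)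
  then show ?case unfolding tower_Suc using Suc by linarith
qed simp

lemma tower_ge_1: "1 \<le> x \<Longrightarrow> 1 \<le> tower j x"
  using tower_ge_self[of x j] by linarith

lemma funpow_ln_Suc: "(ln ^^ Suc j) z = (ln ^^ j) (ln z)" for z :: real
  by (simp only: funpow_Suc_right comp_def)

lemma ln_ge_tower: "tower (Suc j) x \<le> z \<Longrightarrow> tower j x \<le> ln z"
  using less_le_trans[OF exp_gt_zero, of "tower j x" z] by (simp add: tower_Suc ln_ge_iff)

lemma funpow_ln_tower: "(ln ^^ j) (tower j x) = x"
proof (induction j)
  case (Suc j)
  then show ?case by (simp add: funpow_ln_Suc tower_Suc del: funpow.simps)
qed simp

lemma funpow_ln_ge: "tower j x \<le> z \<Longrightarrow> x \<le> (ln ^^ j) z"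
proof (induction j arbitrary: z)
  case (Suc j)
  then show ?case using Suc.IH[OF ln_ge_tower[OF Suc.prems]] by (simp add: funpow_ln_Suc del: funpow.simps)
qed simp

lemma funpow_ln_Lipschitz:
  assumes "tower j 1 \<le> a" "a \<le> b"
  shows "(ln ^^ j) b - (ln ^^ j) a \<le> b - a \<and> (ln ^^ j) a \<le> (ln ^^ j) b"
  using assms
proof (induction j arbitrary: a b)
  case (Suc j)
  have a1: "1 \<le> a" using tower_ge_1[of 1 "Suc j"] Suc.prems(1) by simp
  have la: "tower j 1 \<le> ln a" using Suc.prems(1) by (rule ln_ge_tower)
  have lab: "ln a \<le> ln b" using a1 Suc.prems(2) by simp
  have "ln b - ln a \<le> b - a"
  proof -
    have "ln (b / a) \<le> b / a - 1" using a1 Suc.prems(2) by (intro ln_le_minus_one) auto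
    moreover have "ln (b / a) = ln b - ln a" using a1 Suc.prems(2) by (simp add: ln_div)
    moreover have "b / a - 1 = (b - a) / a" using a1 by (simp add: field_simps)
    moreover have "(b - a) / a \<le> (b - a) / 1" using a1 Suc.prems(2) by (intro divide_left_mono) auto
    ultimately show ?thesis by simp
  qed
  then show ?case using Suc.IH[OF la lab] by (simp add: funpow_ln_Suc del: funpow.simps)
qed simp

lemma funpow_ln_le_self:
  assumes "tower j 1 \<le> z"
  shows "(ln ^^ j) z \<le> z"
  using assms
proof (induction j arbitrary: z)
  case (Suc j)
  have "1 \<le> z" using tower_ge_1[of 1 "Suc j"] Suc.prems by simp
  then have "ln z \<le> z" using ln_le_minus_one[of z] by simp
  then show ?case using Suc.IH[OF ln_ge_tower[OF Suc.prems]] by (simp add: funpow_ln_Suc del: funpow.simps)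
qed simp

lemma tower_funpow_ln:
  assumes "tower j 1 \<le> z"
  shows "tower j ((ln ^^ j) z) = z"
  using assms
proof (induction j arbitrary: z)
  case (Suc j)
  have "1 \<le> z" using tower_ge_1[of 1 "Suc j"] Suc.prems by simp
  then show ?case using Suc.IH[OF ln_ge_tower[OF Suc.prems]]
    by (simp add: funpow_ln_Suc tower_Suc del: funpow.simps)
qed simp

section \<open>The bound at level j and its derivative\<close>

primrec logprod :: "nat \<Rightarrow> real \<Rightarrow> real" where
  "logprod 0 z = 1"
| "logprod (Suc j) z = z * logprod j (ln z)"

text \<open>With z = ln_3 N and t the \<open>j\<close>-fold logarithm of z this is the product of
  \<open>j\<close> logarithms times t - \<kappa>, that is, (1 - \<kappa> / t) times the product in
  the theorem. Putting \<kappa> innermost makes the derivative recursive.\<close>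

primrec rho :: "nat \<Rightarrow> real \<Rightarrow> real \<Rightarrow> real" where
  "rho 0 \<kappa> z = z - \<kappa>"
| "rho (Suc j) \<kappa> z = z * rho j \<kappa> (ln z)"

text \<open>The derivative of \<open>rho\<close> by the product rule; the outer factor z cancels the
  inner derivative 1 / z.\<close>

primrec drho :: "nat \<Rightarrow> real \<Rightarrow> real \<Rightarrow> real" where
  "drho 0 \<kappa> z = 1"
| "drho (Suc j) \<kappa> z = rho j \<kappa> (ln z) + drho j \<kappa> (ln z)"

lemma rho_eq: "rho j \<kappa> z = logprod j z * ((ln ^^ j) z - \<kappa>)"
  by (induction j arbitrary: z) (simp_all add: funpow_ln_Suc del: funpow.simps(2))

lemma logprod_ge_1: "tower j 1 \<le> z \<Longrightarrow> 1 \<le> logprod j z"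
proof (induction j arbitrary: z)
  case (Suc j)
  have "1 \<le> z" using tower_ge_1[of 1 "Suc j"] Suc.prems by simp
  then show ?case using mult_mono[of 1 z 1 "logprod j (ln z)"] Suc.IH[OF ln_ge_tower[OF Suc.prems]] by simp
qed simp

lemma rho_deriv:
  assumes "tower j 1 \<le> z"
  shows "((\<lambda>z. rho j \<kappa> z) has_real_derivative drho j \<kappa> z) (at z)"
  using assms
proof (induction j arbitrary: z)
  case 0
  then show ?case by (auto intro!: derivative_eq_intros)
next
  case (Suc j)
  have z: "1 \<le> z" using tower_ge_1[of 1 "Suc j"] Suc.prems by simp
  have "((\<lambda>z. rho j \<kappa> (ln z)) has_real_derivative drho j \<kappa> (ln z) * (1 / z)) (at z)"
  proof (rule DERIV_chain2[where f = "rho j \<kappa>" and g = ln])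
    show "(rho j \<kappa> has_real_derivative drho j \<kappa> (ln z)) (at (ln z))"
      by (rule Suc.IH[OF ln_ge_tower[OF Suc.prems]])
    show "(ln has_real_derivative 1 / z) (at z)" using z by (auto intro!: derivative_eq_intros)
  qed
  then have "((\<lambda>z. z * rho j \<kappa> (ln z)) has_real_derivative 1 * rho j \<kappa> (ln z) + drho j \<kappa> (ln z) * (1 / z) * z) (at z)"
    by (intro DERIV_mult DERIV_ident)
  then show ?case using z by simp
qed

lemma rho_nonneg: "tower j 1 \<le> z \<Longrightarrow> \<kappa> \<le> (ln ^^ j) z \<Longrightarrow> 0 \<le> rho j \<kappa> z"
  unfolding rho_eq using logprod_ge_1[of j z] by simp

lemma drho_nonneg:
  assumes "tower j 1 \<le> z" "\<kappa> \<le> (ln ^^ j) z"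
  shows "0 \<le> drho j \<kappa> z"
  using assms
proof (induction j arbitrary: z)
  case (Suc j)
  have "\<kappa> \<le> (ln ^^ j) (ln z)" using Suc.prems(2) by (simp add: funpow_ln_Suc del: funpow.simps)
  then show ?case using Suc.IH rho_nonneg ln_ge_tower[OF Suc.prems(1)] by simp
qed simp

text \<open>In \<open>drho\<close> at level j + 1 the first summand is
  \<open>logprod j (ln z)\<close> times t - \<kappa> and the second is at most
  \<open>logprod j (ln z)\<close>, which itself is \<open>logprod (Suc j) z / z\<close>. Hence the
  derivative is small relative to \<open>logprod\<close>, by a factor of about t / z.\<close>

lemma drho_le:
  assumes "1 \<le> \<kappa>" "tower j 1 \<le> z"
  shows "drho j \<kappa> z \<le> logprod j z"
    and "j > 0 \<Longrightarrow> drho j \<kappa> z \<le> logprod j z * (((ln ^^ j) z - \<kappa> + 1) / z)"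
proof -
  have "drho j \<kappa> z \<le> logprod j z \<and> (j > 0 \<longrightarrow> drho j \<kappa> z \<le> logprod j z * (((ln ^^ j) z - \<kappa> + 1) / z))"
    using assms(2)
  proof (induction j arbitrary: z)
    case (Suc j)
    have z: "1 \<le> z" using tower_ge_1[of 1 "Suc j"] Suc.prems by simp
    have lz: "tower j 1 \<le> ln z" using Suc.prems by (rule ln_ge_tower)
    define t where "t = (ln ^^ Suc j) z"
    have t: "t = (ln ^^ j) (ln z)" unfolding t_def by (rule funpow_ln_Suc)
    have "drho (Suc j) \<kappa> z \<le> logprod j (ln z) * (t - \<kappa>) + logprod j (ln z)"
      using Suc.IH[OF lz] by (simp add: rho_eq t)
    also have "\<dots> = logprod (Suc j) z * ((t - \<kappa> + 1) / z)" using z by (simp add: field_simps)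
    finally have 1: "drho (Suc j) \<kappa> z \<le> logprod (Suc j) z * ((t - \<kappa> + 1) / z)" .
    have "t \<le> z" unfolding t_def using Suc.prems by (rule funpow_ln_le_self)
    then have "(t - \<kappa> + 1) / z \<le> 1" using assms(1) z by simp
    then have "logprod (Suc j) z * ((t - \<kappa> + 1) / z) \<le> logprod (Suc j) z * 1"
      using logprod_ge_1[OF Suc.prems] by (intro mult_left_mono) auto
    with 1 show ?case unfolding t_def by simp
  qed simp
  then show "drho j \<kappa> z \<le> logprod j z"
    and "j > 0 \<Longrightarrow> drho j \<kappa> z \<le> logprod j z * (((ln ^^ j) z - \<kappa> + 1) / z)"
    by auto
qed

lemma rho_mono:
  assumes "tower j 1 \<le> a" "a \<le> b" "\<kappa> \<le> (ln ^^ j) a"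
  shows "rho j \<kappa> a \<le> rho j \<kappa> b"
proof (rule DERIV_nonneg_imp_nondecreasing[OF assms(2), of "rho j \<kappa>"])
  fix z assume z: "a \<le> z" "z \<le> b"
  have "tower j 1 \<le> z" using z assms(1) by simp
  moreover have "\<kappa> \<le> (ln ^^ j) z" using funpow_ln_Lipschitz[OF assms(1) z(1)] assms(3) by linarith
  ultimately show "\<exists>y. (rho j \<kappa> has_real_derivative y) (at z) \<and> 0 \<le> y"
    using rho_deriv drho_nonneg by blast
qed

lemma square_le_exp: "0 \<le> x \<Longrightarrow> x ^ 2 \<le> exp (x::real)"
proof -
  assume x: "0 \<le> x"
  have "x \<le> 271 / 100 * (x / 2)" using x by simp
  also have "\<dots> \<le> exp (x / 2)" using x by (intro exp_ge_linear) simp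
  finally have "x ^ 2 \<le> exp (x / 2) ^ 2" using x by (intro power_mono)
  also have "\<dots> = exp x" by (simp flip: exp_of_nat_mult)
  finally show ?thesis .
qed

lemma rho_le_exp:
  assumes "tower j 1 \<le> z" "0 \<le> \<kappa>"
  shows "rho j \<kappa> z \<le> exp z"
  using assms(1)
proof (induction j arbitrary: z)
  case 0
  have "1 + z \<le> exp z" by (rule exp_ge_add_one_self)
  then have "z - \<kappa> \<le> exp z" using assms(2) by linarith
  then show ?case by simp
next
  case (Suc j)
  have z: "1 \<le> z" using tower_ge_1[of 1 "Suc j"] Suc.prems by simp
  have "z * rho j \<kappa> (ln z) \<le> z * exp (ln z)"
    using z Suc.IH[OF ln_ge_tower[OF Suc.prems]] by (intro mult_left_mono) auto
  also have "\<dots> = z ^ 2" using z by (simp add: power2_eq_square)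
  also have "\<dots> \<le> exp z" using z by (intro square_le_exp) simp
  finally show ?case by simp
qed

lemma slope_ln_deriv:
  assumes "1 < x"
  shows "((\<lambda>x. ln (ln x)) has_real_derivative 1 / (x * ln x)) (at x)"
  using assms by (auto intro!: derivative_eq_intros simp: field_simps)

text \<open>One step raises the level \<open>j\<close> at the cost of increasing the constant from \<open>\<kappa>\<close> to \<open>\<kappa>'\<close>. The weights are the
  increments of the bound at level \<open>j\<close>, cut off below \<open>exp (exp s\<^sub>1)\<close>; \<open>cD\<close> makes \<open>rho (Suc j) \<kappa>'\<close> grow no faster
  than the weighted sum, and \<open>cF\<close> makes it so negative at the cut-off that the boundary term is absorbed.\<close>

locale tower_step =
  fixes j :: nat and \<kappa> \<kappa>' \<tau> s\<^sub>1 :: real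
  defines "s\<^sub>1 \<equiv> tower (Suc j) \<tau>"
  assumes \<tau>: "1 \<le> \<tau>" and \<kappa>: "0 \<le> \<kappa>" "\<kappa> \<le> \<tau>" and \<kappa>': "\<tau> \<le> \<kappa>'" "115 / 100 \<le> \<kappa>'"
    and cD: "\<And>s. s\<^sub>1 \<le> s \<Longrightarrow> rho j \<kappa>' (ln s) + drho j \<kappa>' (ln s) \<le> (1 - exp (- s)) * rho j \<kappa> (ln s)"
    and cG: "\<And>s. s\<^sub>1 \<le> s \<Longrightarrow> drho j \<kappa> (ln s) / s \<le> rho j \<kappa> (ln s) / 2"
    and cF: "\<And>s. s\<^sub>1 \<le> s \<Longrightarrow> s \<le> s\<^sub>1 + 3 * exp (- exp s\<^sub>1) \<Longrightarrow>
      1 / 4 + 14 / 10 * rho j \<kappa> (ln s) * exp (- s\<^sub>1) \<le> - rho (Suc j) \<kappa>' s"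
    and cV: "\<And>v. tower (Suc j) \<kappa>' \<le> v \<Longrightarrow> s\<^sub>1 + 3 * exp (- exp s\<^sub>1) + 1 / (exp v - 1) \<le> v"
    and IH: "\<And>M. M \<ge> 1 \<Longrightarrow> tower j 1 \<le> ln (ln (ln (real M))) \<Longrightarrow> 1 \<le> ln (ln (real M)) \<Longrightarrow>
      2 * (real M / ln (real M)) * rho j \<kappa> (ln (ln (ln (real M)))) \<le> lgE M"
begin

lemma s1_ge: "271 / 100 \<le> s\<^sub>1"
proof -
  have "exp 1 \<le> exp (tower j \<tau>)" using tower_ge_self[of \<tau> j] \<tau> by simp
  then show ?thesis using e_ge unfolding s\<^sub>1_def tower_Suc by linarith
qed

lemma at_ge_s1:
  assumes "s\<^sub>1 \<le> s"
  shows "tower (Suc j) 1 \<le> s" "tower j 1 \<le> ln s" "\<tau> \<le> (ln ^^ j) (ln s)" "271 / 100 \<le> s"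
    "0 \<le> rho j \<kappa> (ln s)" "0 \<le> drho j \<kappa> (ln s)"
proof -
  show 1: "tower (Suc j) 1 \<le> s" using tower_mono[OF \<tau>, of "Suc j"] assms by (simp add: s\<^sub>1_def)
  show 2: "tower j 1 \<le> ln s" using 1 by (rule ln_ge_tower)
  show 3: "\<tau> \<le> (ln ^^ j) (ln s)"
    using funpow_ln_ge[of "Suc j" \<tau> s] assms by (simp add: s\<^sub>1_def funpow_ln_Suc del: funpow.simps)
  show "271 / 100 \<le> s" using s1_ge assms by simp
  show "0 \<le> rho j \<kappa> (ln s)" "0 \<le> drho j \<kappa> (ln s)"
    using 2 3 \<kappa> by (auto intro!: rho_nonneg drho_nonneg)
qed

text \<open>The weight as a function of \<open>s = ln (ln x)\<close>; then
  \<open>ln x = exp s\<close>.\<close>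

definition H :: "real \<Rightarrow> real" where
  "H s = slope (exp s) * rho j \<kappa> (ln s)"

lemma slope_exp: "slope (exp s) = exp (- s) * (1 - exp (- s))"
  by (simp add: slope_def exp_minus power2_eq_square field_simps)

lemma slope_exp_nonneg: "0 \<le> s \<Longrightarrow> 0 \<le> slope (exp s)"
  by (intro slope_nonneg) simp

lemma H_nonneg: "s\<^sub>1 \<le> s \<Longrightarrow> 0 \<le> H s"
  unfolding H_def using at_ge_s1(4,5)[of s] slope_exp_nonneg[of s] by (intro mult_nonneg_nonneg) auto

lemma rho_ln_deriv:
  assumes "s\<^sub>1 \<le> s"
  shows "((\<lambda>s. rho j k (ln s)) has_real_derivative drho j k (ln s) / s) (at s)"
proof -
  have "((\<lambda>s. rho j k (ln s)) has_real_derivative drho j k (ln s) * (1 / s)) (at s)"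
  proof (rule DERIV_chain2[where f = "rho j k" and g = ln])
    show "(rho j k has_real_derivative drho j k (ln s)) (at (ln s))"
      using at_ge_s1(2)[OF assms] by (rule rho_deriv)
    show "(ln has_real_derivative 1 / s) (at s)"
      using at_ge_s1(4)[OF assms] by (auto intro!: derivative_eq_intros)
  qed
  then show ?thesis by simp
qed

text \<open>The factor \<open>exp (- s)\<close> falls with logarithmic derivative -1, while
  \<open>cG\<close> limits that of \<open>rho\<close> to 1/2. The correction by
  \<open>e \<le> 1 / 4\<close> does not reverse the sign.\<close>

lemma H_antimono:
  assumes "s\<^sub>1 \<le> a" "a \<le> b"
  shows "H b \<le> H a"
proof (rule DERIV_nonpos_imp_nonincreasing[OF assms(2), of H])
  fix s assume "a \<le> s" "s \<le> b"
  then have s: "s\<^sub>1 \<le> s" using assms by simp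
  define Q Q' e where "Q = rho j \<kappa> (ln s)" and "Q' = drho j \<kappa> (ln s) / s" and "e = exp (- s)"
  have "((\<lambda>s. exp (- s) * (1 - exp (- s)) * rho j \<kappa> (ln s)) has_real_derivative
      (exp (- s) * exp (- s) + (- exp (- s)) * (1 - exp (- s))) * rho j \<kappa> (ln s)
        + drho j \<kappa> (ln s) / s * (exp (- s) * (1 - exp (- s)))) (at s)"
    by (intro DERIV_mult rho_ln_deriv[OF s]) (auto intro!: derivative_eq_intros)
  then have D: "(H has_real_derivative e * (- (1 - 2 * e) * Q + Q' * (1 - e))) (at s)"
    unfolding H_def[abs_def] slope_exp Q_def Q'_def e_def by (rule DERIV_cong) (simp add: algebra_simps add_divide_distrib diff_divide_distrib)
  have "271 / 100 * s \<le> exp s" using at_ge_s1(4)[OF s] by (intro exp_ge_linear) simp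
  then have "4 \<le> exp s" using at_ge_s1(4)[OF s] by linarith
  then have e: "0 < e" "e \<le> 1 / 4" unfolding e_def by (auto simp: exp_minus field_simps)
  have Q: "0 \<le> Q" "0 \<le> Q'" "Q' \<le> Q / 2"
    using at_ge_s1[OF s] cG[OF s] by (auto simp: Q_def Q'_def)
  have "Q' * (1 - e) \<le> Q' * 1" using Q e by (intro mult_left_mono) auto
  also have "\<dots> \<le> 1 / 2 * Q" using Q by simp
  also have "\<dots> \<le> (1 - 2 * e) * Q" using Q e by (intro mult_right_mono) auto
  finally have "- (1 - 2 * e) * Q + Q' * (1 - e) \<le> 0" unfolding mult_minus_left by linarith
  then have "e * (- (1 - 2 * e) * Q + Q' * (1 - e)) \<le> 0" using e by (simp add: mult_nonneg_nonpos)
  with D show "\<exists>y. (H has_real_derivative y) (at s) \<and> y \<le> 0" by blast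
qed

lemma rho_Suc_deriv_le:
  assumes "s\<^sub>1 \<le> s"
  shows "((\<lambda>s. rho (Suc j) \<kappa>' s) has_real_derivative drho (Suc j) \<kappa>' s) (at s)"
    "drho (Suc j) \<kappa>' s \<le> (1 - exp (- s)) * rho j \<kappa> (ln s)"
  using rho_deriv[OF at_ge_s1(1)[OF assms]] cD[OF assms] by simp_all

definition X :: real where "X = exp (exp s\<^sub>1)"

lemma X_ge: "X \<le> x \<Longrightarrow> exp s\<^sub>1 \<le> ln x" "X \<le> x \<Longrightarrow> s\<^sub>1 \<le> ln (ln x)" "X \<le> x \<Longrightarrow> 1 < ln x" "X \<le> x \<Longrightarrow> 1 < x"
proof -
  assume x: "X \<le> x"
  then have x0: "x > 0" unfolding X_def using less_le_trans[OF exp_gt_zero] by blast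
  show 1: "exp s\<^sub>1 \<le> ln x" using x x0 unfolding X_def by (simp add: ln_ge_iff)
  have "1 < exp s\<^sub>1" using s1_ge by simp
  then show 2: "1 < ln x" using 1 by linarith
  show "s\<^sub>1 \<le> ln (ln x)" using 1 2 by (simp add: ln_ge_iff)
  show "1 < x" using 2 x0 by (metis less_trans ln_gt_zero_iff zero_less_one)
qed

definition G :: "real \<Rightarrow> real" where "G x = H (ln (ln x))"

lemma G_eq: "X \<le> x \<Longrightarrow> G x = slope (ln x) * rho j \<kappa> (ln (ln (ln x)))"
  unfolding G_def H_def using X_ge(3)[of x] by simp

lemma G_nonneg: "X \<le> x \<Longrightarrow> 0 \<le> G x"
  unfolding G_def using X_ge(2) by (intro H_nonneg)

lemma G_antimono:
  assumes "X \<le> a" "a \<le> b"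
  shows "G b \<le> G a"
proof -
  have "ln (ln a) \<le> ln (ln b)" using X_ge[of a] X_ge[of b] assms by simp
  then show ?thesis unfolding G_def using X_ge(2)[OF assms(1)] by (intro H_antimono)
qed

definition F :: "real \<Rightarrow> real" where "F x = 2 * (x / ln x * rho j \<kappa> (ln (ln (ln x))))"

text \<open>In the product rule the derivative of \<open>x / ln x\<close> gives exactly
  \<open>2 * G x\<close>; the term from the growth of \<open>rho\<close> is nonnegative and is
  dropped.\<close>

lemma F_deriv:
  assumes "X \<le> x"
  shows "\<exists>d. (F has_real_derivative d) (at x) \<and> 2 * G x \<le> d"
proof -
  define u s where "u = ln x" and "s = ln u"
  have x: "1 < x" "1 < u" "s\<^sub>1 \<le> s" using X_ge[OF assms] by (auto simp: u_def s_def)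
  have "((\<lambda>x. rho j \<kappa> (ln (ln (ln x)))) has_real_derivative drho j \<kappa> (ln s) / s * (1 / (x * u))) (at x)"
    unfolding u_def s_def
  proof (rule DERIV_chain2[where f = "\<lambda>s. rho j \<kappa> (ln s)" and g = "\<lambda>x. ln (ln x)"])
    show "((\<lambda>s. rho j \<kappa> (ln s)) has_real_derivative drho j \<kappa> (ln (ln (ln x))) / ln (ln x)) (at (ln (ln x)))"
      using x by (intro rho_ln_deriv) (simp add: u_def s_def)
  qed (use x slope_ln_deriv in \<open>simp add: u_def\<close>)
  then have "(F has_real_derivative 2 * (slope u * rho j \<kappa> (ln s)
      + drho j \<kappa> (ln s) / s * (1 / (x * u)) * (x / u))) (at x)"
    unfolding F_def[abs_def] u_def s_def using x
    by (intro DERIV_cmult DERIV_mult x_over_ln_deriv) (auto simp: u_def)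
  moreover have "0 \<le> drho j \<kappa> (ln s) / s * (1 / (x * u)) * (x / u)"
    using x at_ge_s1[OF x(3)] by (intro mult_nonneg_nonneg divide_nonneg_nonneg) auto
  moreover have "G x = slope u * rho j \<kappa> (ln s)" using G_eq[OF assms] by (simp add: u_def s_def)
  ultimately show ?thesis by (intro exI conjI) (assumption, simp)
qed

lemma F_step:
  assumes "X \<le> real m"
  shows "2 * G (real (Suc m)) \<le> F (real (Suc m)) - F (real m)"
proof -
  \<comment> \<open>\<open>F_deriv\<close> only asserts existence at each point; a choice function
    is needed for the mean value theorem.\<close>
  define d where "d x = (SOME d. (F has_real_derivative d) (at x) \<and> 2 * G x \<le> d)" for x
  have d: "(F has_real_derivative d x) (at x)" "2 * G x \<le> d x" if "X \<le> x" for x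
    using someI_ex[OF F_deriv[OF that]] by (auto simp: d_def)
  have "\<exists>z. real m < z \<and> z < real (Suc m) \<and> F (real (Suc m)) - F (real m) = (real (Suc m) - real m) * d z"
    by (rule MVT2) (use assms d in auto)
  then obtain z where z: "real m < z" "z < real (Suc m)" "F (real (Suc m)) - F (real m) = d z" by auto
  have "G (real (Suc m)) \<le> G z" using assms z by (intro G_antimono) auto
  then show ?thesis using z d(2)[of z] assms by linarith
qed

lemma F_nonneg: "X \<le> x \<Longrightarrow> 0 \<le> F x"
  unfolding F_def using X_ge[of x] at_ge_s1(5)[of "ln (ln x)"]
  by (intro mult_nonneg_nonneg divide_nonneg_nonneg) auto

lemma sum_G_le:
  assumes "X \<le> real T" "T \<le> M"
  shows "(\<Sum>m=Suc T..M. 2 * G (real m)) \<le> F (real M)"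
  using assms(2)
proof (induction M rule: dec_induct)
  case base
  then show ?case using F_nonneg[OF assms(1)] by simp
next
  case (step M)
  have "X \<le> real M" using assms(1) step.hyps by linarith
  then show ?case using F_step[of M] step by simp
qed

lemma F_le_lgE:
  assumes "X \<le> real M"
  shows "F (real M) \<le> lgE M"
proof -
  have s: "s\<^sub>1 \<le> ln (ln (real M))" using X_ge(2)[OF assms] .
  have "M \<ge> 1" using X_ge(4)[OF assms] by simp
  moreover have "tower j 1 \<le> ln (ln (ln (real M)))" using at_ge_s1(2)[OF s] .
  moreover have "1 \<le> ln (ln (real M))" using s s1_ge by linarith
  ultimately show ?thesis using IH[of M] by (simp add: F_def)
qed

text \<open>The new bound as a function of the cutoff: for \<open>x = K\<close>, close to ln N, its
  argument is close to ln_3 N.\<close>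

definition \<Phi> :: "real \<Rightarrow> real" where "\<Phi> x = rho (Suc j) \<kappa>' (ln (ln x))"

text \<open>Assumption \<open>cD\<close> says precisely that the derivative of \<Phi> is at most
  \<open>G x / x\<close>; monotonicity of both factors then moves the point to the left end.\<close>

lemma \<Phi>_step:
  assumes "X \<le> real m"
  shows "\<Phi> (real (Suc m)) - \<Phi> (real m) \<le> G (real m) / real m"
proof -
  define d where "d x = drho (Suc j) \<kappa>' (ln (ln x)) * (1 / (x * ln x))" for x
  have "\<exists>z. real m < z \<and> z < real (Suc m) \<and> \<Phi> (real (Suc m)) - \<Phi> (real m) = (real (Suc m) - real m) * d z"
  proof (rule MVT2)
    fix x assume "real m \<le> x" "x \<le> real (Suc m)"
    then have x: "X \<le> x" using assms by simp
    show "(\<Phi> has_real_derivative d x) (at x)"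
      unfolding \<Phi>_def[abs_def] d_def
    proof (rule DERIV_chain2[where f = "rho (Suc j) \<kappa>'" and g = "\<lambda>x. ln (ln x)"])
      show "(rho (Suc j) \<kappa>' has_real_derivative drho (Suc j) \<kappa>' (ln (ln x))) (at (ln (ln x)))"
        by (rule rho_Suc_deriv_le(1)[OF X_ge(2)[OF x]])
    qed (use X_ge(4)[OF x] slope_ln_deriv in simp)
  qed simp
  then obtain z where z: "real m < z" "z < real (Suc m)" "\<Phi> (real (Suc m)) - \<Phi> (real m) = d z" by auto
  have zX: "X \<le> z" using assms z by simp
  note Z = X_ge[OF zX]
  have "d z \<le> (1 - exp (- ln (ln z))) * rho j \<kappa> (ln (ln (ln z))) * (1 / (z * ln z))"
    unfolding d_def using rho_Suc_deriv_le(2)[OF Z(2)] Z by (intro mult_right_mono) auto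
  also have "\<dots> = G z / z"
    using Z unfolding G_eq[OF zX] by (simp add: slope_def exp_minus power2_eq_square field_simps)
  also have "\<dots> \<le> G (real m) / real m"
    using G_antimono[OF assms, of z] G_nonneg[OF zX] z X_ge(4)[OF assms] by (intro frac_le) auto
  finally show ?thesis using z(3) by simp
qed

lemma sum_G_div_ge:
  assumes "X \<le> real a" "a \<le> K"
  shows "\<Phi> (real (Suc K)) - \<Phi> (real a) \<le> (\<Sum>m=a..K. G (real m) / real m)"
  using assms(2)
proof (induction K rule: dec_induct)
  case base
  then show ?case using \<Phi>_step[OF assms(1)] by simp
next
  case (step K)
  have "X \<le> real (Suc K)" using assms(1) step.hyps by simp
  then show ?case using \<Phi>_step[of "Suc K"] step by simp
qed

text \<open>Telescoping \<Phi> between \<open>T + 2\<close> and \<open>K + 1\<close> bounds the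
  weighted sum. The loss at the upper end is at most 1/5, the gain at the lower end is 1/4 beyond
  the boundary term with ln 4; after doubling, the surplus 1/10 covers the error 15/1000.\<close>

lemma lgE_ge_rho_Suc:
  assumes N: "N \<ge> 1" and v: "tower (Suc j) 1 \<le> ln (ln (ln (real N)))" and U: "1 \<le> ln (ln (real N))"
  shows "2 * (real N / ln (real N)) * rho (Suc j) \<kappa>' (ln (ln (ln (real N)))) \<le> lgE N"
proof -
  define y U v where "y = ln (real N)" and "U = ln y" and "v = ln U"
  have U1: "1 \<le> U" using U by (simp add: U_def y_def)
  have y0: "0 < y" using U1 N unfolding U_def y_def by (cases "ln (real N) = 0") auto
  have yU: "y = exp U" "U = exp v"
  proof -
    show "y = exp U" using y0 by (simp add: U_def)
    have "U > 0" using U1 by linarith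
    then show "U = exp v" unfolding v_def by (rule exp_ln[symmetric])
  qed
  have v1: "tower (Suc j) 1 \<le> v" using v by (simp add: v_def U_def y_def)
  have goal: "2 * (real N / y) * rho (Suc j) \<kappa>' v \<le> lgE N"
  \<comment> \<open>If the innermost logarithm does not exceed \<kappa>', the claimed bound is not
    positive.\<close>
  proof (cases "(ln ^^ Suc j) v \<le> \<kappa>'")
    case True
    have "rho (Suc j) \<kappa>' v \<le> 0"
      unfolding rho_eq using True logprod_ge_1[OF v1] by (intro mult_nonneg_nonpos) auto
    then have "2 * (real N / y) * rho (Suc j) \<kappa>' v \<le> 0" using y0 by (intro mult_nonneg_nonpos) auto
    then show ?thesis using lgE_nonneg[of N] by linarith
  next
    case False
    have vt: "tower (Suc j) \<kappa>' \<le> v"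
    proof -
      have "tower (Suc j) \<kappa>' \<le> tower (Suc j) ((ln ^^ Suc j) v)" using False by (intro tower_mono) simp
      then show ?thesis using tower_funpow_ln[OF v1] by simp
    qed
    have v3: "315 / 100 \<le> v"
    proof -
      have "ln (315 / 100 :: real) = ln 3 + ln (105 / 100)" using ln_mult[of 3 "105 / 100 :: real"] by simp
      moreover have "ln (105 / 100 :: real) \<le> 105 / 100 - 1" by (rule ln_le_minus_one) simp
      ultimately have "ln (315 / 100 :: real) \<le> 115 / 100" using ln_3_bounds by linarith
      then have "315 / 100 \<le> exp (115 / 100 :: real)"
        by (metis exp_le_cancel_iff exp_ln divide_pos_pos zero_less_numeral)
      also have "\<dots> \<le> exp (tower j \<kappa>')" using tower_ge_self[of \<kappa>' j] \<kappa>' by simp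
      finally show ?thesis using vt by (simp add: tower_Suc)
    qed
    \<comment> \<open>Since \<open>U = exp v\<close>, the quotient is already below 1/5 at
      \<open>v = 3.15\<close>. It bounds the later loss at the cutoff.\<close>
    have vU: "v / (U - 1) \<le> 1 / 5" "85 / 10 \<le> U"
    proof -
      have "271 / 100 * v \<le> exp v" using v3 by (intro exp_ge_linear) simp
      then show "85 / 10 \<le> U" using v3 yU by simp
      have "271 / 100 * (v / 2) \<le> exp (v / 2)" using v3 by (intro exp_ge_linear) simp
      then have "(271 / 100 * (v / 2)) ^ 2 \<le> exp (v / 2) ^ 2" using v3 by (intro power_mono) auto
      also have "\<dots> = exp v" by (simp flip: exp_of_nat_mult)
      finally have "73441 / 40000 * (v * v) \<le> U" unfolding yU(2) by (simp add: power2_eq_square)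
      moreover have "315 / 100 * v \<le> v * v" using v3 by (intro mult_right_mono) auto
      ultimately have "5 * v + 1 \<le> U" using v3 by linarith
      then show "v / (U - 1) \<le> 1 / 5" using v3 by (simp add: pos_divide_le_eq)
    qed
    have y45: "45 \<le> y"
    proof -
      have "(85 / 10) ^ 2 \<le> U ^ 2" using vU by (intro power_mono) auto
      also have "\<dots> \<le> exp U" using vU by (intro square_le_exp) simp
      finally show ?thesis unfolding yU by (simp add: power2_eq_square)
    qed
    define K where "K = nat \<lfloor>2 / 5 * y\<rfloor>"
    define T where "T = nat \<lceil>X\<rceil>"
    note K = cutoff_bounds[OF y45, folded K_def]
    have X1: "1 < X" using X_ge(4)[of X] by simp
    have T: "X \<le> real T" "real T \<le> X + 1" using X1 unfolding T_def by linarith+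
    define s\<^sub>2 where "s\<^sub>2 = ln (ln (real (Suc (Suc T))))"
    have s2: "s\<^sub>1 \<le> s\<^sub>2" unfolding s\<^sub>2_def using T by (intro X_ge(2)) simp
    \<comment> \<open>Rounding moves the lower end by at most 3 beyond \<open>X\<close>; both
      logarithms together shrink this to at most \<open>3 / X\<close>.\<close>
    have s2': "s\<^sub>2 \<le> s\<^sub>1 + 3 * exp (- exp s\<^sub>1)"
    proof -
      have es: "1 \<le> exp s\<^sub>1" using s1_ge by simp
      define r where "r = real (Suc (Suc T))"
      have r: "X \<le> r" "r \<le> X + 3" using T by (auto simp: r_def)
      have "ln (r / X) \<le> r / X - 1" using r X1 by (intro ln_le_minus_one) auto
      also have "\<dots> = (r - X) / X" using X1 by (simp add: field_simps)
      also have "\<dots> \<le> 3 / X" using r X1 by (intro divide_right_mono) auto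
      finally have 1: "ln r \<le> exp s\<^sub>1 + 3 / X" using r X1 by (simp add: ln_div X_def)
      have lr: "1 < ln r" using X_ge(3)[OF r(1)] .
      have "ln (ln r / exp s\<^sub>1) \<le> ln r / exp s\<^sub>1 - 1" using lr by (intro ln_le_minus_one) auto
      also have "\<dots> = (ln r - exp s\<^sub>1) / exp s\<^sub>1" by (simp add: field_simps)
      also have "\<dots> \<le> (3 / X) / exp s\<^sub>1" using 1 by (intro divide_right_mono) auto
      also have "\<dots> \<le> (3 / X) / 1" using es X1 by (intro divide_left_mono) auto
      finally have "ln (ln r) \<le> s\<^sub>1 + 3 / X" using lr by (simp add: ln_div)
      then show ?thesis by (simp add: s\<^sub>2_def r_def X_def exp_minus divide_inverse)
    qed
    \<comment> \<open>The cutoff costs 1 in \<open>ln K\<close> compared with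
      \<open>ln y = U\<close>, hence at most \<open>1 / (U - 1)\<close> after one more
      logarithm.\<close>
    have w: "v - 1 / (U - 1) \<le> ln (ln (real K))"
    proof -
      have "ln U \<le> ln (U - 1) + 1 / (U - 1)" using vU by (intro ln_le_ln_minus_one_plus) simp
      moreover have "ln (U - 1) \<le> ln (ln (real K))"
        using K(3) vU by (subst ln_le_cancel_iff) (auto simp: U_def)
      ultimately show ?thesis by (simp add: v_def)
    qed
    \<comment> \<open>Assumption \<open>cV\<close> guarantees that the range from the lower end to
      the cutoff is not empty.\<close>
    have ws: "s\<^sub>2 \<le> ln (ln (real K))" using cV[OF vt, folded yU(2)] w s2' by linarith
    have TK: "Suc (Suc T) \<le> K"
    proof (rule ccontr)
      assume "\<not> Suc (Suc T) \<le> K"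
      then have "real K < real (Suc (Suc T))" by linarith
      then have "ln (real K) < ln (real (Suc (Suc T)))" using K(1) by (subst ln_less_cancel_iff) auto
      moreover have "0 < ln (real K)" using K(1) by simp
      ultimately have "ln (ln (real K)) < s\<^sub>2" unfolding s\<^sub>2_def by (subst ln_less_cancel_iff) auto
      then show False using ws by simp
    qed
    have main: "real N * ((\<Sum>m=Suc (Suc T)..K. 2 * G (real m) / real m) - ln 4 * (2 * G (real (Suc T))))
        - 15 / 1000 * real N \<le> lgE N * y"
      unfolding y_def K_def
    proof (rule lgE_ge_decreasing_weights[OF N])
      show "45 \<le> ln (real N)" using y45 by (simp add: y_def)
      show "1 \<le> T" using T(1) X1 by linarith
      show "T < nat \<lfloor>2 / 5 * ln (real N)\<rfloor>" using TK by (simp add: K_def y_def)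
      show "2 * G (real (Suc m)) \<le> 2 * G (real m)" if "T < m" for m
        using that T by (intro mult_left_mono G_antimono) auto
      show "0 \<le> 2 * G (real m)" if "T < m" for m using that T G_nonneg[of "real m"] by simp
      show "(\<Sum>m=Suc T..M. 2 * G (real m)) \<le> lgE M" if "T < M" for M
      proof -
        have "(\<Sum>m=Suc T..M. 2 * G (real m)) \<le> F (real M)" using that by (intro sum_G_le T(1)) simp
        also have "\<dots> \<le> lgE M" using that T by (intro F_le_lgE) simp
        finally show ?thesis .
      qed
    qed
    have "\<Phi> (real (Suc K)) - \<Phi> (real (Suc (Suc T))) \<le> (\<Sum>m=Suc (Suc T)..K. G (real m) / real m)"
      using T(1) by (intro sum_G_div_ge TK) simp
    moreover have "(\<Sum>m=Suc (Suc T)..K. 2 * G (real m) / real m) = 2 * (\<Sum>m=Suc (Suc T)..K. G (real m) / real m)"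
      by (simp add: sum_distrib_left)
    moreover have "1 / 4 + ln 4 * G (real (Suc T)) \<le> - \<Phi> (real (Suc (Suc T)))"
    proof -
      have XT: "X \<le> real (Suc T)" using T by simp
      note Z = X_ge[OF XT]
      have "G (real (Suc T)) \<le> exp (- s\<^sub>1) * rho j \<kappa> (ln s\<^sub>2)"
        unfolding G_eq[OF XT]
      proof (rule mult_mono)
        have "slope (ln (real (Suc T))) \<le> 1 / ln (real (Suc T))" by (simp add: slope_def)
        also have "\<dots> \<le> 1 / exp s\<^sub>1" using Z by (intro divide_left_mono) auto
        finally show "slope (ln (real (Suc T))) \<le> exp (- s\<^sub>1)" by (simp add: exp_minus divide_inverse)
        have "ln (ln (real (Suc T))) \<le> s\<^sub>2" unfolding s\<^sub>2_def using Z by simp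
        then show "rho j \<kappa> (ln (ln (ln (real (Suc T))))) \<le> rho j \<kappa> (ln s\<^sub>2)"
          using at_ge_s1[OF Z(2)] \<kappa> by (intro rho_mono) auto
        show "0 \<le> rho j \<kappa> (ln (ln (ln (real (Suc T)))))" using at_ge_s1(5)[OF Z(2)] .
      qed simp
      then have "ln 4 * G (real (Suc T)) \<le> 14 / 10 * (exp (- s\<^sub>1) * rho j \<kappa> (ln s\<^sub>2))"
        using ln_2_bounds ln_4_eq G_nonneg[OF XT] by (intro mult_mono) auto
      then show ?thesis using cF[OF s2 s2'] by (simp add: \<Phi>_def s\<^sub>2_def mult_ac)
    qed
    \<comment> \<open>The argument at the cutoff falls short of \<open>v\<close> by at most
      \<open>1 / (U - 1)\<close>, and the derivative of the new bound is at most \<open>v\<close>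
      there.\<close>
    moreover have "rho (Suc j) \<kappa>' v - 1 / 5 \<le> \<Phi> (real (Suc K))"
    proof -
      define w where "w = ln (ln (real (Suc K)))"
      have "ln (ln (real K)) \<le> w"
        unfolding w_def using K(1) by (intro ln_mono) auto
      then have w1: "v - 1 / (U - 1) \<le> w" "s\<^sub>1 \<le> w" using w ws s2 by linarith+
      show ?thesis
      proof (cases "v \<le> w")
        case True
        have "rho (Suc j) \<kappa>' v \<le> rho (Suc j) \<kappa>' w" using v1 True False by (intro rho_mono) auto
        then show ?thesis by (simp add: \<Phi>_def w_def)
      next
        case wv: False
        have "\<exists>z. w < z \<and> z < v \<and> rho (Suc j) \<kappa>' v - rho (Suc j) \<kappa>' w = (v - w) * drho (Suc j) \<kappa>' z"
          by (rule MVT2) (use wv w1 rho_Suc_deriv_le(1) in auto)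
        then obtain z where z: "w < z" "z < v"
          "rho (Suc j) \<kappa>' v - rho (Suc j) \<kappa>' w = (v - w) * drho (Suc j) \<kappa>' z" by auto
        have zs: "s\<^sub>1 \<le> z" using z w1 by simp
        note Z = at_ge_s1[OF zs]
        have "drho (Suc j) \<kappa>' z \<le> (1 - exp (- z)) * rho j \<kappa> (ln z)" by (rule rho_Suc_deriv_le(2)[OF zs])
        also have "\<dots> \<le> 1 * rho j \<kappa> (ln z)" using Z by (intro mult_right_mono) auto
        also have "\<dots> \<le> exp (ln z)" using Z(2) \<kappa>(1) rho_le_exp by simp
        also have "\<dots> \<le> v" using Z(4) z by simp
        finally have "drho (Suc j) \<kappa>' z \<le> v" .
        then have "(v - w) * drho (Suc j) \<kappa>' z \<le> (v - w) * v" using wv by (intro mult_left_mono) auto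
        also have "\<dots> \<le> 1 / (U - 1) * v" using w1 v3 by (intro mult_right_mono) auto
        also have "\<dots> \<le> 1 / 5" using vU by simp
        finally show ?thesis using z(3) by (simp add: \<Phi>_def w_def)
      qed
    qed
    ultimately have "2 * rho (Suc j) \<kappa>' v + 15 / 1000
        \<le> (\<Sum>m=Suc (Suc T)..K. 2 * G (real m) / real m) - ln 4 * (2 * G (real (Suc T)))"
      by linarith
    then have "real N * (2 * rho (Suc j) \<kappa>' v + 15 / 1000)
        \<le> real N * ((\<Sum>m=Suc (Suc T)..K. 2 * G (real m) / real m) - ln 4 * (2 * G (real (Suc T))))"
      by (rule mult_left_mono) simp
    then have "real N * (2 * rho (Suc j) \<kappa>' v) \<le> lgE N * y" using main by (simp add: distrib_left)
    then show ?thesis using y0 by (simp add: field_simps)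
  qed
  then show ?thesis by (simp only: y_def U_def v_def)
qed

end

section \<open>The constants of the induction\<close>

text \<open>The constants increase to \<open>3 / 2\<close>; their gaps pay for the loss in each step and may halve because that
  loss is inversely proportional to an iterated exponential.\<close>

definition kap :: "nat \<Rightarrow> real" where
  "kap j = (if j = 0 then 0 else if j = 1 then 115 / 100 else 3 / 2 - 9 / 100 / 2 ^ (j - 2))"

text \<open>From ln s <= s / 2.71 and s^2 <= exp s.\<close>

lemma exp_neg_mult_ln_le:
  fixes s :: real
  assumes "1 \<le> s"
  shows "exp (- s) * ln s \<le> 100 / 271 / s"
proof -
  have "271 / 100 * ln s \<le> exp (ln s)" using assms by (intro exp_ge_linear) simp
  then have "ln s \<le> 100 / 271 * s" using assms by simp
  moreover have "s ^ 2 \<le> exp s" using assms by (intro square_le_exp) simp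
  ultimately have "ln s * s ^ 2 \<le> 100 / 271 * s * exp s" using assms by (intro mult_mono) auto
  then show ?thesis using assms by (simp add: exp_minus field_simps power2_eq_square)
qed

lemma exp_e_ge: "15 \<le> exp (exp (1::real))"
proof -
  have "ln (15::real) = ln 3 + ln 5" using ln_mult[of 3 "5::real"] by simp
  then have "ln (15::real) \<le> exp 1" using ln_3_bounds ln_5_bounds e_ge by linarith
  then have "exp (ln (15::real)) \<le> exp (exp 1)" by (simp only: exp_le_cancel_iff)
  then show ?thesis by simp
qed

text \<open>With \<kappa> = 0, assumption \<open>cD\<close> reads
  \<open>exp (- s) * ln s \<le> \<kappa>' - 1\<close>. For s >= 2.71 the left side is at most (100 /
  271)^2 < 0.15, whence the value 1.15.\<close>

lemma tower_step_0:
  assumes "\<And>M. M \<ge> 1 \<Longrightarrow> tower 0 1 \<le> ln (ln (ln (real M))) \<Longrightarrow> 1 \<le> ln (ln (real M)) \<Longrightarrow>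
      2 * (real M / ln (real M)) * rho 0 0 (ln (ln (ln (real M)))) \<le> lgE M"
  shows "tower_step 0 0 (115 / 100) 1"
proof
  have ts: "tower (Suc 0) 1 = exp 1" by (simp add: tower_Suc)
  have X: "3 * exp (- exp (exp (1::real))) \<le> 1 / 1000"
  proof -
    have "exp 15 \<le> exp (exp (exp (1::real)))" using exp_e_ge by simp
    then have "3000 \<le> exp (exp (exp (1::real)))" using exp_15_ge by linarith
    then show ?thesis by (simp add: exp_minus field_simps)
  qed
  have e: "exp (1::real) \<le> 272 / 100" using e_less_272 by simp
  show "rho 0 (115 / 100) (ln s) + drho 0 (115 / 100) (ln s) \<le> (1 - exp (- s)) * rho 0 0 (ln s)"
    if "tower (Suc 0) 1 \<le> s" for s
  proof -
    have s: "271 / 100 \<le> s" using that e_ge unfolding ts by linarith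
    have "100 / 271 / s \<le> 100 / 271 / (271 / 100)" using s by (intro divide_left_mono) auto
    then have "exp (- s) * ln s \<le> 15 / 100" using exp_neg_mult_ln_le[of s] s by simp
    then show ?thesis by (simp add: left_diff_distrib)
  qed
  show "drho 0 0 (ln s) / s \<le> rho 0 0 (ln s) / 2" if "tower (Suc 0) 1 \<le> s" for s
  proof -
    have s: "exp 1 \<le> s" using that unfolding ts .
    then have s0: "2 \<le> s" using e_ge by linarith
    then have "1 \<le> ln s" using s by (simp add: ln_ge_iff)
    moreover have "1 / s \<le> 1 / 2" using s0 by (intro frac_le) auto
    ultimately show ?thesis by simp
  qed
  show "1 / 4 + 14 / 10 * rho 0 0 (ln s) * exp (- tower (Suc 0) 1) \<le> - rho (Suc 0) (115 / 100) s"
    if "tower (Suc 0) 1 \<le> s" "s \<le> tower (Suc 0) 1 + 3 * exp (- exp (tower (Suc 0) 1))" for s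
  proof -
    have s: "exp 1 \<le> s" "s \<le> exp 1 + 1 / 1000" using that X unfolding ts by linarith+
    have s0: "271 / 100 \<le> s" using s e_ge by linarith
    have "ln s \<le> 1 + 1 / 1000"
    proof -
      have "ln (s / exp 1) \<le> s / exp 1 - 1" using s0 by (intro ln_le_minus_one) auto
      also have "\<dots> = (s - exp 1) / exp 1" by (simp add: field_simps)
      also have "\<dots> \<le> (1 / 1000) / 1" using s by (intro frac_le) auto
      finally show ?thesis using s0 by (simp add: ln_div)
    qed
    moreover have "1 \<le> ln s" using s s0 by (simp add: ln_ge_iff)
    moreover have "exp (- exp (1::real)) \<le> 1 / 15" using exp_e_ge by (simp add: exp_minus field_simps)
    ultimately have "ln s * exp (- exp 1) \<le> (1 + 1 / 1000) * (1 / 15)" by (intro mult_mono) auto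
    moreover have "271 / 100 * (149 / 1000) \<le> s * (115 / 100 - ln s)"
      using s0 \<open>ln s \<le> _\<close> by (intro mult_mono) auto
    ultimately show ?thesis unfolding ts by (simp add: algebra_simps)
  qed
  show "tower (Suc 0) 1 + 3 * exp (- exp (tower (Suc 0) 1)) + 1 / (exp v - 1) \<le> v"
    if "tower (Suc 0) (115 / 100) \<le> v" for v
  proof -
    have "271 / 100 * (115 / 100) \<le> exp (115 / 100 :: real)" by (intro exp_ge_linear) simp
    then have v: "311 / 100 \<le> v" using that by (simp add: tower_Suc)
    have "271 / 100 * v \<le> exp v" using v by (intro exp_ge_linear) simp
    then have "7 \<le> exp v - 1" using v by simp
    then have "1 / (exp v - 1) \<le> 1 / 7" by (intro frac_le) auto
    then show ?thesis unfolding ts using X e v by linarith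
  qed
  show "2 * (real M / ln (real M)) * rho 0 0 (ln (ln (ln (real M)))) \<le> lgE M"
    if "M \<ge> 1" "tower 0 1 \<le> ln (ln (ln (real M)))" "1 \<le> ln (ln (real M))" for M
    using that by (rule assms)
qed simp_all

text \<open>The cut-off is placed at the midpoint of \<kappa> and \<kappa>'. The lower half of the
  gap makes \<open>rho\<close> with \<kappa> large enough for \<open>cG\<close>, the upper half
  makes \<open>rho\<close> with \<kappa>' negative enough for \<open>cF\<close> and leaves the room
  for \<open>cV\<close>. The hypothesis \<open>main\<close> yields \<open>cD\<close> on
  multiplication by \<open>logprod\<close>.\<close>

lemma tower_step_Suc:
  fixes \<kappa> \<kappa>' :: real
  assumes j: "j > 0" and \<kappa>: "1 \<le> \<kappa>" "\<kappa> \<le> \<kappa>'" "115 / 100 \<le> \<kappa>'" "\<kappa>' \<le> \<kappa> + 1 / 2"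
    and s1: "36 \<le> tower (Suc j) ((\<kappa> + \<kappa>') / 2)" "4 \<le> tower (Suc j) ((\<kappa> + \<kappa>') / 2) * (\<kappa>' - \<kappa>)"
    and main: "\<And>z. tower j ((\<kappa> + \<kappa>') / 2) \<le> z \<Longrightarrow> ((ln ^^ j) z - \<kappa>' + 1) / z + exp (- exp z) * z \<le> \<kappa>' - \<kappa>"
    and IH: "\<And>M. M \<ge> 1 \<Longrightarrow> tower j 1 \<le> ln (ln (ln (real M))) \<Longrightarrow> 1 \<le> ln (ln (real M)) \<Longrightarrow>
      2 * (real M / ln (real M)) * rho j \<kappa> (ln (ln (ln (real M)))) \<le> lgE M"
  shows "tower_step j \<kappa> \<kappa>' ((\<kappa> + \<kappa>') / 2)"
proof
  define \<tau> where "\<tau> = (\<kappa> + \<kappa>') / 2"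
  define s\<^sub>1 where "s\<^sub>1 = tower (Suc j) \<tau>"
  \<comment> \<open>Half the gap; the hypothesis \<open>s1\<close> says that it is at least
    \<open>2 / s\<^sub>1\<close>, so that errors of order \<open>1 / s\<^sub>1\<close> fit.\<close>
  define \<eta> where "\<eta> = (\<kappa>' - \<kappa>) / 2"
  have s1': "36 \<le> s\<^sub>1" "2 \<le> s\<^sub>1 * \<eta>" using s1 by (simp_all add: s\<^sub>1_def \<tau>_def \<eta>_def)
  have \<tau>: "1 \<le> \<tau>" "\<tau> = \<kappa> + \<eta>" "\<kappa>' = \<tau> + \<eta>" "0 \<le> \<eta>" using \<kappa> by (simp_all add: \<tau>_def \<eta>_def field_simps)
  have basic: "tower j \<tau> \<le> ln s" "tower j 1 \<le> ln s" "\<tau> \<le> (ln ^^ j) (ln s)" "36 \<le> s" "1 \<le> logprod j (ln s)"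
    if "s\<^sub>1 \<le> s" for s
  proof -
    show 1: "tower j \<tau> \<le> ln s" using that unfolding s\<^sub>1_def by (rule ln_ge_tower)
    then show 2: "tower j 1 \<le> ln s" using tower_mono[OF \<tau>(1), of j] by linarith
    show "\<tau> \<le> (ln ^^ j) (ln s)" using 1 by (rule funpow_ln_ge)
    show "36 \<le> s" using s1' that by simp
    show "1 \<le> logprod j (ln s)" using 2 by (rule logprod_ge_1)
  qed
  have small: "3 * exp (- exp s\<^sub>1) \<le> 1 / 4 * \<eta>"
  proof -
    have "s\<^sub>1 ^ 2 \<le> exp s\<^sub>1" using s1' by (intro square_le_exp) simp
    also have "exp s\<^sub>1 \<le> exp (exp s\<^sub>1)" using exp_ge_add_one_self[of s\<^sub>1] by (simp del: exp_ge_add_one_self)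
    finally have "s\<^sub>1 * s\<^sub>1 \<le> exp (exp s\<^sub>1)" by (simp add: power2_eq_square)
    moreover have "36 * s\<^sub>1 \<le> s\<^sub>1 * s\<^sub>1" using s1' by (intro mult_right_mono) auto
    ultimately have "12 * s\<^sub>1 \<le> exp (exp s\<^sub>1) / 3" by linarith
    then have "3 * exp (- exp s\<^sub>1) \<le> 1 / (12 * s\<^sub>1)" using s1' by (simp add: exp_minus field_simps)
    moreover have "1 / (12 * s\<^sub>1) \<le> 1 / 4 * \<eta>"
    proof -
      have "1 / 4 * \<eta> * (12 * s\<^sub>1) = 3 * (s\<^sub>1 * \<eta>)" by simp
      then have "1 \<le> 1 / 4 * \<eta> * (12 * s\<^sub>1)" using s1' by linarith
      then show ?thesis using s1' by (subst pos_divide_le_eq) auto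
    qed
    ultimately show ?thesis by linarith
  qed
  show "1 \<le> (\<kappa> + \<kappa>') / 2" "0 \<le> \<kappa>" "\<kappa> \<le> (\<kappa> + \<kappa>') / 2" "(\<kappa> + \<kappa>') / 2 \<le> \<kappa>'" "115 / 100 \<le> \<kappa>'"
    using \<kappa> by auto
  show "rho j \<kappa>' (ln s) + drho j \<kappa>' (ln s) \<le> (1 - exp (- s)) * rho j \<kappa> (ln s)"
    if "tower (Suc j) ((\<kappa> + \<kappa>') / 2) \<le> s" for s
  proof -
    have s: "s\<^sub>1 \<le> s" using that by (simp add: s\<^sub>1_def \<tau>_def)
    note b = basic[OF s]
    define z t where "z = ln s" and "t = (ln ^^ j) z"
    have sz: "s = exp z" using b(4) by (simp add: z_def)
    have tz: "t \<le> z" unfolding t_def using b(2) by (intro funpow_ln_le_self) (simp add: z_def)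
    have "drho j \<kappa>' z \<le> logprod j z * ((t - \<kappa>' + 1) / z)"
      unfolding t_def using \<kappa> b(2) j by (intro drho_le(2)) (auto simp: z_def)
    moreover have "(t - \<kappa>' + 1) / z + exp (- s) * z \<le> \<kappa>' - \<kappa>"
      using main[of z] b(1) unfolding sz t_def by (simp add: z_def \<tau>_def)
    moreover have "exp (- s) * (t - \<kappa>) \<le> exp (- s) * z" using tz \<kappa> by (intro mult_left_mono) auto
    ultimately have 1: "drho j \<kappa>' z \<le> logprod j z * ((t - \<kappa>' + 1) / z)"
      and 2: "(t - \<kappa>' + 1) / z \<le> \<kappa>' - \<kappa> - exp (- s) * (t - \<kappa>)" by linarith+
    have "logprod j z * ((t - \<kappa>' + 1) / z) \<le> logprod j z * (\<kappa>' - \<kappa> - exp (- s) * (t - \<kappa>))"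
      using b(5) by (intro mult_left_mono 2) (simp add: z_def)
    with 1 have "drho j \<kappa>' z \<le> logprod j z * (\<kappa>' - \<kappa> - exp (- s) * (t - \<kappa>))" by linarith
    then have "rho j \<kappa>' z + drho j \<kappa>' z \<le> (1 - exp (- s)) * rho j \<kappa> z"
      unfolding rho_eq t_def[symmetric] by (simp add: algebra_simps)
    then show ?thesis by (simp add: z_def)
  qed
  show "drho j \<kappa> (ln s) / s \<le> rho j \<kappa> (ln s) / 2"
    if "tower (Suc j) ((\<kappa> + \<kappa>') / 2) \<le> s" for s
  proof -
    have s: "s\<^sub>1 \<le> s" using that by (simp add: s\<^sub>1_def \<tau>_def)
    note b = basic[OF s]
    have "2 \<le> s\<^sub>1 * \<eta>" by (rule s1'(2))
    also have "\<dots> \<le> s * ((ln ^^ j) (ln s) - \<kappa>)" using s b s1' \<tau> by (intro mult_mono) auto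
    finally have "logprod j (ln s) * 2 \<le> logprod j (ln s) * (s * ((ln ^^ j) (ln s) - \<kappa>))"
      using b(5) by (intro mult_left_mono) auto
    moreover have "drho j \<kappa> (ln s) \<le> logprod j (ln s)" using \<kappa>(1) b(2) by (rule drho_le(1))
    ultimately have "2 * drho j \<kappa> (ln s) \<le> s * rho j \<kappa> (ln s)" unfolding rho_eq by (simp add: mult_ac)
    then show ?thesis using b(4) by (simp add: field_simps)
  qed
  show "1 / 4 + 14 / 10 * rho j \<kappa> (ln s) * exp (- tower (Suc j) ((\<kappa> + \<kappa>') / 2)) \<le> - rho (Suc j) \<kappa>' s"
    if "tower (Suc j) ((\<kappa> + \<kappa>') / 2) \<le> s"
      "s \<le> tower (Suc j) ((\<kappa> + \<kappa>') / 2) + 3 * exp (- exp (tower (Suc j) ((\<kappa> + \<kappa>') / 2)))" for s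
  proof -
    have s: "s\<^sub>1 \<le> s" "s \<le> s\<^sub>1 + 1 / 4 * \<eta>" using that small by (simp_all add: s\<^sub>1_def \<tau>_def)
    note b = basic[OF s(1)]
    define t where "t = (ln ^^ j) (ln s)"
    define p where "p = logprod j (ln s)"
    have "t \<le> \<tau> + 1 / 4 * \<eta>"
    proof -
      have "(ln ^^ Suc j) s - (ln ^^ Suc j) s\<^sub>1 \<le> s - s\<^sub>1"
        using funpow_ln_Lipschitz[of "Suc j" s\<^sub>1 s] tower_mono[OF \<tau>(1), of "Suc j"] s(1)
        by (simp add: s\<^sub>1_def del: funpow.simps)
      moreover have "(ln ^^ Suc j) s\<^sub>1 = \<tau>" unfolding s\<^sub>1_def by (rule funpow_ln_tower)
      moreover have "(ln ^^ Suc j) s = t" unfolding t_def by (rule funpow_ln_Suc)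
      ultimately show ?thesis using s by linarith
    qed
    then have t: "3 / 4 * \<eta> \<le> \<kappa>' - t" "t - \<kappa> \<le> 1" "0 \<le> t - \<kappa>"
    proof -
      have "\<eta> \<le> 1 / 4" using \<kappa> by (simp add: \<eta>_def)
      then show "3 / 4 * \<eta> \<le> \<kappa>' - t" "t - \<kappa> \<le> 1" using \<tau> \<open>t \<le> _\<close> by linarith+
      show "0 \<le> t - \<kappa>" using \<tau> b(3) unfolding t_def[symmetric] by linarith
    qed
    have p: "1 \<le> p" using b(5) by (simp add: p_def)
    have "exp (- s\<^sub>1) \<le> 1 / 36"
    proof -
      have "1 + s\<^sub>1 \<le> exp s\<^sub>1" by (rule exp_ge_add_one_self)
      then have "36 \<le> exp s\<^sub>1" using s1' by linarith
      then show ?thesis by (simp add: exp_minus field_simps)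
    qed
    then have "14 / 10 * (p * (t - \<kappa>)) * exp (- s\<^sub>1) \<le> 14 / 10 * (p * 1) * (1 / 36)"
      using t p by (intro mult_mono mult_left_mono) auto
    moreover have "3 / 2 * p \<le> s * (p * (\<kappa>' - t))"
    proof -
      have "s\<^sub>1 * (3 / 4 * \<eta>) = 3 / 4 * (s\<^sub>1 * \<eta>)" by simp
      then have "3 / 2 \<le> s\<^sub>1 * (3 / 4 * \<eta>)" using s1'(2) by linarith
      also have "\<dots> \<le> s * (\<kappa>' - t)" using s t s1' \<tau> by (intro mult_mono) auto
      finally have "p * (3 / 2) \<le> p * (s * (\<kappa>' - t))" using p by (intro mult_left_mono) auto
      then show ?thesis by (simp add: mult_ac)
    qed
    ultimately have "1 / 4 + 14 / 10 * (p * (t - \<kappa>)) * exp (- s\<^sub>1) \<le> s * (p * (\<kappa>' - t))" using p by linarith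
    moreover have "rho j \<kappa> (ln s) = p * (t - \<kappa>)" "rho (Suc j) \<kappa>' s = s * (p * (t - \<kappa>'))"
      by (simp_all only: rho.simps(2), simp_all only: rho_eq t_def p_def)
    moreover have "s * (p * (\<kappa>' - t)) = - (s * (p * (t - \<kappa>')))" by (simp add: algebra_simps)
    ultimately show ?thesis by (simp only: s\<^sub>1_def \<tau>_def)
  qed
  show "tower (Suc j) ((\<kappa> + \<kappa>') / 2) + 3 * exp (- exp (tower (Suc j) ((\<kappa> + \<kappa>') / 2))) + 1 / (exp v - 1) \<le> v"
    if "tower (Suc j) \<kappa>' \<le> v" for v
  proof -
    have "\<kappa>' - \<tau> \<le> tower (Suc j) \<kappa>' - s\<^sub>1"
      unfolding s\<^sub>1_def using \<tau> by (intro tower_diff_ge) auto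
    then have v: "s\<^sub>1 + \<eta> \<le> v" using that \<tau> by simp
    have "1 + v \<le> exp v" by (rule exp_ge_add_one_self)
    then have "s\<^sub>1 \<le> exp v - 1" using v \<tau> by linarith
    then have "1 / (exp v - 1) \<le> 1 / s\<^sub>1" using s1' by (intro frac_le) auto
    also have "\<dots> \<le> 1 / 2 * \<eta>" using s1' by (simp add: pos_divide_le_eq mult.commute)
    finally show ?thesis using small v \<tau>(4) unfolding s\<^sub>1_def[symmetric] \<tau>_def[symmetric] by linarith
  qed
  show "2 * (real M / ln (real M)) * rho j \<kappa> (ln (ln (ln (real M)))) \<le> lgE M"
    if "M \<ge> 1" "tower j 1 \<le> ln (ln (ln (real M)))" "1 \<le> ln (ln (real M))" for M
    using that by (rule IH)
qed

text \<open>3.5838 is the upper estimate for ln 36 = 2 ln 2 + 2 ln 3 from the bounds above, so a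
  second exponential reaches 36.\<close>

lemma exp_128_ge: "35838 / 10000 \<le> exp (128 / 100 :: real)"
proof -
  have a: "ln (36 / 10 :: real) = 2 * ln 2 + 2 * ln 3 - ln 10"
  proof -
    have "ln (36 :: real) = ln 4 + ln 9" using ln_mult[of 4 "9::real"] by simp
    moreover have "ln (9 :: real) = 2 * ln 3" using ln_realpow[of 3 2] by simp
    moreover have "ln (36 / 10 :: real) = ln 36 - ln 10" by (rule ln_divide_pos) auto
    ultimately show ?thesis using ln_4_eq by simp
  qed
  have "ln (10 :: real) = ln 2 + ln 5" using ln_mult[of 2 "5::real"] by simp
  moreover have "ln (35838 / 10000 :: real) = ln (36 / 10) + ln (35838 / 36000)"
    using ln_mult[of "36 / 10" "35838 / 36000 :: real"] by simp
  moreover have "ln (35838 / 36000 :: real) \<le> 35838 / 36000 - 1" by (rule ln_le_minus_one) simp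
  ultimately have "ln (35838 / 10000 :: real) \<le> 128 / 100"
    using a ln_2_bounds ln_3_bounds ln_5_bounds by linarith
  then have "exp (ln (35838 / 10000 :: real)) \<le> exp (128 / 100)" by (simp only: exp_le_cancel_iff)
  then show ?thesis by simp
qed

lemma exp_exp_128_ge: "36 \<le> exp (exp (128 / 100 :: real))"
proof -
  have "ln (36 :: real) = ln 4 + ln 9" using ln_mult[of 4 "9::real"] by simp
  moreover have "ln (9 :: real) = 2 * ln 3" using ln_realpow[of 3 2] by simp
  ultimately have "ln (36 :: real) \<le> exp (128 / 100)"
    using exp_128_ge ln_4_eq ln_2_bounds ln_3_bounds by linarith
  then have "exp (ln (36 :: real)) \<le> exp (exp (128 / 100))" by (simp only: exp_le_cancel_iff)
  then show ?thesis by simp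
qed

lemma exp_141_ge: "409 / 100 \<le> exp (141 / 100 :: real)"
proof -
  have "ln (409 / 100 :: real) = ln 4 + ln (409 / 400)" using ln_mult[of 4 "409 / 400 :: real"] by simp
  moreover have "ln (409 / 400 :: real) \<le> 409 / 400 - 1" by (rule ln_le_minus_one) simp
  ultimately have "ln (409 / 100 :: real) \<le> 141 / 100" using ln_4_eq ln_2_bounds by linarith
  then have "exp (ln (409 / 100 :: real)) \<le> exp (141 / 100)" by (simp only: exp_le_cancel_iff)
  then show ?thesis by simp
qed

text \<open>Essentially the tangent of exp at 1.41, which bounds (ln z - \<kappa>' + 1) / z for
  \<kappa>' = 1.41: that quotient is largest where ln z = \<kappa>'.\<close>

lemma exp_tangent_141: "409 / 100 * (t - 41 / 100) \<le> exp t" for t :: real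
proof (cases "t \<le> 41 / 100")
  case True
  then have "409 / 100 * (t - 41 / 100) \<le> 0" by simp
  then show ?thesis using exp_gt_zero[of t] by linarith
next
  case False
  have "1 + (t - 141 / 100) \<le> exp (t - 141 / 100)" by (rule exp_ge_add_one_self)
  then have "409 / 100 * (t - 41 / 100) \<le> exp (141 / 100) * exp (t - 141 / 100)"
    using exp_141_ge False by (intro mult_mono) auto
  then show ?thesis by (simp flip: exp_add)
qed

lemma exp_neg_mult_ln_le_div:
  fixes s c :: real
  assumes "1 \<le> c" "c \<le> s"
  shows "exp (- s) * ln s \<le> 100 / 271 / c"
proof -
  have "100 / 271 / s \<le> 100 / 271 / c" using assms by (intro divide_left_mono) auto
  then show ?thesis using exp_neg_mult_ln_le[of s] assms by linarith
qed

text \<open>The required gap is at most 100/409 + 100/(271 * 36), about 0.255, which fits into 1.41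
  - 1.15 = 0.26.\<close>

lemma tower_step_1:
  assumes "\<And>M. M \<ge> 1 \<Longrightarrow> tower 1 1 \<le> ln (ln (ln (real M))) \<Longrightarrow> 1 \<le> ln (ln (real M)) \<Longrightarrow>
      2 * (real M / ln (real M)) * rho 1 (115 / 100) (ln (ln (ln (real M)))) \<le> lgE M"
  shows "tower_step 1 (115 / 100) (141 / 100) (128 / 100)"
proof -
  have \<tau>: "(115 / 100 + 141 / 100) / 2 = (128 / 100 :: real)" by simp
  have t2: "tower (Suc 1) (128 / 100) = exp (exp (128 / 100))" by (simp add: tower_def)
  have "((ln ^^ 1) z - 141 / 100 + 1) / z + exp (- exp z) * z \<le> 141 / 100 - 115 / 100"
    if "tower 1 (128 / 100) \<le> z" for z
  proof -
    have z: "exp (128 / 100) \<le> z" using that by (simp add: tower_def)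
    then have z0: "0 < z" using exp_gt_zero[of "128 / 100 :: real"] by linarith
    have "409 / 100 * (ln z - 41 / 100) \<le> z" using exp_tangent_141[of "ln z"] z0 by simp
    then have "(ln z - 41 / 100) / z \<le> 100 / 409" using z0 by (simp add: pos_divide_le_eq)
    moreover have "exp (exp (128 / 100)) \<le> exp z" using z by simp
    then have "36 \<le> exp z" using exp_exp_128_ge by linarith
    then have "exp (- exp z) * z \<le> 100 / 271 / 36"
      using exp_neg_mult_ln_le_div[of 36 "exp z"] by (simp only: ln_exp)
    moreover have "(ln ^^ 1) z - 141 / 100 + 1 = ln z - 41 / 100" by simp
    ultimately show ?thesis by (simp only:)
  qed
  note main = this
  have "tower_step 1 (115 / 100) (141 / 100) ((115 / 100 + 141 / 100) / 2)"
  proof (rule tower_step_Suc)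
    show "36 \<le> tower (Suc 1) ((115 / 100 + 141 / 100) / 2)" unfolding \<tau> t2 by (rule exp_exp_128_ge)
    show "4 \<le> tower (Suc 1) ((115 / 100 + 141 / 100) / 2) * (141 / 100 - 115 / 100)"
      unfolding \<tau> t2 using exp_exp_128_ge by simp
    show "((ln ^^ 1) z - 141 / 100 + 1) / z + exp (- exp z) * z \<le> 141 / 100 - 115 / 100"
      if "tower 1 ((115 / 100 + 141 / 100) / 2) \<le> z" for z
      using that unfolding \<tau> by (rule main)
    show "2 * (real M / ln (real M)) * rho 1 (115 / 100) (ln (ln (ln (real M)))) \<le> lgE M"
      if "M \<ge> 1" "tower 1 1 \<le> ln (ln (ln (real M)))" "1 \<le> ln (ln (real M))" for M
      using that by (rule assms)
  qed simp_all
  then show ?thesis by (simp only: \<tau>)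
qed

lemma two_le_exp: "2 * x \<le> exp x" for x :: real
proof (cases "0 \<le> x")
  case True
  then show ?thesis using exp_ge_linear[of x] by linarith
next
  case False
  then show ?thesis using exp_gt_zero[of x] by linarith
qed

lemma tower_ge_double:
  assumes "c \<le> tower i x"
  shows "c * 2 ^ n \<le> tower (i + n) x"
proof (induction n)
  case (Suc n)
  have "2 * tower (i + n) x \<le> exp (tower (i + n) x)" by (rule two_le_exp)
  then show ?case using Suc by (simp add: tower_Suc)
qed (use assms in simp)

text \<open>exp t >= 2.71 t = x and exp x >= (1.355 x)^2, where x^2 is bounded below by its tangent
  at 3.4.\<close>

lemma tower_2_ge:
  assumes "143 / 100 \<le> t"
  shows "25 * (t - 45 / 100) \<le> tower 2 t"
proof -
  define x where "x = 271 / 100 * t"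
  have x: "387 / 100 \<le> x" using assms by (simp add: x_def)
  have "(271 / 100 * (x / 2)) ^ 2 \<le> exp (x / 2) ^ 2"
    using exp_ge_linear[of "x / 2"] x by (intro power_mono) auto
  also have "\<dots> = exp x" by (simp flip: exp_of_nat_mult)
  finally have 1: "73441 / 40000 * (x * x) \<le> exp x" by (simp add: power2_eq_square)
  have "0 \<le> (x - 34 / 10) * (x - 34 / 10)" by simp
  then have "68 / 10 * x - 1156 / 100 \<le> x * x" by (simp add: algebra_simps)
  then have "73441 / 40000 * (68 / 10 * x - 1156 / 100) \<le> 73441 / 40000 * (x * x)"
    by (intro mult_left_mono) auto
  then have "25 * (t - 45 / 100) \<le> exp x" using 1 x unfolding x_def by (simp add: algebra_simps)
  also have "x \<le> exp t" unfolding x_def using assms by (intro exp_ge_linear) simp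
  then have "exp x \<le> exp (exp t)" by simp
  finally show ?thesis by (simp add: tower_def numeral_2_eq_2)
qed

lemma tower_3_ge:
  assumes "143 / 100 \<le> t"
  shows "1000 \<le> tower 3 t"
proof -
  have "25 * (143 / 100 - 45 / 100) \<le> 25 * (t - 45 / 100)" using assms by simp
  also have "\<dots> \<le> tower 2 t" by (rule tower_2_ge[OF assms])
  finally have "15 \<le> tower 2 t" by simp
  then have "exp 15 \<le> exp (tower 2 t)" by simp
  also have "\<dots> = tower 3 t" by (simp add: tower_def numeral_2_eq_2 numeral_3_eq_3)
  finally have "exp 15 \<le> tower 3 t" .
  then show ?thesis using exp_15_ge by linarith
qed

text \<open>With d = 1 / 2^n the gap is 0.045 d. Each further exponential at least doubles, so z >=
  25 (t - 0.45) / d; hence the two losses are at most 0.04 d and d / 2710. The gaps sum to 0.09 =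
  1.5 - 1.41.\<close>

lemma tower_step_ge_2:
  assumes IH: "\<And>M. M \<ge> 1 \<Longrightarrow> tower (2 + n) 1 \<le> ln (ln (ln (real M))) \<Longrightarrow> 1 \<le> ln (ln (real M)) \<Longrightarrow>
      2 * (real M / ln (real M)) * rho (2 + n) (3 / 2 - 9 / 100 / 2 ^ n) (ln (ln (ln (real M)))) \<le> lgE M"
  defines "\<kappa> \<equiv> 3 / 2 - 9 / 100 / 2 ^ n" and "\<kappa>' \<equiv> 3 / 2 - 9 / 100 / 2 ^ Suc n"
  shows "tower_step (2 + n) \<kappa> \<kappa>' ((\<kappa> + \<kappa>') / 2)"
proof -
  define d :: real where "d = 1 / 2 ^ n"
  have d: "0 < d" "d \<le> 1" by (auto simp: d_def)
  have \<kappa>: "\<kappa> = 3 / 2 - 9 / 100 * d" "\<kappa>' = 3 / 2 - 45 / 1000 * d"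
    by (simp_all add: \<kappa>_def \<kappa>'_def d_def)
  define \<tau> where "\<tau> = (\<kappa> + \<kappa>') / 2"
  have \<tau>: "143 / 100 \<le> \<tau>" using d by (simp add: \<tau>_def \<kappa>)
  have d1: "2 ^ n * d = 1" by (simp add: d_def)
  have s: "1000 * 2 ^ n \<le> tower (Suc (2 + n)) \<tau>"
  proof -
    have eq: "Suc (2 + n) = 3 + n" by simp
    show ?thesis unfolding eq using \<tau> by (intro tower_ge_double tower_3_ge)
  qed
  have pow: "1 \<le> (2::real) ^ n" by simp
  show ?thesis
  proof (rule tower_step_Suc)
    show "1 \<le> \<kappa>" "\<kappa> \<le> \<kappa>'" "115 / 100 \<le> \<kappa>'" "\<kappa>' \<le> \<kappa> + 1 / 2" using d by (auto simp: \<kappa>)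
    show "36 \<le> tower (Suc (2 + n)) ((\<kappa> + \<kappa>') / 2)"
      using s pow unfolding \<tau>_def by linarith
    have "1000 * 2 ^ n * (45 / 1000 * d) \<le> tower (Suc (2 + n)) \<tau> * (45 / 1000 * d)"
      using s d by (intro mult_right_mono) auto
    then have "45 \<le> tower (Suc (2 + n)) \<tau> * (45 / 1000 * d)" using d1 by (simp add: mult_ac)
    moreover have "\<kappa>' - \<kappa> = 45 / 1000 * d" by (simp add: \<kappa>)
    ultimately show "4 \<le> tower (Suc (2 + n)) ((\<kappa> + \<kappa>') / 2) * (\<kappa>' - \<kappa>)"
      unfolding \<tau>_def[symmetric] by (simp only:)
    show "((ln ^^ (2 + n)) z - \<kappa>' + 1) / z + exp (- exp z) * z \<le> \<kappa>' - \<kappa>"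
      if "tower (2 + n) ((\<kappa> + \<kappa>') / 2) \<le> z" for z
    proof -
      have z: "tower (2 + n) \<tau> \<le> z" using that by (simp only: \<tau>_def)
      define t where "t = (ln ^^ (2 + n)) z"
      have t: "\<tau> \<le> t" unfolding t_def using z by (rule funpow_ln_ge)
      have "tower (2 + n) 1 \<le> z" using z tower_mono[of 1 \<tau> "2 + n"] \<tau> by linarith
      then have zt: "z = tower (2 + n) t" unfolding t_def by (rule tower_funpow_ln[symmetric])
      have zl: "25 * (t - 45 / 100) * 2 ^ n \<le> z"
        unfolding zt using t \<tau> by (intro tower_ge_double tower_2_ge) simp
      have z1: "1 \<le> z" using z tower_ge_1[of \<tau> "2 + n"] \<tau> by linarith
      have "t - \<kappa>' + 1 \<le> t - 45 / 100" using d by (simp add: \<kappa>)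
      also have "\<dots> = 4 / 100 * d * (25 * (t - 45 / 100) * 2 ^ n)" using d1 by (simp add: mult_ac)
      also have "\<dots> \<le> 4 / 100 * d * z" using zl d by (intro mult_left_mono) auto
      finally have "(t - \<kappa>' + 1) / z \<le> 4 / 100 * d" using z1 by (simp add: pos_divide_le_eq)
      moreover have "exp (- exp z) * z \<le> 100 / 271 / (1000 * 2 ^ n)"
      proof (rule exp_neg_mult_ln_le_div[of _ "exp z", unfolded ln_exp])
        show "1 \<le> 1000 * (2::real) ^ n" using pow by linarith
        have "tower (Suc (2 + n)) \<tau> \<le> exp z" using z by (simp add: tower_Suc)
        then show "1000 * 2 ^ n \<le> exp z" using s by linarith
      qed
      moreover have "100 / 271 / (1000 * 2 ^ n) = 1 / 2710 * d" by (simp add: d_def)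
      ultimately have "(t - \<kappa>' + 1) / z + exp (- exp z) * z \<le> 45 / 1000 * d" using d by linarith
      then show ?thesis by (simp add: t_def \<kappa>)
    qed
    show "2 * (real M / ln (real M)) * rho (2 + n) \<kappa> (ln (ln (ln (real M)))) \<le> lgE M"
      if "M \<ge> 1" "tower (2 + n) 1 \<le> ln (ln (ln (real M)))" "1 \<le> ln (ln (real M))" for M
      unfolding \<kappa>_def using that by (rule IH)
  qed simp
qed

lemma ln_ln_ge_1:
  fixes x :: real
  assumes "1 \<le> ln (ln x)" "0 < ln x"
  shows "271 / 100 \<le> ln x"
proof -
  have "exp 1 \<le> ln x" using assms by (simp add: ln_ge_iff)
  then show ?thesis using e_ge by linarith
qed

lemma ln_ln_ln_ge_1:
  fixes x :: real
  assumes "1 \<le> ln (ln (ln x))" "0 < ln (ln x)" "0 < ln x"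
  shows "15 \<le> ln x"
proof -
  have "exp 1 \<le> ln (ln x)" using assms by (simp add: ln_ge_iff)
  then have "exp (exp 1) \<le> ln x" using assms by (simp add: ln_ge_iff)
  then show ?thesis using exp_e_ge by linarith
qed

text \<open>The case N = 1 is excluded by the default value \<open>ln 0 = 0\<close>.\<close>

lemma ln_nat_cases: "N \<ge> 1 \<Longrightarrow> 0 < ln (ln (real N)) \<Longrightarrow> 0 < ln (real N)"
  by (cases "N = 1") auto

lemma lgE_ge_rho:
  assumes "N \<ge> 1" "tower j 1 \<le> ln (ln (ln (real N)))" "1 \<le> ln (ln (real N))"
  shows "2 * (real N / ln (real N)) * rho j (kap j) (ln (ln (ln (real N)))) \<le> lgE N"
  using assms
proof (induction j arbitrary: N)
  case 0
  have U: "0 < ln (ln (real N))" using 0(3) by linarith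
  have "15 \<le> ln (real N)"
    using 0(2) U ln_nat_cases[OF 0(1) U] unfolding tower_0 by (rule ln_ln_ln_ge_1)
  then show ?case using lgE_ge_ln3[OF 0(1)] by (simp add: kap_def)
next
  case (Suc j)
  consider "j = 0" | "j = 1" | n where "j = 2 + n"
    by (metis One_nat_def add_2_eq_Suc not0_implies_Suc)
  then show ?case
  proof cases
    case 1
    have "tower_step 0 0 (115 / 100) 1"
      using Suc.IH unfolding 1 by (intro tower_step_0) (simp add: kap_def)
    from tower_step.lgE_ge_rho_Suc[OF this Suc.prems[unfolded 1]]
    show ?thesis by (simp add: 1 kap_def)
  next
    case 2
    have "tower_step 1 (115 / 100) (141 / 100) (128 / 100)"
      using Suc.IH unfolding 2 by (intro tower_step_1) (simp add: kap_def)
    from tower_step.lgE_ge_rho_Suc[OF this Suc.prems[unfolded 2]]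
    show ?thesis by (simp add: 2 kap_def numeral_2_eq_2)
  next
    case 3
    have k: "kap (2 + n) = 3 / 2 - 9 / 100 / 2 ^ n" "kap (Suc (2 + n)) = 3 / 2 - 9 / 100 / 2 ^ Suc n"
      by (simp_all add: kap_def)
    have "tower_step (2 + n) (3 / 2 - 9 / 100 / 2 ^ n) (3 / 2 - 9 / 100 / 2 ^ Suc n)
      (((3 / 2 - 9 / 100 / 2 ^ n) + (3 / 2 - 9 / 100 / 2 ^ Suc n)) / 2)"
      using Suc.IH[unfolded 3 k] by (rule tower_step_ge_2)
    from tower_step.lgE_ge_rho_Suc[OF this Suc.prems[unfolded 3]]
    show ?thesis by (simp only: 3 k)
  qed
qed

section \<open>Translation to the iterated logarithms of the theorem\<close>

lemma iter_ln_numeral: "iter_ln 1 x = ln x" "iter_ln 2 x = ln (ln x)" "iter_ln 3 x = ln (ln (ln x))"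
  by (simp_all add: iter_ln_def numeral_2_eq_2 numeral_3_eq_3)

lemma iter_ln_add_3: "iter_ln (3 + i) x = (ln ^^ i) (ln (ln (ln x)))"
  by (simp add: iter_ln_def numeral_3_eq_3 funpow_ln_Suc del: funpow.simps)

text \<open>Positivity of the intermediate iterates allows each \<open>ln\<close> to be undone by
  \<open>exp\<close>; with default values the conclusion could fail.\<close>

lemma tower_le_of_funpow_ln_ge:
  assumes "1 \<le> (ln ^^ j) v" "\<And>i. i < j \<Longrightarrow> 0 < (ln ^^ i) v"
  shows "tower j 1 \<le> (v :: real)"
  using assms
proof (induction j arbitrary: v)
  case (Suc j)
  have v: "0 < v" using Suc.prems(2)[of 0] by simp
  have "tower j 1 \<le> ln v"
  proof (rule Suc.IH)
    show "1 \<le> (ln ^^ j) (ln v)" using Suc.prems(1) by (simp only: funpow_ln_Suc)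
    show "0 < (ln ^^ i) (ln v)" if "i < j" for i
      using Suc.prems(2)[of "Suc i"] that by (simp only: funpow_ln_Suc Suc_less_eq)
  qed
  then show ?case using v by (simp add: tower_Suc ln_ge_iff)
qed simp

lemma logprod_eq_prod: "logprod j v = (\<Prod>i<j. (ln ^^ i) v)"
proof (induction j arbitrary: v)
  case (Suc j)
  show ?case by (simp add: prod.lessThan_Suc_shift Suc funpow_ln_Suc del: funpow.simps(2) prod.lessThan_Suc)
qed simp

lemma prod_iter_ln: "(\<Prod>j=3..3 + i. iter_ln j x) = logprod i (ln (ln (ln x))) * (ln ^^ i) (ln (ln (ln x)))"
proof -
  have "(\<Prod>j=3..3 + i. iter_ln j x) = (\<Prod>j=0..i. iter_ln (3 + j) x)"
    using prod.shift_bounds_cl_nat_ivl[of "\<lambda>j. iter_ln j x" 0 3 i] by (simp add: add.commute)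
  also have "\<dots> = (\<Prod>j\<le>i. (ln ^^ j) (ln (ln (ln x))))" by (simp add: iter_ln_add_3 atMost_atLeast0)
  also have "\<dots> = (\<Prod>j<Suc i. (ln ^^ j) (ln (ln (ln x))))" by (simp only: lessThan_Suc_atMost)
  also have "\<dots> = logprod i (ln (ln (ln x))) * (ln ^^ i) (ln (ln (ln x)))"
    unfolding logprod_eq_prod by (rule prod.lessThan_Suc)
  finally show ?thesis .
qed

lemma kap_less: "kap j < 3 / 2"
  by (simp add: kap_def)

lemma ln_card_egyptian: "ln (real (card (egyptian N))) = ln 2 * lgE N"
  by (simp add: lgE_def log_def)

lemma ln_card_egyptian_ge:
  assumes "2 * a \<le> lgE N"
  shows "2 * ln 2 * a \<le> ln (real (card (egyptian N)))"
  using mult_left_mono[OF assms, of "ln 2"] by (simp add: ln_card_egyptian mult_ac)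

text \<open>The hypothesis gives ln N >= e > 2.71, just above ln 15, hence N >= 16.\<close>

lemma lgE_ge_of_ln_2:
  assumes N: "N \<ge> 1" and "1 \<le> ln (ln (real N))"
  shows "2 * (real N / ln (real N)) \<le> lgE N"
proof -
  have y: "271 / 100 \<le> ln (real N)" using assms ln_nat_cases[OF N] by (intro ln_ln_ge_1) auto
  have "ln (15::real) = ln 3 + ln 5" using ln_mult[of 3 "5::real"] by simp
  then have "ln 15 < ln (real N)" using y ln_3_bounds ln_5_bounds by linarith
  then have "15 < real N" using N by (subst (asm) ln_less_cancel_iff) auto
  then have "218 / 100 * (real N / ln (real N)) \<le> lgE N" by (intro lgE_ge) simp
  moreover have "0 \<le> real N / ln (real N)" using y by simp
  ultimately show ?thesis by linarith
qed

lemma lgE_ge_of_ln_3: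
  assumes N: "N \<ge> 1" and "0 < ln (ln (real N))" "1 \<le> ln (ln (ln (real N)))"
  shows "2 * (real N / ln (real N) * ln (ln (ln (real N)))) \<le> lgE N"
proof -
  have "15 \<le> ln (real N)"
    using assms(3,2) ln_nat_cases[OF N assms(2)] by (rule ln_ln_ln_ge_1)
  then show ?thesis using lgE_ge_ln3[OF N] by (simp only: mult.assoc)
qed

text \<open>(1 - (3/2) / t) times the whole product equals \<open>logprod i v * (t - 3 / 2)\<close>,
  which is at most \<open>rho\<close> at level \<open>i = k - 3\<close> because
  \<open>kap i < 3 / 2\<close>.\<close>

lemma lgE_ge_of_ln_ge_4:
  assumes N: "N \<ge> 1" and k: "k \<ge> 4" "iter_ln_defined k (real N)" "3 / 2 \<le> iter_ln k (real N)"
  shows "2 * (real N / ln (real N) * ((1 - (3 / 2) / iter_ln k (real N)) * (\<Prod>j=3..k. iter_ln j (real N)))) \<le> lgE N"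
proof -
  define i v t where "i = k - 3" and "v = ln (ln (ln (real N)))" and "t = (ln ^^ i) v"
  have ki: "k = 3 + i" using k by (simp add: i_def)
  have tk: "iter_ln k (real N) = t" by (simp only: ki iter_ln_add_3 t_def v_def)
  then have t: "3 / 2 \<le> t" using k by simp
  have pos: "0 < iter_ln j (real N)" if "j < k" for j using k that by (simp add: iter_ln_defined_def)
  have v: "tower i 1 \<le> v"
  proof (rule tower_le_of_funpow_ln_ge)
    show "1 \<le> (ln ^^ i) v" using t unfolding t_def by linarith
    show "0 < (ln ^^ l) v" if "l < i" for l
      using pos[of "3 + l"] that unfolding iter_ln_add_3 v_def ki by simp
  qed
  have U0: "0 < ln (ln (real N))" using pos[of 2] k by (simp add: iter_ln_numeral)
  have v1: "1 \<le> v" using v tower_ge_1[of 1 i] by simp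
  then have "exp 1 \<le> ln (ln (real N))" using U0 by (simp add: v_def ln_ge_iff)
  then have U1: "1 \<le> ln (ln (real N))" using e_ge by linarith
  have y: "0 < ln (real N)" using ln_nat_cases[OF N U0] .
  have P: "1 \<le> logprod i v" using v by (rule logprod_ge_1)
  have "logprod i v * (t - 3 / 2) \<le> rho i (kap i) v"
    unfolding rho_eq t_def using P kap_less[of i] by (intro mult_left_mono) auto
  then have "2 * (real N / ln (real N)) * (logprod i v * (t - 3 / 2)) \<le>
      2 * (real N / ln (real N)) * rho i (kap i) v"
    using y by (intro mult_left_mono) auto
  also have "\<dots> \<le> lgE N" unfolding v_def by (rule lgE_ge_rho[OF N v[unfolded v_def] U1])
  also have "logprod i v * (t - 3 / 2) = (1 - (3 / 2) / t) * (logprod i v * t)"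
  proof -
    have "(3 / 2) / t * t = 3 / 2" using t by (intro nonzero_eq_divide_eq[THEN iffD1] refl) linarith
    then have "(1 - (3 / 2) / t) * t = t - 3 / 2" by (simp only: left_diff_distrib mult_1)
    then show ?thesis by (simp only: mult.left_commute)
  qed
  also have "logprod i v * t = (\<Prod>j=3..k. iter_ln j (real N))"
    unfolding ki prod_iter_ln t_def v_def by (rule refl)
  finally show ?thesis by (simp only: tk mult.assoc)
qed

theorem theorem1:
  fixes N k :: nat
  assumes "N > 0" and "k > 0"
  shows "(iter_ln_defined 2 (real N) \<and> iter_ln 2 (real N) \<ge> 1 \<longrightarrow>
            ln (real (card (egyptian N))) \<ge> 2 * ln 2 * (real N / ln (real N))) \<and>
         (iter_ln_defined 3 (real N) \<and> iter_ln 3 (real N) \<ge> 1 \<longrightarrow>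
            ln (real (card (egyptian N))) \<ge> 2 * ln 2 * (real N / ln (real N)) * iter_ln 3 (real N)) \<and>
         (k \<ge> 4 \<and> iter_ln_defined k (real N) \<and> iter_ln k (real N) \<ge> 3 / 2 \<longrightarrow>
            ln (real (card (egyptian N))) \<ge>
              2 * ln 2 * (real N / ln (real N)) * (1 - (3 / 2) / iter_ln k (real N)) *
              (\<Prod>j=3..k. iter_ln j (real N)))"
proof (intro conjI impI)
  have N: "N \<ge> 1" using assms by simp
  note bound = ln_card_egyptian_ge[OF lgE_ge_of_ln_2[OF N]]
    ln_card_egyptian_ge[OF lgE_ge_of_ln_3[OF N]] ln_card_egyptian_ge[OF lgE_ge_of_ln_ge_4[OF N]]
  show "2 * ln 2 * (real N / ln (real N)) \<le> ln (real (card (egyptian N)))"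
    if "iter_ln_defined 2 (real N) \<and> iter_ln 2 (real N) \<ge> 1"
    using that by (intro bound(1)) (simp add: iter_ln_numeral)
  show "2 * ln 2 * (real N / ln (real N)) * iter_ln 3 (real N) \<le> ln (real (card (egyptian N)))"
    if "iter_ln_defined 3 (real N) \<and> iter_ln 3 (real N) \<ge> 1"
  proof -
    have "0 < iter_ln 2 (real N)" using that by (simp add: iter_ln_defined_def)
    then show ?thesis using bound(2) that unfolding iter_ln_numeral mult.assoc by blast
  qed
  show "2 * ln 2 * (real N / ln (real N)) * (1 - (3 / 2) / iter_ln k (real N)) *
      (\<Prod>j=3..k. iter_ln j (real N)) \<le> ln (real (card (egyptian N)))"
    if "k \<ge> 4 \<and> iter_ln_defined k (real N) \<and> iter_ln k (real N) \<ge> 3 / 2"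
    using bound(3)[of k] that unfolding mult.assoc by blast
qed

end
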